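(* Let $K$ be a field, $N\geq 1$, and let $R$ be a quadric $K$-algebra of solvable type with respect to $x=(x_1,\dots,x_N)$ and a monomial ordering $\leq$ of $\mathbb{N}^N$. Let $d\in\mathbb{N}$. Then every left ideal of $R$ generated by elements of degree at most $d$ has a Gröbner basis (with respect to $\leq$) consisting of elements of degree at most $$D(N,d):=2\left(\frac{d^2}{2}+d\right)^{2^{N-1}}.$$
   Context: Here $\mathbb{N}=\{0,1,2,\dots\}$ and $|\alpha|=\alpha_1+\cdots+\alpha_N$ for $\alpha\in\mathbb{N}^N$. A monomial ordering of $\mathbb{N}^N$ is a total ordering compatible with addition whose smallest element is $0$. $K$-algebras are associative with unit. For a $K$-algebra $R$ and $x=(x_1,\dots,x_N)\in R^N$ put $x^\alpha:=x_1^{\alpha_1}\cdots x_N^{\alpha_N}$; these are the monomials. $R$ is of solvable type with respect to $x$ and $\leq$ if $\{x^\alpha\}_{\alpha\in\mathbb{N}^N}$ is a $K$-basis of $R$ and for $1\leq i<j\leq N$ there are $0\neq c_{ij}\in K$ and $p_{ij}\in R$ with $x_jx_i=c_{ij}x_ix_j+p_{ij}$ and $\operatorname{lm}(p_{ij})<x_ix_j$. Here monomials are ordered by $x^\alpha\leq x^\beta\iff\alpha\leq\beta$, $\operatorname{lm}(f)$ is the $\leq$-largest monomial occurring in $f\neq 0$, and $\operatorname{lm}(0):=0$ is smaller than every monomial. $R$ is quadric if each $p_{ij}$ is a $K$-linear combination of monomials $x^\alpha$ with $|\alpha|\leq 2$. The degree of a nonzero $f\in R$ is the smallest $e$ such that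 $f$ is a $K$-linear combination of products (words) of at most $e$ of the generators $x_1,\dots,x_N$; for quadric $R$ this equals the maximum of $|\alpha|$ over the monomials $x^\alpha$ occurring in $f$. The zero element satisfies every degree bound. A monomial $x^\alpha$ divides $x^\beta$ if $\alpha_i\leq\beta_i$ for all $i$. A Gröbner basis of a left ideal $I$ of $R$ is a finite set $G\subseteq I$ generating $I$ as a left ideal such that for every nonzero $f\in I$ there is a nonzero $g\in G$ with $\operatorname{lm}(g)\mid\operatorname{lm}(f)$. *)

theory Defs
  imports Complex_Main "HOL-Library.Poly_Mapping"
begin

text \<open>
  \<open>\<nat>\<^sup>N\<close> is encoded as the finitely supported functions vanishing outside \<open>{1..N}\<close>; only the values
  \<open>x 1, \<dots>, x N\<close> of the sequence \<open>x\<close> are ever used.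
\<close>

definition exponents :: "nat \<Rightarrow> (nat \<Rightarrow>\<^sub>0 nat) set" where
  "exponents N = {\<alpha>. Poly_Mapping.keys \<alpha> \<subseteq> {1..N}}"

definition total_degree :: "nat \<Rightarrow> (nat \<Rightarrow>\<^sub>0 nat) \<Rightarrow> nat" where
  "total_degree N \<alpha> = (\<Sum>i = 1..N. Poly_Mapping.lookup \<alpha> i)"

definition exp_divides :: "nat \<Rightarrow> (nat \<Rightarrow>\<^sub>0 nat) \<Rightarrow> (nat \<Rightarrow>\<^sub>0 nat) \<Rightarrow> bool" where
  "exp_divides N \<alpha> \<beta> \<longleftrightarrow>
     (\<forall>i\<in>{1..N}. Poly_Mapping.lookup \<alpha> i \<le> Poly_Mapping.lookup \<beta> i)"

definition monomial_ordering :: "nat \<Rightarrow> (nat \<Rightarrow>\<^sub>0 nat) rel \<Rightarrow> bool" where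
  "monomial_ordering N r \<longleftrightarrow>
     linear_order_on (exponents N) r \<and>
     (\<forall>\<alpha>\<in>exponents N. \<forall>\<beta>\<in>exponents N. \<forall>\<gamma>\<in>exponents N.
        (\<alpha>, \<beta>) \<in> r \<longrightarrow> (\<alpha> + \<gamma>, \<beta> + \<gamma>) \<in> r) \<and>
     (\<forall>\<alpha>\<in>exponents N. (0, \<alpha>) \<in> r)"

text \<open>The ring need not be commutative, so the order of the factors matters.\<close>

definition monomial :: "nat \<Rightarrow> (nat \<Rightarrow> 'r::ring_1) \<Rightarrow> (nat \<Rightarrow>\<^sub>0 nat) \<Rightarrow> 'r" where
  "monomial N x \<alpha> = prod_list (map (\<lambda>i. x i ^ Poly_Mapping.lookup \<alpha> i) [1..<Suc N])"

definition left_ideal :: "'r::ring_1 set \<Rightarrow> bool" where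
  "left_ideal I \<longleftrightarrow>
     0 \<in> I \<and> (\<forall>f\<in>I. \<forall>g\<in>I. f + g \<in> I) \<and> (\<forall>a. \<forall>f\<in>I. a * f \<in> I)"

locale k_algebra = vector_space scale
  for scale :: "'k::field \<Rightarrow> 'r::ring_1 \<Rightarrow> 'r" (infixr \<open>*s\<close> 75) +
  assumes scale_mult_left: "(c *s a) * b = c *s (a * b)"
    and mult_scale_right: "a * (c *s b) = c *s (a * b)"
begin

definition monomial_basis :: "nat \<Rightarrow> (nat \<Rightarrow> 'r) \<Rightarrow> bool" where
  "monomial_basis N x \<longleftrightarrow>
     inj_on (monomial N x) (exponents N) \<and>
     independent (monomial N x ` exponents N) \<and>
     span (monomial N x ` exponents N) = UNIV"

text \<open>
  The exponents of the monomials occurring in an element, and the exponent of the leading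
  monomial. The latter is meaningful only for nonzero elements; the convention that the leading
  monomial of zero lies below every monomial is spelled out in \<open>lm_less\<close>.
\<close>

definition occurring :: "nat \<Rightarrow> (nat \<Rightarrow> 'r) \<Rightarrow> 'r \<Rightarrow> (nat \<Rightarrow>\<^sub>0 nat) set" where
  "occurring N x f =
     {\<alpha> \<in> exponents N. representation (monomial N x ` exponents N) f (monomial N x \<alpha>) \<noteq> 0}"

definition lm :: "nat \<Rightarrow> (nat \<Rightarrow> 'r) \<Rightarrow> (nat \<Rightarrow>\<^sub>0 nat) rel \<Rightarrow> 'r \<Rightarrow> (nat \<Rightarrow>\<^sub>0 nat)" where
  "lm N x r f = (THE \<alpha>. \<alpha> \<in> occurring N x f \<and> (\<forall>\<beta>\<in>occurring N x f. (\<beta>, \<alpha>) \<in> r))"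

definition lm_less ::
    "nat \<Rightarrow> (nat \<Rightarrow> 'r) \<Rightarrow> (nat \<Rightarrow>\<^sub>0 nat) rel \<Rightarrow> 'r \<Rightarrow> (nat \<Rightarrow>\<^sub>0 nat) \<Rightarrow> bool" where
  "lm_less N x r f \<alpha> \<longleftrightarrow> f = 0 \<or> ((lm N x r f, \<alpha>) \<in> r \<and> lm N x r f \<noteq> \<alpha>)"

definition commutation_relation ::
    "nat \<Rightarrow> (nat \<Rightarrow> 'r) \<Rightarrow> (nat \<Rightarrow>\<^sub>0 nat) rel \<Rightarrow> nat \<Rightarrow> nat \<Rightarrow> 'k \<Rightarrow> 'r \<Rightarrow> bool" where
  "commutation_relation N x r i j c p \<longleftrightarrow>
     c \<noteq> 0 \<and> x j * x i = c *s (x i * x j) + p \<and>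
     lm_less N x r p (Poly_Mapping.single i 1 + Poly_Mapping.single j 1)"

definition solvable_type :: "nat \<Rightarrow> (nat \<Rightarrow> 'r) \<Rightarrow> (nat \<Rightarrow>\<^sub>0 nat) rel \<Rightarrow> bool" where
  "solvable_type N x r \<longleftrightarrow>
     monomial_basis N x \<and>
     (\<forall>i j. 1 \<le> i \<and> i < j \<and> j \<le> N \<longrightarrow> (\<exists>c p. commutation_relation N x r i j c p))"

text \<open>
  In an algebra of solvable type the monomial basis determines \<open>c\<close> and \<open>p\<close> in a commutation
  relation, so the quantification over them below just refers to the unique such pair.
\<close>

definition quadric :: "nat \<Rightarrow> (nat \<Rightarrow> 'r) \<Rightarrow> (nat \<Rightarrow>\<^sub>0 nat) rel \<Rightarrow> bool" where
  "quadric N x r \<longleftrightarrow>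
     (\<forall>i j c p. 1 \<le> i \<and> i < j \<and> j \<le> N \<and> commutation_relation N x r i j c p \<longrightarrow>
        p \<in> span (monomial N x ` {\<alpha> \<in> exponents N. total_degree N \<alpha> \<le> 2}))"

text \<open>
  Since the span contains zero for every \<open>e\<close>, the zero element gets degree zero and thus
  satisfies every degree bound.
\<close>

definition degree :: "nat \<Rightarrow> (nat \<Rightarrow> 'r) \<Rightarrow> 'r \<Rightarrow> nat" where
  "degree N x f =
     (LEAST e. f \<in> span {prod_list (map x w) |w. set w \<subseteq> {1..N} \<and> length w \<le> e})"

definition groebner_basis ::
    "nat \<Rightarrow> (nat \<Rightarrow> 'r) \<Rightarrow> (nat \<Rightarrow>\<^sub>0 nat) rel \<Rightarrow> 'r set \<Rightarrow> 'r set \<Rightarrow> bool" where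
  "groebner_basis N x r I G \<longleftrightarrow>
     finite G \<and> G \<subseteq> I \<and> left_ideal hull G = I \<and>
     (\<forall>f\<in>I. f \<noteq> 0 \<longrightarrow> (\<exists>g\<in>G. g \<noteq> 0 \<and> exp_divides N (lm N x r g) (lm N x r f)))"

end

definition D_bound :: "nat \<Rightarrow> nat \<Rightarrow> real" where
  "D_bound N d = 2 * ((real d)\<^sup>2 / 2 + real d) ^ (2 ^ (N - 1))"

end

theory Submission
  imports Defs "HOL-Computational_Algebra.Computational_Algebra" "HOL-Library.Multiset"
begin

text \<open>
  The argument adapts Dube's proof for polynomial ideals and uses only Hilbert series. Pairs
  \<open>(f, t)\<close> with \<open>f\<close> of degree at most \<open>t\<close> play the role of homogeneous elements of degree \<open>t\<close> in the
  Rees algebra of \<open>R\<close>, in \<open>n = N + 1\<close> variables. The generators, all regarded as having degree \<open>d\<close>,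
  are added one at a time; a generator \<open>f\<close> contributes the standard monomials of the colon ideal
  \<open>J : f\<close>, shifted by \<open>d\<close>, where \<open>J\<close> is generated by its predecessors. Standard monomials split into
  cones, which bound the degrees of the minimal leading monomials. Both the standard monomials of
  \<open>I\<close> and \<open>I\<close> without the contribution of its first generator then have Hilbert series of exact
  cone decompositions, which are governed by decreasing thresholds \<open>b\<close> and \<open>a\<close>. As the two series
  add up to \<open>(1 - X\<^sup>d) / (1 - X)\<^sup>n\<close>, an expansion at \<open>X = 1\<close> expresses \<open>a\<^sub>j + b\<^sub>j\<close> by
  the later thresholds, and the doubly exponential bound follows by induction.
\<close>

section \<open>Cone decompositions and their Hilbert series\<close>

text \<open>The ordering need not respect total degree, so an element with a small leading monomial
  may have a large degree; passing to pairs records the degree next to the leading exponent.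
  Quadricity makes this work: rewriting a word produces only words of no greater length and
  exponent, so leading exponents add under multiplication at every level and there are no zero
  divisors. The first generator is set apart because its colon ideal is zero: it contributes a full
  cone in degree d, and once that is removed all cones have dimension below n, with a_n = d and b_n
  = 0 as initial values. Giving all generators the same degree d makes every further contribution
  start in degree d, so that together they form one decomposition that is standard from d on. A cone
  survives only as a pair of numbers; cones may thus be split and raised freely without tracking
  which monomials they hold. The exponent in the bound counts dimensions: n - 1 steps lead from
  dimension n down to 1, the first yields 2d and each later one roughly squares, whence 2^(n-2) =
  2^(N-1).\<close>

definition geom :: "int fps" where
  "geom = Abs_fps (\<lambda>_. 1)"

text \<open>
  A pair \<open>(e, k)\<close> stands for a cone: a monomial of degree \<open>e\<close> times all monomials in \<open>k\<close> of the
  variables, with Hilbert series \<open>X\<^sup>e / (1 - X)\<^sup>k\<close>.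
\<close>

definition cone_series :: "(nat \<times> nat) multiset \<Rightarrow> int fps" where
  "cone_series P = (\<Sum>(e, k)\<in>#P. fps_X ^ e * geom ^ k)"

text \<open>Dube's \<open>q\<close>-standard decompositions, reduced to degrees and dimensions.
  Points (\<open>k = 0\<close>) are exempt because raising a cone scatters them over arbitrary low
  degrees.\<close>

definition standard :: "nat \<Rightarrow> (nat \<times> nat) multiset \<Rightarrow> bool" where
  "standard q P \<longleftrightarrow> (\<forall>e k. (e, k) \<in># P \<longrightarrow> 0 < k \<longrightarrow>
     q \<le> e \<and> (\<forall>c\<in>{q..e}. \<exists>l\<ge>k. (c, l) \<in># P))"

text \<open>
  In an exact decomposition exactly one cone of dimension \<open>k\<close> starts in each degree from
  \<open>a (Suc k)\<close> to \<open>a k - 1\<close>, while \<open>Z\<close> lists the degrees of the cones of dimension 0.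
\<close>

definition exact_series :: "nat \<Rightarrow> (nat \<Rightarrow> nat) \<Rightarrow> nat multiset \<Rightarrow> int fps" where
  "exact_series n a Z =
     (\<Sum>e\<in>#Z. fps_X ^ e) + (\<Sum>k=1..n. \<Sum>e=a (Suc k)..<a k. fps_X ^ e * geom ^ k)"

lemma geom_mult: "(1 - fps_X) * geom = 1"
proof (rule fps_ext)
  fix n show "((1 - fps_X) * geom) $ n = 1 $ n"
    by (cases n) (simp_all add: geom_def left_diff_distrib)
qed

lemma geom_power_Suc: "geom ^ Suc k = geom ^ k + fps_X * geom ^ Suc k"
proof -
  have "geom ^ Suc k - fps_X * geom ^ Suc k = (1 - fps_X) * geom * geom ^ k"
    by (simp add: algebra_simps)
  then show ?thesis
    by (simp add: geom_mult diff_eq_eq)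
qed

lemma cone_series_empty [simp]: "cone_series {#} = 0"
  by (simp add: cone_series_def)

lemma cone_series_add_mset [simp]:
  "cone_series (add_mset p P) = fps_X ^ fst p * geom ^ snd p + cone_series P"
  by (simp add: cone_series_def case_prod_unfold)

lemma cone_series_union [simp]: "cone_series (P + Q) = cone_series P + cone_series Q"
  by (simp add: cone_series_def)

lemma cone_series_shift:
  "cone_series (image_mset (\<lambda>(e, k). (e + c, k)) P) = fps_X ^ c * cone_series P"
  by (induction P) (auto simp: power_add algebra_simps)

lemma cone_series_zero_dim:
  "\<forall>p\<in>#P. snd p = 0 \<Longrightarrow> cone_series P = (\<Sum>e\<in>#image_mset fst P. fps_X ^ e)"
  by (induction P) auto

lemma standardD:
  assumes "standard q P" "(e, k) \<in># P" "0 < k"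
  shows "q \<le> e" "c \<in> {q..e} \<Longrightarrow> \<exists>l\<ge>k. (c, l) \<in># P"
  using assms unfolding standard_def by blast+

lemma standard_union:
  assumes "standard q P" "standard q Q"
  shows "standard q (P + Q)"
  unfolding standard_def
proof (intro allI impI)
  fix e k assume "(e, k) \<in># P + Q" "0 < k"
  then show "q \<le> e \<and> (\<forall>c\<in>{q..e}. \<exists>l\<ge>k. (c, l) \<in># P + Q)"
    using standardD[OF assms(1), of e k] standardD[OF assms(2), of e k]
    by (metis union_iff)
qed

lemma standard_shift:
  assumes "standard q P"
  shows "standard (q + c) (image_mset (\<lambda>(e, k). (e + c, k)) P)"
  unfolding standard_def
proof (intro allI impI conjI ballI)
  fix e k assume ek: "(e, k) \<in># image_mset (\<lambda>(e, k). (e + c, k)) P" "0 < k"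
  then have P: "(e - c, k) \<in># P" and ce: "c \<le> e"
    by auto
  note * = standardD[OF assms P ek(2)]
  show "q + c \<le> e"
    using *(1) ce by simp
  fix d assume d: "d \<in> {q + c..e}"
  then have "d - c \<in> {q..e - c}"
    by auto
  from *(2)[OF this] obtain l where l: "l \<ge> k" "(d - c, l) \<in># P"
    by blast
  have "(\<lambda>(e, k). (e + c, k)) (d - c, l) = (d, l)"
    using d by simp
  with l show "\<exists>l\<ge>k. (d, l) \<in># image_mset (\<lambda>(e, k). (e + c, k)) P"
    by (metis image_eqI set_image_mset)
qed

section \<open>Raising cones and making decompositions exact\<close>

lemma raise_cone_step:
  assumes "e \<le> c"
  shows "fps_X ^ e * geom ^ Suc k =
    fps_X ^ c * geom ^ Suc k + (\<Sum>j=e..<c. fps_X ^ j * geom ^ k)"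
  using assms
proof (induction c rule: dec_induct)
  case (step c)
  have "fps_X ^ c * geom ^ Suc k = fps_X ^ c * (geom ^ k + fps_X * geom ^ Suc k)"
    by (rule arg_cong[OF geom_power_Suc])
  also have "\<dots> = fps_X ^ Suc c * geom ^ Suc k + fps_X ^ c * geom ^ k"
    by (simp add: distrib_left mult.assoc power_Suc2 del: power_Suc)
  finally show ?case
    using step.hyps by (simp add: step.IH add.assoc add.commute del: power_Suc)
qed simp

lemma raise_sum:
  assumes "\<And>j. j \<in> A \<Longrightarrow> \<exists>Q. cone_series Q = f j \<and> (\<forall>p\<in>#Q. R p)"
  shows "\<exists>Q. cone_series Q = (\<Sum>j\<in>A. f j) \<and> (\<forall>p\<in>#Q. R p)"
  using assms
proof (induction A rule: infinite_finite_induct)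
  case (insert x F)
  obtain Q1 where Q1: "cone_series Q1 = f x" "\<forall>p\<in>#Q1. R p"
    using insert.prems[of x] by blast
  obtain Q2 where Q2: "cone_series Q2 = (\<Sum>j\<in>F. f j)" "\<forall>p\<in>#Q2. R p"
    using insert.IH insert.prems by blast
  have "cone_series (Q1 + Q2) = (\<Sum>j\<in>insert x F. f j)"
    using insert.hyps Q1(1) Q2(1) by simp
  moreover have "\<forall>p\<in>#Q1 + Q2. R p"
    using Q1(2) Q2(2) by auto
  ultimately show ?case by blast
next
  case (infinite A)
  have "cone_series {#} = (\<Sum>j\<in>A. f j)" "\<forall>p\<in>#{#}. R p"
    using infinite.hyps by simp_all
  then show ?case by blast
next
  case empty
  have "cone_series {#} = (\<Sum>j\<in>{}. f j)" "\<forall>p\<in>#{#}. R p"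
    by simp_all
  then show ?case by blast
qed

text \<open>\<open>raise_cone_step\<close> trades a cone for its translate in degree
  \<open>c\<close> and slices of one dimension less in degrees \<open>e\<close> to
  \<open>c - 1\<close>. Raising the slices in turn leaves only points away from
  \<open>c\<close>.\<close>

lemma raise_cone:
  assumes "e \<le> c"
  shows "\<exists>Q. cone_series Q = fps_X ^ e * geom ^ k \<and>
    (\<forall>p\<in>#Q. snd p \<le> k \<and> (0 < snd p \<longrightarrow> fst p = c))"
  using assms
proof (induction k arbitrary: e)
  case 0
  show ?case by (intro exI[of _ "{#(e, 0)#}"]) auto
next
  case (Suc k)
  have "\<exists>Q. cone_series Q = (\<Sum>j=e..<c. fps_X ^ j * geom ^ k) \<and>
    (\<forall>p\<in>#Q. snd p \<le> k \<and> (0 < snd p \<longrightarrow> fst p = c))"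
    by (rule raise_sum, rule Suc.IH) auto
  then obtain Q where Q: "cone_series Q = (\<Sum>j=e..<c. fps_X ^ j * geom ^ k)"
    "\<forall>p\<in>#Q. snd p \<le> k \<and> (0 < snd p \<longrightarrow> fst p = c)" by blast
  show ?case
    using Q raise_cone_step[OF Suc.prems, of k]
    by (intro exI[of _ "add_mset (c, Suc k) Q"]) auto
qed

lemma raise_cone_lower:
  assumes "e \<le> t" "t \<le> c"
  shows "\<exists>Q. fps_X ^ e * geom ^ Suc k = fps_X ^ t * geom ^ Suc k + cone_series Q \<and>
    (\<forall>p\<in>#Q. snd p \<le> k \<and> (0 < snd p \<longrightarrow> fst p = c))"
proof -
  have "\<exists>Q. cone_series Q = (\<Sum>j=e..<t. fps_X ^ j * geom ^ k) \<and>
    (\<forall>p\<in>#Q. snd p \<le> k \<and> (0 < snd p \<longrightarrow> fst p = c))"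
    by (rule raise_sum, rule raise_cone) (use assms in auto)
  then obtain Q where "cone_series Q = (\<Sum>j=e..<t. fps_X ^ j * geom ^ k)"
    "\<forall>p\<in>#Q. snd p \<le> k \<and> (0 < snd p \<longrightarrow> fst p = c)" by blast
  then show ?thesis
    unfolding raise_cone_step[OF assms(1), of k] by (intro exI[of _ Q]) simp
qed

text \<open>The largest element of \<open>D\<close> is at most \<open>q + size D - 1\<close>, since
  all degrees from \<open>q\<close> up to it occur. Raising it to exactly this degree occupies the
  top slot; dropping one copy of the maximum opens no gap, so the rest spreads over the lower slots.
  The slices split off on the way go to the common degree \<open>c\<close>.\<close>

lemma gap_free_spread:
  assumes "\<And>v. v \<in># D \<Longrightarrow> q \<le> v \<and> {q..v} \<subseteq> set_mset D" "q + size D \<le> c"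
  shows "(\<forall>v\<in>#D. v < q + size D) \<and>
    (\<exists>Q. (\<Sum>e\<in>#D. fps_X ^ e * geom ^ Suc k) =
        (\<Sum>e=q..<q + size D. fps_X ^ e * geom ^ Suc k) + cone_series Q \<and>
      (\<forall>p\<in>#Q. snd p \<le> k \<and> (0 < snd p \<longrightarrow> fst p = c)))"
  using assms
proof (induction "size D" arbitrary: D)
  case 0
  then have "D = {#}"
    by simp
  then show ?case
    by (intro conjI exI[of _ "{#}"]) simp_all
next
  case (Suc m)
  define v where "v = Max (set_mset D)"
  have "D \<noteq> {#}"
    using Suc(2) by auto
  then have v: "v \<in># D" "\<And>w. w \<in># D \<Longrightarrow> w \<le> v"
    unfolding v_def by auto
  define D' where "D' = D - {#v#}"
  have D: "D = add_mset v D'"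
    using v(1) by (simp add: D'_def)
  have size: "size D = Suc m" "size D' = m"
    using Suc(2) D by simp_all
  have "card {q..v} \<le> card (set_mset D)"
    using Suc.prems(1)[OF v(1)] by (intro card_mono) auto
  also have "\<dots> \<le> size D"
    unfolding size_multiset_overloaded_eq card_eq_sum by (rule sum_mono) (simp add: Suc_le_eq)
  finally have vm: "v \<le> q + m"
    using size by simp
  have gap: "q \<le> w \<and> {q..w} \<subseteq> set_mset D'" if "w \<in># D'" for w
  proof -
    have w: "w \<in># D" "w \<le> v"
      using that v(2) by (auto simp: D'_def dest: in_diffD)
    have "u \<in># D'" if "u \<in> {q..w}" for u
    proof (cases "u = v")
      case True
      with that w(2) have "u = w" by simp
      with \<open>w \<in># D'\<close> show ?thesis by simp
    next
      case False
      have "u \<in># D" using Suc.prems(1)[OF w(1)] that by auto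
      with False show ?thesis by (metis D insertE set_mset_add_mset_insert)
    qed
    with Suc.prems(1)[OF w(1)] show ?thesis by auto
  qed
  have IH: "(\<forall>v\<in>#D'. v < q + size D') \<and>
    (\<exists>Q. (\<Sum>e\<in>#D'. fps_X ^ e * geom ^ Suc k) =
        (\<Sum>e=q..<q + size D'. fps_X ^ e * geom ^ Suc k) + cone_series Q \<and>
      (\<forall>p\<in>#Q. snd p \<le> k \<and> (0 < snd p \<longrightarrow> fst p = c)))"
    by (rule Suc.hyps(1)[OF size(2)[symmetric] gap]) (use Suc.prems(2) size in simp_all)
  then obtain Q where Q: "(\<Sum>e\<in>#D'. fps_X ^ e * geom ^ Suc k) =
        (\<Sum>e=q..<q + size D'. fps_X ^ e * geom ^ Suc k) + cone_series Q"
      "\<forall>p\<in>#Q. snd p \<le> k \<and> (0 < snd p \<longrightarrow> fst p = c)" by blast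
  obtain Q' where Q': "fps_X ^ v * geom ^ Suc k = fps_X ^ (q + m) * geom ^ Suc k + cone_series Q'"
     "\<forall>p\<in>#Q'. snd p \<le> k \<and> (0 < snd p \<longrightarrow> fst p = c)"
    using raise_cone_lower[OF vm, of c k] Suc.prems(2) size by auto
  have "(\<Sum>e\<in>#D. fps_X ^ e * geom ^ Suc k) =
        (\<Sum>e=q..<q + size D. fps_X ^ e * geom ^ Suc k) + cone_series (Q + Q')"
    using Q(1) Q'(1) size by (simp add: D del: power_Suc)
  moreover have "\<forall>p\<in>#Q + Q'. snd p \<le> k \<and> (0 < snd p \<longrightarrow> fst p = c)"
    using Q(2) Q'(2) by auto
  moreover have "\<forall>w\<in>#D. w < q + size D"
    using v(2) vm size by fastforce
  ultimately show ?case by blast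
qed

lemma raise_cones:
  assumes "\<forall>p\<in>#P. snd p \<le> k \<and> fst p \<le> c"
  shows "\<exists>Q. cone_series Q = cone_series P \<and>
    (\<forall>p\<in>#Q. snd p \<le> k \<and> (0 < snd p \<longrightarrow> fst p = c))"
  using assms
proof (induction P)
  case (add p P)
  then obtain Q1 where "cone_series Q1 = cone_series P"
    "\<forall>p\<in>#Q1. snd p \<le> k \<and> (0 < snd p \<longrightarrow> fst p = c)" by auto
  moreover obtain Q2 where "cone_series Q2 = fps_X ^ fst p * geom ^ snd p"
    "\<forall>r\<in>#Q2. snd r \<le> snd p \<and> (0 < snd r \<longrightarrow> fst r = c)"
    using raise_cone[of "fst p" c "snd p"] add.prems by auto
  ultimately show ?case
    using add.prems by (intro exI[of _ "Q1 + Q2"]) (auto intro: order_trans)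
qed (rule exI[of _ "{#}"], simp)

text \<open>One level of Dube's passage to an exact decomposition. Cones of top dimension have
  gap-free starting degrees and spread over \<open>q\<close> to \<open>q' - 1\<close>; lower cones
  that start before \<open>q'\<close> are raised to \<open>q'\<close>. The last claim keeps control
  of the original degrees: whatever disappears lay below \<open>q'\<close>.\<close>

lemma standard_reduce_dimension:
  assumes std: "standard q P" and dims: "\<forall>p\<in>#P. snd p \<le> Suc k"
  shows "\<exists>q' P'. q \<le> q' \<and> standard q' P' \<and> (\<forall>p\<in>#P'. snd p \<le> k) \<and>
    cone_series P = (\<Sum>e=q..<q'. fps_X ^ e * geom ^ Suc k) + cone_series P' \<and>
    (\<forall>p\<in>#P. fst p < q' \<or> p \<in># P')"
proof -
  define T where "T = filter_mset (\<lambda>p. snd p = Suc k) P"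
  define D where "D = image_mset fst T"
  define q' where "q' = q + size D"
  define L where "L = filter_mset (\<lambda>p. snd p \<le> k \<and> 0 < snd p \<and> fst p < q') P"
  define H where "H = filter_mset (\<lambda>p. snd p \<le> k \<and> \<not> (0 < snd p \<and> fst p < q')) P"
  have "P = T + filter_mset (\<lambda>p. snd p \<noteq> Suc k) P"
    unfolding T_def by simp
  also have "filter_mset (\<lambda>p. snd p \<noteq> Suc k) P = filter_mset (\<lambda>p. snd p \<le> k) P"
    using dims by (intro filter_mset_cong) auto
  also have "\<dots> = L + H"
    unfolding L_def H_def by (subst multiset_partition[of _ "\<lambda>p. 0 < snd p \<and> fst p < q'"])
      (simp add: filter_filter_mset conj_commute conj_left_commute)
  finally have P: "P = T + L + H" by (simp add: add.assoc)
  have D_iff: "v \<in># D \<longleftrightarrow> (v, Suc k) \<in># P" for v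
    unfolding D_def T_def by force
  have gap: "q \<le> v \<and> {q..v} \<subseteq> set_mset D" if "v \<in># D" for v
  proof -
    have *: "q \<le> v" "\<And>c. c \<in> {q..v} \<Longrightarrow> \<exists>l\<ge>Suc k. (c, l) \<in># P"
      using standardD[OF std that[unfolded D_iff]] by auto
    have "c \<in># D" if "c \<in> {q..v}" for c
      using *(2)[OF that] dims unfolding D_iff by (metis order_antisym snd_conv)
    with * show ?thesis by auto
  qed
  obtain Q where Q: "(\<Sum>e\<in>#D. fps_X ^ e * geom ^ Suc k) =
        (\<Sum>e=q..<q'. fps_X ^ e * geom ^ Suc k) + cone_series Q"
      "\<forall>p\<in>#Q. snd p \<le> k \<and> (0 < snd p \<longrightarrow> fst p = q')"
    and Dlt: "\<forall>v\<in>#D. v < q'"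
    using gap_free_spread[of D q q' k] gap unfolding q'_def by auto
  have T: "cone_series T = (\<Sum>e\<in>#D. fps_X ^ e * geom ^ Suc k)"
    unfolding D_def cone_series_def by (simp add: multiset.map_comp T_def case_prod_unfold)
       (rule arg_cong[where f = sum_mset], rule image_mset_cong, auto)
  obtain Q' where Q': "cone_series Q' = cone_series L"
    "\<forall>p\<in>#Q'. snd p \<le> k \<and> (0 < snd p \<longrightarrow> fst p = q')"
    using raise_cones[of L k q'] unfolding L_def by auto
  define P' where "P' = Q + Q' + H"
  have "standard q' P'"
    unfolding standard_def
  proof (intro allI impI conjI ballI)
    fix e l assume el: "(e, l) \<in># P'" "0 < l"
    then consider "e = q'" | "(e, l) \<in># H"
      using Q(2) Q'(2) by (auto simp: P'_def)
    note cases = this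
    from cases el show "q' \<le> e"
      by cases (auto simp: H_def)
    fix c assume c: "c \<in> {q'..e}"
    from cases show "\<exists>m\<ge>l. (c, m) \<in># P'"
    proof cases
      case 1
      with c el show ?thesis by auto
    next
      case 2
      then have "(e, l) \<in># P" "q \<le> c"
        using c by (auto simp: H_def q'_def)
      with el c obtain m where m: "m \<ge> l" "(c, m) \<in># P"
        using standardD(2)[OF std \<open>(e, l) \<in># P\<close>, of c] by auto
      \<comment> \<open>The filler in degree \<open>c\<close> cannot have top dimension, as all
        those cones start below \<open>q'\<close>; hence it has survived in
        \<open>H\<close>.\<close>
      have "m \<noteq> Suc k"
        using m D_iff[of c] Dlt c by auto
      with dims m(2) have "m \<le> k"
        by (metis le_SucE snd_conv)
      with m c el have "(c, m) \<in># H"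
        by (auto simp: H_def)
      with m show ?thesis by (auto simp: P'_def)
    qed
  qed
  moreover have "\<forall>p\<in>#P'. snd p \<le> k"
    using Q Q' by (auto simp: P'_def H_def)
  moreover have "cone_series P = (\<Sum>e=q..<q'. fps_X ^ e * geom ^ Suc k) + cone_series P'"
    by (subst P) (simp add: T Q(1) Q'(1) P'_def del: power_Suc)
  moreover have "fst p < q' \<or> p \<in># P'" if "p \<in># P" for p
  proof (cases "snd p = Suc k")
    case True
    with that have "fst p \<in># D" unfolding D_iff by (metis prod.collapse)
    with Dlt show ?thesis by auto
  next
    case False
    with that dims have "snd p \<le> k" by (metis le_SucE)
    with that show ?thesis by (auto simp: P'_def H_def)
  qed
  ultimately show ?thesis
    by (intro exI[of _ q'] exI[of _ P']) (auto simp: q'_def)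
qed

text \<open>Dimensions are treated from the top down, the \<open>q'\<close> of one level being the
  start of the next; the points remaining at the end form \<open>Z\<close>. The bound on the
  original degrees persists because no threshold exceeds \<open>a 1\<close>.\<close>

lemma standard_imp_exact:
  assumes "standard q P" "\<forall>p\<in>#P. snd p \<le> n"
  shows "\<exists>a Z. a (Suc n) = q \<and> (\<forall>k\<in>{1..n}. a (Suc k) \<le> a k) \<and>
    cone_series P = exact_series n a Z \<and> (\<forall>p\<in>#P. fst p < a 1 \<or> fst p \<in># Z)"
  using assms
proof (induction n arbitrary: q P)
  case 0
  then show ?case
    by (intro exI[of _ "\<lambda>_. q"] exI[of _ "image_mset fst P"])
      (auto simp: exact_series_def cone_series_zero_dim)
next
  case (Suc n)
  obtain q' P' where P': "q \<le> q'" "standard q' P'" "\<forall>p\<in>#P'. snd p \<le> n"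
    "cone_series P = (\<Sum>e=q..<q'. fps_X ^ e * geom ^ Suc n) + cone_series P'"
    "\<forall>p\<in>#P. fst p < q' \<or> p \<in># P'"
    using standard_reduce_dimension[OF Suc.prems] by blast
  obtain a Z where a: "a (Suc n) = q'" "\<forall>k\<in>{1..n}. a (Suc k) \<le> a k"
    "cone_series P' = exact_series n a Z" "\<forall>p\<in>#P'. fst p < a 1 \<or> fst p \<in># Z"
    using Suc.IH[OF P'(2,3)] by blast
  define b where "b = a(Suc (Suc n) := q)"
  have "a (Suc n) \<le> a 1"
  proof -
    have "a (Suc n) \<le> a (Suc i)" if "i \<le> n" for i
      using that
    proof (induction rule: inc_induct)
      case (step i)
      with a(2) show ?case by (fastforce intro: order_trans)
    qed simp
    from this[of 0] show ?thesis by simp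
  qed
  then have "\<forall>p\<in>#P. fst p < b 1 \<or> fst p \<in># Z"
    using P'(5) a(1,4) by (auto simp: b_def)
  moreover have "(\<Sum>k=1..n. \<Sum>e=b (Suc k)..<b k. fps_X ^ e * geom ^ k) =
      (\<Sum>k=1..n. \<Sum>e=a (Suc k)..<a k. fps_X ^ e * geom ^ k)"
    by (intro sum.cong) (auto simp: b_def)
  then have "exact_series (Suc n) b Z =
      exact_series n a Z + (\<Sum>e=q..<q'. fps_X ^ e * geom ^ Suc n)"
    using a(1) by (simp add: exact_series_def b_def del: power_Suc)
  then have "cone_series P = exact_series (Suc n) b Z"
    using P'(4) a(3) by (simp del: power_Suc)
  moreover have "b (Suc (Suc n)) = q" "\<forall>k\<in>{1..Suc n}. b (Suc k) \<le> b k"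
    using P'(1) a(1,2) by (auto simp: b_def le_Suc_eq)
  ultimately show ?case
    by blast
qed

section \<open>Degree bounds from Hilbert series\<close>

lemma sum_binomial_interval:
  assumes "l \<le> u"
  shows "(\<Sum>e=l..<u. int (e choose m)) = int (u choose Suc m) - int (l choose Suc m)"
  using assms by (induction u rule: dec_induct) auto

text \<open>Summation by parts: an inner \<open>\<alpha> m\<close> occurs in two neighbouring terms,
  and Pascal's rule merges its two binomials into
  \<open>Suc (\<alpha> m) choose Suc m\<close>.\<close>

lemma alternating_binomial_telescope:
  "(\<Sum>m=0..p. (-1) ^ m * (int (\<alpha> m choose Suc m) - int (\<alpha> (Suc m) choose Suc m))) =
   int (\<alpha> 0) + (\<Sum>m=1..p. (-1) ^ m * int (Suc (\<alpha> m) choose Suc m))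
     - (-1) ^ p * int (\<alpha> (Suc p) choose Suc p)"
  by (induction p) (simp_all add: algebra_simps)

text \<open>The numerator over (1 - X)^n is a polynomial and may be expanded at X = 1. Points
  contribute multiples of (1 - X)^n, which are invisible in the coefficients of order below
  n.\<close>

lemma exact_series_mult:
  "(1 - fps_X) ^ n * exact_series n a Z = fps_of_poly
     ((\<Sum>e\<in>#Z. monom 1 e) * [:1, -1:] ^ n +
      (\<Sum>k=1..n. \<Sum>e=a (Suc k)..<a k. monom 1 e * [:1, -1:] ^ (n - k)))"
proof -
  have X: "fps_of_poly [:1, -1:] = (1 - fps_X :: int fps)"
    by (simp add: fps_of_poly_pCons)
  have Z: "fps_of_poly (\<Sum>e\<in>#Z. monom 1 e) = (\<Sum>e\<in>#Z. fps_X ^ e :: int fps)"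
    by (induction Z) (simp_all add: fps_of_poly_add fps_of_poly_monom')
  have "(1 - fps_X) ^ n * (fps_X ^ e * geom ^ k) =
      fps_of_poly (monom 1 e * [:1, -1:] ^ (n - k))" if "k \<le> n" for e k
  proof -
    have "(1 - fps_X) ^ n = (1 - fps_X) ^ (n - k) * ((1 - fps_X) ^ k :: int fps)"
      using that by (simp flip: power_add)
    then have "(1 - fps_X) ^ n * (fps_X ^ e * geom ^ k) =
        (1 - fps_X) ^ (n - k) * (1 - fps_X) ^ k * (fps_X ^ e * geom ^ k)"
      by (rule arg_cong)
    also have "\<dots> = fps_X ^ e * (1 - fps_X) ^ (n - k) * ((1 - fps_X) * geom) ^ k"
      unfolding power_mult_distrib by (simp only: mult_ac)
    also have "\<dots> = fps_X ^ e * (1 - fps_X) ^ (n - k)"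
      unfolding geom_mult by simp
    also have "\<dots> = fps_of_poly (monom 1 e * [:1, -1:] ^ (n - k))"
      unfolding fps_of_poly_mult fps_of_poly_power fps_of_poly_monom' X ..
    finally show ?thesis .
  qed
  then have "(1 - fps_X) ^ n * (\<Sum>k=1..n. \<Sum>e=a (Suc k)..<a k. fps_X ^ e * geom ^ k) =
      fps_of_poly (\<Sum>k=1..n. \<Sum>e=a (Suc k)..<a k. monom 1 e * [:1, -1:] ^ (n - k))"
    unfolding fps_of_poly_sum sum_distrib_left by (intro sum.cong) auto
  then show ?thesis
    unfolding exact_series_def fps_of_poly_add fps_of_poly_mult fps_of_poly_power X Z
    by (simp add: distrib_left mult.commute)
qed

lemma pcompose_one: "pcompose 1 q = (1 :: int poly)"
  by (metis one_pCons pcompose_const)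

text \<open>The substitution of \<open>1 + u\<close> for \<open>X\<close> expands the Hilbert numerator at \<open>X = 1\<close>.\<close>

lemma coeff_shifted_cone:
  assumes "j \<le> n" "k \<le> n"
  shows "coeff (pcompose (monom 1 e * [:1, -1:] ^ (n - k)) [:1, 1:]) (n - j) =
    (if j \<le> k then (-1) ^ (n - k) * int (e choose (k - j)) else 0)"
proof -
  have m: "pcompose (monom 1 e) [:1, 1:] = ([:1, 1:] :: int poly) ^ e"
    by (induction e) (simp_all add: monom_Suc pcompose_pCons pcompose_one)
  \<comment> \<open>With X = 1 + u the factor 1 - X becomes -u, so a cone of dimension k has
    numerator (1 + u)^e (-u)^(n-k).\<close>
  have w: "pcompose ([:1, -1:] ^ i) [:1, 1:] = monom ((-1) ^ i :: int) i" for i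
  proof (induction i)
    case (Suc i)
    have "pcompose [:1, -1:] [:1, 1:] = monom (-1 :: int) 1"
      by (simp add: pcompose_pCons monom_Suc monom_0)
    with Suc show ?case
      unfolding power_Suc pcompose_mult by (simp add: mult_monom)
  qed (simp add: pcompose_one)
  have "coeff ([:1, 1:] ^ e) i = int (e choose i)" for i
    by (cases "i \<le> e") (simp_all add: coeff_linear_poly_power binomial_eq_0 coeff_eq_0
        degree_linear_power)
  then show ?thesis
    using assms by (auto simp: pcompose_mult m w mult.commute[of "_ ^ e"] coeff_monom_mult)
qed

text \<open>\<open>b\<close> and \<open>W\<close> describe the standard monomials, \<open>a\<close>
  and \<open>Z\<close> the ideal without the share \<open>fps_X ^ d * geom ^ n\<close> of its first
  generator. The last values record where the decompositions start.\<close>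

locale complementary_exact =
  fixes n d :: nat and a b :: "nat \<Rightarrow> nat" and Z W :: "nat multiset"
  assumes series: "geom ^ n = fps_X ^ d * geom ^ n + exact_series n a Z + exact_series n b W"
    and a_last: "a (Suc n) = d" and b_last: "b (Suc n) = 0"
    and a_step: "k \<in> {1..n} \<Longrightarrow> a (Suc k) \<le> a k"
    and b_step: "k \<in> {1..n} \<Longrightarrow> b (Suc k) \<le> b k"
    and n_ge_2: "2 \<le> n"
begin

lemma poly_identity:
  "monom 1 d + ((\<Sum>e\<in>#Z + W. monom 1 e) * [:1, -1:] ^ n +
      ((\<Sum>k=1..n. \<Sum>e=a (Suc k)..<a k. monom 1 e * [:1, -1:] ^ (n - k)) +
      (\<Sum>k=1..n. \<Sum>e=b (Suc k)..<b k. monom 1 e * [:1, -1:] ^ (n - k)))) = (1 :: int poly)"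
    (is "?L = 1")
proof -
  define w :: "int fps" where "w = (1 - fps_X) ^ n"
  have g: "w * geom ^ n = 1"
    unfolding w_def power_mult_distrib[symmetric] geom_mult by simp
  have "w * geom ^ n = w * (fps_X ^ d * geom ^ n + exact_series n a Z + exact_series n b W)"
    by (rule arg_cong[OF series])
  also have "\<dots> = fps_X ^ d * (w * geom ^ n) + w * exact_series n a Z + w * exact_series n b W"
    by (simp only: distrib_left mult.left_commute)
  finally have "1 = fps_X ^ d + w * exact_series n a Z + w * exact_series n b W"
    unfolding g by simp
  also have "\<dots> = fps_of_poly ?L"
    unfolding w_def exact_series_mult
    by (simp only: fps_of_poly_add fps_of_poly_monom' image_mset_union sum_mset.union distrib_right
        add.assoc add.left_commute)
  finally have "fps_of_poly ?L = fps_of_poly 1"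
    unfolding fps_of_poly_1 ..
  then show ?thesis
    unfolding fps_of_poly_eq_iff .
qed

text \<open>Coefficients of u^(n-j) in \<open>poly_identity\<close>, multiplied by (-1)^(n-j).
  Points drop out because of their factor (1 - X)^n, cones of dimension below j because their
  numerators vanish to an order above n - j.\<close>

lemma coeff_identity:
  assumes "1 \<le> j" "j \<le> n"
  shows "(-1) ^ (n - j) * int (d choose (n - j)) +
     (\<Sum>k=j..n. (-1) ^ (k - j) * (\<Sum>e=a (Suc k)..<a k. int (e choose (k - j)))) +
     (\<Sum>k=j..n. (-1) ^ (k - j) * (\<Sum>e=b (Suc k)..<b k. int (e choose (k - j)))) =
     (if j = n then 1 else 0)"
proof -
  define C where "C p = coeff (pcompose p [:1, 1:]) (n - j)" for p :: "int poly"
  have C_add: "C (p + q) = C p + C q" for p q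
    by (simp add: C_def pcompose_add)
  have C_sum: "C (sum f A) = (\<Sum>i\<in>A. C (f i))" for f :: "nat \<Rightarrow> int poly" and A
    by (simp add: C_def pcompose_sum coeff_sum)
  have C_cone: "C (monom 1 e * [:1, -1:] ^ (n - k)) =
    (if j \<le> k then (-1) ^ (n - k) * int (e choose (k - j)) else 0)" if "k \<le> n" for e k
    unfolding C_def using coeff_shifted_cone[OF assms(2) that] .
  have C_Z: "C ((\<Sum>e\<in>#V. monom 1 e) * [:1, -1:] ^ n) = 0" for V
  proof (induction V)
    case (add e V)
    then show ?case
      using C_cone[of 0 e] assms by (simp add: distrib_right C_add)
  qed (simp add: C_def)
  have C_D: "C (monom 1 d) = int (d choose (n - j))"
    using C_cone[of n d] assms by simp
  have C_1: "C 1 = (if j = n then 1 else 0)"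
    using assms by (simp add: C_def pcompose_one)
  have sgn: "(-1) ^ (n - j) * (-1) ^ (n - k) = (-1 :: int) ^ (k - j)" if "j \<le> k" "k \<le> n" for k
  proof -
    have "n - j = (n - k) + (k - j)"
      using that by simp
    then have "(-1) ^ (n - j) * (-1) ^ (n - k) = ((-1) ^ (n - k) * (-1) ^ (n - k)) * (-1 :: int) ^ (k - j)"
      by (simp add: power_add)
    then show ?thesis
      by simp
  qed
  have C_levels: "(-1) ^ (n - j) *
      C (\<Sum>k=1..n. \<Sum>e=f (Suc k)..<f k. monom 1 e * [:1, -1:] ^ (n - k)) =
     (\<Sum>k=j..n. (-1) ^ (k - j) * (\<Sum>e=f (Suc k)..<f k. int (e choose (k - j))))"
    for f :: "nat \<Rightarrow> nat"
  proof -
    have "C (\<Sum>k=1..n. \<Sum>e=f (Suc k)..<f k. monom 1 e * [:1, -1:] ^ (n - k)) =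
      (\<Sum>k=1..n. if j \<le> k then (-1) ^ (n - k) * (\<Sum>e=f (Suc k)..<f k. int (e choose (k - j))) else 0)"
      unfolding C_sum by (intro sum.cong refl) (auto simp: C_cone sum_distrib_left)
    also have "\<dots> = (\<Sum>k=j..n. (-1) ^ (n - k) * (\<Sum>e=f (Suc k)..<f k. int (e choose (k - j))))"
      using assms by (intro sum.mono_neutral_cong_right) auto
    finally show ?thesis
      by (simp only: sum_distrib_left mult.assoc[symmetric])
         (intro sum.cong refl, simp add: sgn)
  qed
  have "(-1) ^ (n - j) * C 1 = (if j = n then 1 else 0)"
    by (simp add: C_1)
  then show ?thesis
    unfolding poly_identity[symmetric] C_add C_Z C_D distrib_left C_levels by simp
qed

text \<open>The case j = n - p: the inner sums collapse by the hockey-stick identity, and the outer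
  one telescopes to an expression in the thresholds alone.\<close>

lemma telescoped_identity:
  assumes "p < n"
  shows "(-1) ^ p * int (d choose p) +
     (int (a (n - p)) + (\<Sum>m=1..p. (-1) ^ m * int (Suc (a (n - p + m)) choose Suc m))
       - (-1) ^ p * int (d choose Suc p)) +
     (int (b (n - p)) + (\<Sum>m=1..p. (-1) ^ m * int (Suc (b (n - p + m)) choose Suc m))
       - (-1) ^ p * int (0 choose Suc p)) = (if p = 0 then 1 else 0)"
proof -
  have *: "(\<Sum>k=n-p..n. (-1) ^ (k - (n - p)) * (\<Sum>e=f (Suc k)..<f k. int (e choose (k - (n - p))))) =
     int (f (n - p)) + (\<Sum>m=1..p. (-1) ^ m * int (Suc (f (n - p + m)) choose Suc m))
       - (-1) ^ p * int (f (Suc n) choose Suc p)" (is "?S f = ?T f")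
    if step: "\<And>k. k \<in> {1..n} \<Longrightarrow> f (Suc k) \<le> f k" for f :: "nat \<Rightarrow> nat"
  proof -
    have "(\<Sum>k=n-p..n. (-1) ^ (k - (n - p)) * (\<Sum>e=f (Suc k)..<f k. int (e choose (k - (n - p))))) =
      (\<Sum>m=0..p. (-1) ^ m * (\<Sum>e=f (Suc (n - p + m))..<f (n - p + m). int (e choose m)))"
      by (rule sum.reindex_bij_witness[of _ "\<lambda>m. n - p + m" "\<lambda>k. k - (n - p)"]) (use assms in auto)
    also have "\<dots> = (\<Sum>m=0..p. (-1) ^ m *
        (int (f (n - p + m) choose Suc m) - int (f (n - p + Suc m) choose Suc m)))"
    proof (intro sum.cong refl)
      fix m assume "m \<in> {0..p}"
      then have "f (Suc (n - p + m)) \<le> f (n - p + m)"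
        using assms by (intro step) auto
      then show "(-1) ^ m * (\<Sum>e=f (Suc (n - p + m))..<f (n - p + m). int (e choose m)) =
          (-1) ^ m * (int (f (n - p + m) choose Suc m) - int (f (n - p + Suc m) choose Suc m))"
        by (simp add: sum_binomial_interval)
    qed
    also have "\<dots> = int (f (n - p)) + (\<Sum>m=1..p. (-1) ^ m * int (Suc (f (n - p + m)) choose Suc m))
       - (-1) ^ p * int (f (Suc n) choose Suc p)"
      using alternating_binomial_telescope[of "\<lambda>m. f (n - p + m)" p] assms by simp
    finally show ?thesis .
  qed
  have np: "n - (n - p) = p" "n - p = n \<longleftrightarrow> p = 0" "1 \<le> n - p" "n - p \<le> n"
    using assms by auto
  have A: ?thesis if "?S a = ?T a" "?S b = ?T b"
    using coeff_identity[OF np(3,4)] unfolding that a_last b_last np(1,2) .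
  show ?thesis
    by (rule A; rule *) (fact a_step b_step)+
qed

text \<open>Codimension 0 gives a_n + b_n = d, while a_n is at least a_(n+1) = d. Hence neither
  decomposition contains a cone of dimension n.\<close>

lemma top_values: "a n = d" "b n = 0"
proof -
  have "int (a n) + int (b n) = int d"
    using telescoped_identity[of 0] n_ge_2 by simp
  moreover have "d \<le> a n"
    using a_step[of n] n_ge_2 by (simp add: a_last)
  ultimately show "a n = d" "b n = 0"
    by auto
qed

lemma recursion:
  assumes "1 \<le> p" "p < n"
  shows "int (a (n - p) + b (n - p)) = (\<Sum>m=1..<p. (-1) ^ Suc m *
      int ((Suc (a (n - (p - m))) choose Suc m) + (Suc (b (n - (p - m))) choose Suc m)))
    + (-1) ^ Suc p * (2 * int (d choose p))"
proof -
  define S where "S f = (\<Sum>m=1..<p. (-1) ^ m * int (Suc (f (n - (p - m))) choose Suc m))"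
    for f :: "nat \<Rightarrow> nat"
  have split: "(\<Sum>m=1..p. (-1) ^ m * int (Suc (f (n - p + m)) choose Suc m)) =
      S f + (-1) ^ p * int (Suc (f n) choose Suc p)" for f :: "nat \<Rightarrow> nat"
  proof -
    have "{1..p} = insert p {1..<p}"
      using assms by auto
    moreover have "n - p + m = n - (p - m)" if "m \<in> {1..<p}" for m
      using that assms by auto
    ultimately show ?thesis
      using assms by (simp add: S_def del: binomial_Suc_Suc)
  qed
  have last: "Suc 0 choose Suc p = 0" "0 choose Suc p = 0"
    using assms by (simp_all add: binomial_eq_0)
  have "(\<Sum>m=1..<p. (-1) ^ Suc m *
      int ((Suc (a (n - (p - m))) choose Suc m) + (Suc (b (n - (p - m))) choose Suc m)))
      = - S a - S b"
    by (simp add: S_def sum_negf sum_subtractf distrib_left del: binomial_Suc_Suc)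
  \<comment> \<open>The summand m = p involves a_n = d and b_n = 0. Its
    \<open>Suc d choose Suc p\<close> splits by Pascal's rule: one part cancels
    \<open>d choose Suc p\<close>, the other doubles \<open>d choose p\<close>.\<close>
  moreover have "int (Suc d choose Suc p) = int (d choose p) + int (d choose Suc p)"
    by simp
  moreover have "p \<noteq> 0"
    using assms by simp
  ultimately show ?thesis
    using telescoped_identity[OF assms(2)]
    unfolding split top_values last by (simp add: algebra_simps del: binomial_Suc_Suc)
qed

text \<open>A point in degree e contributes X^e (1 - X)^n, of degree e + n, to the numerator, and
  multiplicities are non-negative, so points cannot cancel each other. If e were at least a_1 and
  b_1, all other summands would have smaller degree, contradicting
  \<open>poly_identity\<close>.\<close>

lemma zero_dim_bound:
  assumes "e \<in># Z + W"
  shows "e < max (a 1) (b 1)"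
proof (rule ccontr)
  assume "\<not> e < max (a 1) (b 1)"
  then have e: "a 1 \<le> e" "b 1 \<le> e"
    by auto
  define ZZ :: "int poly" where "ZZ = (\<Sum>e\<in>#Z + W. monom 1 e)"
  have le_1: "f k \<le> f 1" if "\<And>k. k \<in> {1..n} \<Longrightarrow> f (Suc k) \<le> f k" "1 \<le> k" "k \<le> Suc n"
    for f :: "nat \<Rightarrow> nat" and k
    using that(2,3)
  proof (induction k rule: dec_induct)
    case (step k)
    with that(1)[of k] show ?case by simp
  qed simp
  have "coeff (\<Sum>e\<in>#V. monom 1 e) i = int (count V i)" for V i
    by (induction V) auto
  then have "coeff ZZ e = int (count (Z + W) e)"
    unfolding ZZ_def by blast
  with assms have "coeff ZZ e \<noteq> 0"
    by (metis count_eq_zero_iff of_nat_eq_0_iff)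
  then have "e \<le> degree ZZ" "ZZ \<noteq> 0"
    by (auto simp: le_degree)
  then have big: "e + n \<le> degree (ZZ * [:1, -1:] ^ n)"
    by (simp add: degree_mult_eq degree_power_eq)
  have levels: "degree (\<Sum>k=1..n. \<Sum>e=f (Suc k)..<f k. monom 1 e * [:1, -1:] ^ (n - k) :: int poly)
      \<le> e + n - 1" if step: "\<And>k. k \<in> {1..n} \<Longrightarrow> f (Suc k) \<le> f k" and "f 1 \<le> e" for f
  proof (intro degree_sum_le)
    fix k i assume *: "k \<in> {1..n}" "i \<in> {f (Suc k)..<f k}"
    have "degree (monom 1 i * [:1, -1:] ^ (n - k) :: int poly) = i + (n - k)"
      by (simp add: degree_mult_eq degree_power_eq degree_monom_eq)
    also have "\<dots> \<le> e + n - 1"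
      using * le_1[of f k, OF step] that(2) by auto
    finally show "degree (monom 1 i * [:1, -1:] ^ (n - k) :: int poly) \<le> e + n - 1" .
  qed auto
  have "ZZ * [:1, -1:] ^ n = 1 - (monom 1 d +
      ((\<Sum>k=1..n. \<Sum>e=a (Suc k)..<a k. monom 1 e * [:1, -1:] ^ (n - k)) +
      (\<Sum>k=1..n. \<Sum>e=b (Suc k)..<b k. monom 1 e * [:1, -1:] ^ (n - k))))"
    unfolding ZZ_def using poly_identity by (simp add: algebra_simps)
  also have "degree \<dots> \<le> e + n - 1"
  proof (intro degree_diff_le degree_add_le)
    show "degree (monom 1 d :: int poly) \<le> e + n - 1"
      using le_1[of a "Suc n", OF a_step] e n_ge_2 by (simp add: degree_monom_eq a_last)
  qed (use levels[of a, OF a_step] levels[of b, OF b_step] e in auto)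
  finally show False
    using big n_ge_2 by linarith
qed

end

section \<open>Numerical estimates for the threshold recursion\<close>

lemma binomial_superadditive:
  assumes "2 \<le> m"
  shows "(Suc x choose m) + (Suc y choose m) \<le> (Suc (x + y) choose m)"
proof (induction y)
  case 0
  then show ?case using assms by (simp add: binomial_eq_0)
next
  case (Suc y)
  obtain l where m: "m = Suc l"
    using assms by (cases m) auto
  have "(Suc y choose l) \<le> (Suc (x + y) choose l)"
    by (rule binomial_right_mono) simp
  then show ?case
    using Suc.IH unfolding m by (simp add: binomial_Suc_Suc[of "Suc _"] del: binomial_Suc_Suc)
qed

text \<open>Consecutive terms have quotient 2/(m+1), which is at most 1/2; at m = 4 the value is
  16/24 = 2/3. The geometric decay bounds the tail of the recursion independently of its
  length.\<close>

lemma two_power_le_fact: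
  assumes "4 \<le> m"
  shows "2 ^ m / fact m \<le> (2 / 3 :: real) * (1 / 2) ^ (m - 4)"
  using assms
proof (induction m rule: dec_induct)
  case base
  show ?case by (simp add: fact_numeral)
next
  case (step m)
  have "2 ^ Suc m / fact (Suc m) = 2 / (1 + real m) * (2 ^ m / fact m :: real)"
    by simp
  also have "\<dots> \<le> 1 / 2 * (2 / 3 * (1 / 2) ^ (m - 4))"
    using step by (intro mult_mono) (auto simp: field_simps)
  also have "Suc m - 4 = Suc (m - 4)"
    using step.hyps by simp
  then have "1 / 2 * (2 / 3 * (1 / 2) ^ (m - 4)) = (2 / 3 * (1 / 2) ^ (Suc m - 4) :: real)"
    by simp
  finally show ?case .
qed

lemma le_two_power_diff_2:
  assumes "4 \<le> m"
  shows "m \<le> 2 ^ (m - 2)"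
  using assms
proof (induction m rule: dec_induct)
  case (step m)
  have "Suc m - 2 = Suc (m - 2)"
    using step.hyps by simp
  then have "2 ^ (Suc m - 2) = 2 * (2 ^ (m - 2) :: nat)"
    by simp
  with step show ?case by simp
qed simp

lemma binomial_le_power_div:
  "real (x choose m) \<le> real x ^ m / fact m"
proof -
  have "real ((x choose m) * fact m) \<le> real (x ^ m)"
    using binomial_fact_pow[of x m] by (simp only: of_nat_le_iff)
  then show ?thesis
    by (simp add: field_simps)
qed

text \<open>Put Y = A^(2^(p-m-1)). Since Y is at least 3/2, s + 1 <= 4/3 Y + 1 <= 2 Y, so the
  binomial is at most (2 Y)^(m+1) / (m+1)!. Then m + 1 <= 2^(m-1) bounds Y^(m+1) by
  A^(2^(p-2)).\<close>

lemma recursion_term_bound: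
  fixes A :: real
  assumes A: "3 / 2 \<le> A" and m: "3 \<le> m" "m < p"
    and s: "real s \<le> 4 / 3 * A ^ 2 ^ (p - m - 1)"
  shows "real (Suc s choose Suc m) \<le> 2 / 3 * (1 / 2) ^ (m - 3) * A ^ 2 ^ (p - 2)"
proof -
  define Y where "Y = A ^ 2 ^ (p - m - 1)"
  have "A ^ 1 \<le> Y"
    unfolding Y_def using A by (intro power_increasing) auto
  then have "real (Suc s) \<le> 2 * Y"
    using s A by (simp add: Y_def)
  then have "real (Suc s) ^ Suc m \<le> (2 * Y) ^ Suc m"
    by (intro power_mono) auto
  then have "real (Suc s choose Suc m) \<le> (2 * Y) ^ Suc m / fact (Suc m)"
    by (intro order_trans[OF binomial_le_power_div] divide_right_mono) auto
  also have "\<dots> = 2 ^ Suc m / fact (Suc m) * Y ^ Suc m"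
    by (simp add: power_mult_distrib)
  also have "\<dots> \<le> 2 / 3 * (1 / 2) ^ (Suc m - 4) * A ^ 2 ^ (p - 2)"
  proof (intro mult_mono)
    show "2 ^ Suc m / fact (Suc m) \<le> (2 / 3 :: real) * (1 / 2) ^ (Suc m - 4)"
      using m by (intro two_power_le_fact) auto
    have "2 ^ (p - m - 1) * Suc m \<le> 2 ^ (p - m - 1) * 2 ^ (Suc m - 2)"
      using m by (intro mult_left_mono le_two_power_diff_2) auto
    also have "\<dots> = 2 ^ (p - 2)"
      using m by (simp flip: power_add)
    finally show "Y ^ Suc m \<le> A ^ 2 ^ (p - 2)"
      unfolding Y_def power_mult[symmetric] using A by (intro power_increasing) auto
  qed (use A in \<open>auto simp: Y_def\<close>)
  finally show ?thesis
    using m by (simp add: numeral_eq_Suc)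
qed

text \<open>
  The term for \<open>m = 1\<close> gives the squaring step and the one for \<open>m = 2\<close> is dropped for its sign. By
  \<open>m + 1 \<le> 2\<^bsup>m - 1\<^esup>\<close> the others are linear in \<open>A ^ 2 ^ (p - 2)\<close>, so a factor below 2 in
  front of the bound, here \<open>4 / 3\<close>, leaves room for them.
\<close>

lemma recursion_tail_bound:
  fixes A :: real and s :: "nat \<Rightarrow> nat"
  assumes d: "1 \<le> d" and A: "A = (real d)\<^sup>2 / 2 + real d" and p: "2 \<le> p"
    and u: "\<And>m. m \<in> {1..<p} \<Longrightarrow>
      u m \<le> real (Suc (s m) choose Suc m)" "\<And>m. 0 \<le> u m"
    and s: "\<And>m. m \<in> {1..<p} \<Longrightarrow> real (s m) \<le> 4 / 3 * A ^ 2 ^ (p - m - 1)"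
  shows "(\<Sum>m=1..<p. (-1) ^ Suc m * u m) + (-1) ^ Suc p * (2 * real (d choose p))
    \<le> 4 / 3 * A ^ 2 ^ (p - 1)"
proof -
  define B where "B = A ^ 2 ^ (p - 2)"
  \<comment> \<open>The constant 3/2 is the value of \<open>A\<close> at
    \<open>d = 1\<close>.\<close>
  have A_ge: "3 / 2 \<le> A" and dA: "real d \<le> A"
  proof -
    have "1 \<le> (real d)\<^sup>2"
      using d by simp
    moreover have "1 \<le> real d"
      using d by simp
    ultimately show "3 / 2 \<le> A" "real d \<le> A"
      unfolding A by linarith+
  qed
  have "A ^ 1 \<le> B"
    unfolding B_def using A_ge by (intro power_increasing) auto
  then have B_ge: "3 / 2 \<le> B"
    using A_ge by simp
  have "p - 1 = Suc (p - 2)"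
    using p by simp
  then have "2 ^ (p - 1) = 2 ^ (p - 2) * (2 :: nat)"
    by simp
  then have BB: "A ^ 2 ^ (p - 1) = B\<^sup>2"
    unfolding B_def by (simp add: power_mult)
  have "real (s 1) \<le> 4 / 3 * B"
    using s[of 1] p by (simp add: B_def numeral_2_eq_2)
  then have "(real (s 1) + 1) * real (s 1) \<le> (4 / 3 * B + 1) * (4 / 3 * B)"
    by (intro mult_mono) auto
  moreover have "u 1 \<le> (real (s 1) + 1) * real (s 1) / 2"
    using u(1)[of 1] p by (simp add: numeral_2_eq_2[symmetric] choose_two field_simps real_of_nat_div)
  ultimately have u1: "u 1 \<le> 8 / 9 * B\<^sup>2 + 2 / 3 * B"
    by (simp add: power2_eq_square field_simps)
  have split: "(\<Sum>m=1..<p. (-1) ^ Suc m * u m) \<le> u 1 + (\<Sum>m=3..<p. (-1) ^ Suc m * u m)"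
  proof (cases "p = 2")
    case True
    then have "{1..<p} = {1}" "{3..<p} = {}" by auto
    then show ?thesis by simp
  next
    case False
    then have "{1..<p} = insert 1 (insert 2 {3..<p})"
      using p by auto
    then show ?thesis using u(2)[of 2] by simp
  qed
  \<comment> \<open>The right-hand side is what remains of 4/3 B^2 after the term for m = 1 has
    taken 8/9 B^2 + 2/3 B. The cases p = 2 and p = 3 are separate because B may be too small there
    for the general estimate.\<close>
  have extra: "(\<Sum>m=3..<p. (-1) ^ Suc m * u m) + (-1) ^ Suc p * (2 * real (d choose p))
      \<le> 4 / 9 * B\<^sup>2 - 2 / 3 * B"
  proof -
    have sq: "4 / 9 * B\<^sup>2 - 2 / 3 * B = 2 / 3 * B * (2 / 3 * B - 1)"
      by (simp add: power2_eq_square field_simps)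
    consider "p = 2" | "p = 3" | "4 \<le> p"
      using p by linarith
    then show ?thesis
    proof cases
      case 1
      have "0 \<le> 2 / 3 * B * (2 / 3 * B - 1)"
        using B_ge by simp
      moreover have "(\<Sum>m=3..<p. (-1) ^ Suc m * u m) + (-1) ^ Suc p * (2 * real (d choose p)) \<le> 0"
        using 1 by simp
      ultimately show ?thesis
        unfolding sq by linarith
    next
      case 2
      \<comment> \<open>For p = 3 the sum is empty and only \<open>2 * (d choose 3)\<close>, at most
        d^3/3, is left; B = A^2 contains the summand d^3.\<close>
      have B: "B = (real d)\<^sup>2 * ((real d)\<^sup>2 / 4 + real d + 1)"
        unfolding B_def A 2 by (simp add: power2_eq_square field_simps)
      have "(real d)\<^sup>2 * real d \<le> B"
        unfolding B by (intro mult_left_mono) auto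
      then have d3: "real d ^ 3 \<le> B"
        by (simp add: power2_eq_square power3_eq_cube)
      have "(3 / 2) * (3 / 2) \<le> A * A"
        using A_ge by (intro mult_mono) auto
      then have "9 / 4 \<le> B"
        unfolding B_def 2 by (simp add: power2_eq_square)
      then have "2 / 3 * B * (1 / 2) \<le> 2 / 3 * B * (2 / 3 * B - 1)"
        by (intro mult_left_mono) auto
      moreover have "real (d choose 3) \<le> real d ^ 3 / 6"
        using binomial_le_power_div[of d 3] by (simp add: fact_numeral)
      ultimately show ?thesis
        unfolding sq using d3 2 by simp
    next
      case 3
      have "A ^ 4 \<le> B"
        unfolding B_def using A_ge order_trans[OF 3 le_two_power_diff_2[OF 3]]
        by (intro power_increasing) auto
      moreover have "(3 / 2) ^ 4 \<le> A ^ 4"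
        using A_ge by (intro power_mono) auto
      ultimately have B5: "81 / 16 \<le> B"
        by (simp add: power_divide)
      have "(\<Sum>m=3..<p. (-1) ^ Suc m * u m) \<le> (\<Sum>m=3..<p. 2 / 3 * (1 / 2) ^ (m - 3) * B)"
      proof (rule sum_mono)
        fix m assume m: "m \<in> {3..<p}"
        have "(-1) ^ Suc m * u m \<le> u m"
          using u(2)[of m] by (cases "even m") auto
        also have "\<dots> \<le> real (Suc (s m) choose Suc m)"
          using m by (intro u) auto
        also have "\<dots> \<le> 2 / 3 * (1 / 2) ^ (m - 3) * B"
          unfolding B_def using m A_ge s[of m] by (intro recursion_term_bound) auto
        finally show "(-1) ^ Suc m * u m \<le> 2 / 3 * (1 / 2) ^ (m - 3) * B" .
      qed
      also have "\<dots> = 2 / 3 * B * (\<Sum>m=3..<p. (1 / 2) ^ (m - 3))"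
        by (simp add: sum_distrib_left mult_ac)
      also have "(\<Sum>m=3..<p. (1 / 2 :: real) ^ (m - 3)) = (\<Sum>m<p - 3. (1 / 2) ^ m)"
        by (rule sum.reindex_bij_witness[of _ "\<lambda>m. m + 3" "\<lambda>m. m - 3"]) auto
      also have "\<dots> \<le> 2"
        by (simp add: sum_gp_strict)
      finally have t1: "(\<Sum>m=3..<p. (-1) ^ Suc m * u m) \<le> 4 / 3 * B"
        using B5 by simp
      have "real d ^ p \<le> A ^ p"
        using dA by (intro power_mono) auto
      also have "\<dots> \<le> B"
        unfolding B_def using A_ge le_two_power_diff_2[OF 3] by (intro power_increasing) auto
      finally have dp: "real d ^ p \<le> B" .
      have "(24 :: real) \<le> fact p"
        using fact_mono[OF 3, where 'a = real] by (simp add: fact_numeral)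
      then have "real d ^ p / fact p \<le> B / 24"
        using dp B5 by (intro frac_le) auto
      then have "real (d choose p) \<le> B / 24"
        by (rule order_trans[OF binomial_le_power_div])
      then have t2: "(-1) ^ Suc p * (2 * real (d choose p)) \<le> B / 12"
        using B5 by (cases "even p") auto
      \<comment> \<open>81/16 <= B gives 2/3 B - 1 >= 19/8, and 2/3 * 19/8 = 19/12 exceeds the 4/3 +
        1/12 = 17/12 required by \<open>t1\<close> and \<open>t2\<close>.\<close>
      have "2 / 3 * B * (19 / 8) \<le> 2 / 3 * B * (2 / 3 * B - 1)"
        using B5 by (intro mult_left_mono) auto
      then show ?thesis
        unfolding sq using t1 t2 B5 by linarith
    qed
  qed
  show ?thesis
    unfolding BB using u1 split extra by linarith
qed

context complementary_exact
begin

text \<open>The thresholds are Dube's Macaulay constants. The recursion determines only the sums a_j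
  + b_j; as \<open>binomial_superadditive\<close> bounds its terms by binomials of these sums, the
  induction over the codimension p can run on the sums alone.\<close>

lemma macaulay_constant_bound:
  assumes d: "1 \<le> d" and p: "1 \<le> p" "p < n"
  shows "real (a (n - p) + b (n - p)) \<le> 4 / 3 * ((real d)\<^sup>2 / 2 + real d) ^ 2 ^ (p - 1)"
  using p
proof (induction p rule: less_induct)
  case (less p)
  define A where "A = (real d)\<^sup>2 / 2 + real d"
  define u where "u m = (Suc (a (n - (p - m))) choose Suc m) + (Suc (b (n - (p - m))) choose Suc m)" for m
  have rec: "real (a (n - p) + b (n - p)) = (\<Sum>m=1..<p. (-1) ^ Suc m * real (u m))
    + (-1) ^ Suc p * (2 * real (d choose p))"
  proof -
    have "real_of_int (int (a (n - p) + b (n - p))) = real_of_int ((\<Sum>m=1..<p. (-1) ^ Suc m * int (u m))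
      + (-1) ^ Suc p * (2 * int (d choose p)))"
      using recursion[OF less.prems] unfolding u_def by (rule arg_cong)
    then show ?thesis by simp
  qed
  show ?case
  proof (cases "p = 1")
    case True
    \<comment> \<open>For p = 1 the sum is exactly 2d, and 2d <= 2/3 d^2 + 4/3 d because d >=
      1.\<close>
    have "1 * real d \<le> real d * real d"
      using d by (intro mult_right_mono) auto
    then have "2 * real d \<le> 4 / 3 * A"
      unfolding A_def by (simp add: power2_eq_square)
    then show ?thesis
      using rec True by (simp add: A_def)
  next
    case False
    then have "2 \<le> p" using less.prems by simp
    moreover have "real (u m) \<le> real (Suc (a (n - (p - m)) + b (n - (p - m))) choose Suc m)"
      if "m \<in> {1..<p}" for m
      unfolding u_def using that by (intro of_nat_mono binomial_superadditive) auto
    moreover have "real (a (n - (p - m)) + b (n - (p - m))) \<le> 4 / 3 * A ^ 2 ^ (p - m - 1)"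
      if "m \<in> {1..<p}" for m
      unfolding A_def using that less.prems by (intro less.IH) auto
    ultimately show ?thesis
      unfolding rec A_def[symmetric]
      by (intro recursion_tail_bound[where s = "\<lambda>m. a (n - (p - m)) + b (n - (p - m))", OF d A_def]) auto
  qed
qed

text \<open>The successor anticipates that a minimal leading monomial may lie one degree above a
  cone. Points are covered by \<open>zero_dim_bound\<close>, and codimension n - 1 yields the
  thresholds of index 1.\<close>

lemma degree_bound:
  assumes d: "1 \<le> d" and e: "e < b 1 \<or> e \<in># W"
  shows "real (Suc e) \<le> 4 / 3 * ((real d)\<^sup>2 / 2 + real d) ^ 2 ^ (n - 2)"
proof -
  have "Suc e \<le> a 1 + b 1"
    using e zero_dim_bound[of e] by auto
  then have "real (Suc e) \<le> real (a 1 + b 1)"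
    by (simp only: of_nat_le_iff)
  also have "\<dots> \<le> 4 / 3 * ((real d)\<^sup>2 / 2 + real d) ^ 2 ^ (n - 2)"
    using macaulay_constant_bound[OF d, of "n - 1"] n_ge_2 by (simp add: numeral_2_eq_2)
  finally show ?thesis .
qed

end

section \<open>Cone decompositions of monomial sets\<close>

definition cube :: "'a set \<Rightarrow> ('a \<Rightarrow> nat) set" where
  "cube U = {h. \<forall>i. i \<notin> U \<longrightarrow> h i = 0}"

definition down_set :: "'a set \<Rightarrow> ('a \<Rightarrow> nat) set \<Rightarrow> bool" where
  "down_set U M \<longleftrightarrow> M \<subseteq> cube U \<and> (\<forall>h\<in>M. \<forall>g\<le>h. g \<in> M)"

definition hilbert :: "'a set \<Rightarrow> ('a \<Rightarrow> nat) set \<Rightarrow> int fps" where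
  "hilbert U M = Abs_fps (\<lambda>z. int (card {h \<in> M. sum h U = z}))"

text \<open>Membership is decided after truncating exponents at \<open>c\<close>. For a down-set
  this says that the complementary monomial ideal has generators with exponents at most
  \<open>c\<close>; counting inside the box supplies a finite measure for induction.\<close>

definition boxed :: "'a set \<Rightarrow> nat \<Rightarrow> ('a \<Rightarrow> nat) set \<Rightarrow> bool" where
  "boxed U c M \<longleftrightarrow> (\<forall>h\<in>cube U. h \<in> M \<longleftrightarrow> (\<lambda>i. min (h i) c) \<in> M)"

lemma cube_mono: "U \<subseteq> V \<Longrightarrow> cube U \<subseteq> cube V"
  by (auto simp: cube_def)

lemma cube_min: "h \<in> cube U \<Longrightarrow> (\<lambda>i. min (h i) c) \<in> cube U"
  by (auto simp: cube_def)

lemma cube_upd: "x \<in> U \<Longrightarrow> h \<in> cube U \<Longrightarrow> h(x := j) \<in> cube U"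
  by (auto simp: cube_def)

lemma cube_down:
  assumes "g \<le> h" "h \<in> cube U"
  shows "g \<in> cube U"
  unfolding cube_def
proof (intro CollectI allI impI)
  fix i assume "i \<notin> U"
  then show "g i = 0"
    using assms le_funD[OF assms(1), of i] by (simp add: cube_def)
qed

lemma cube_empty: "cube {} = {\<lambda>_. 0}"
  by (auto simp: cube_def)

lemma down_setD: "down_set U M \<Longrightarrow> h \<in> M \<Longrightarrow> g \<le> h \<Longrightarrow> g \<in> M"
  unfolding down_set_def by blast

lemma down_set_subset: "down_set U M \<Longrightarrow> M \<subseteq> cube U"
  unfolding down_set_def by blast

lemma finite_box:
  assumes "finite U"
  shows "finite {h \<in> cube U. \<forall>i. h i \<le> c}"
proof (rule finite_subset)
  show "{h \<in> cube U. \<forall>i. h i \<le> c} \<subseteq> {h. \<forall>i. (i \<in> U \<longrightarrow> h i \<in> {..c}) \<and> (i \<notin> U \<longrightarrow> h i = 0)}"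
    by (auto simp: cube_def)
  show "finite {h :: 'a \<Rightarrow> nat. \<forall>i. (i \<in> U \<longrightarrow> h i \<in> {..c}) \<and> (i \<notin> U \<longrightarrow> h i = 0)}"
    by (rule finite_set_of_finite_funs[OF assms]) simp
qed

lemma finite_degree:
  assumes "finite U" "M \<subseteq> cube U"
  shows "finite {h \<in> M. sum h U = z}"
proof (rule finite_subset[OF _ finite_box[OF assms(1), of z]])
  show "{h \<in> M. sum h U = z} \<subseteq> {h \<in> cube U. \<forall>i. h i \<le> z}"
  proof
    fix h assume h: "h \<in> {h \<in> M. sum h U = z}"
    then have "h \<in> cube U"
      using assms(2) by blast
    moreover have "h i \<le> z" for i
    proof (cases "i \<in> U")
      case True
      then have "h i \<le> sum h U"
        using assms(1) by (intro member_le_sum) auto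
      with h show ?thesis by simp
    qed (use \<open>h \<in> cube U\<close> in \<open>simp add: cube_def\<close>)
    ultimately show "h \<in> {h \<in> cube U. \<forall>i. h i \<le> z}"
      by blast
  qed
qed

lemma boxed_mono:
  assumes "boxed U c M" "c \<le> c'"
  shows "boxed U c' M"
  unfolding boxed_def
proof
  fix h assume h: "h \<in> cube U"
  have "(\<lambda>i. min (min (h i) c') c) = (\<lambda>i. min (h i) c)"
    using assms(2) by (auto simp: min_def)
  then show "h \<in> M \<longleftrightarrow> (\<lambda>i. min (h i) c') \<in> M"
    using assms(1) h cube_min[OF h, of c'] unfolding boxed_def by metis
qed

text \<open>A form of Dickson's lemma.\<close>

lemma down_set_boxed:
  assumes "finite U" "down_set U M"
  shows "\<exists>c. boxed U c M"
  using assms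
proof (induction U arbitrary: M)
  case empty
  have "(\<lambda>i. min (h i) 0) = h" if "h \<in> cube {}" for h :: "'a \<Rightarrow> nat"
    using that by (auto simp: cube_def)
  then show ?case
    unfolding boxed_def by metis
next
  case (insert x U)
  \<comment> \<open>The slices at a fixed exponent of \<open>x\<close> decrease as the exponent
    grows; \<open>S'\<close> is their intersection.\<close>
  define S where "S j = {h \<in> cube U. h(x := j) \<in> M}" for j
  define S' where "S' = {h \<in> cube U. \<forall>j. h(x := j) \<in> M}"
  have upd: "g(x := i) \<le> h(x := j)" if "g \<le> h" "i \<le> j" for g h :: "'a \<Rightarrow> nat" and i j
    using that by (auto simp: le_fun_def)
  have S: "down_set U (S j)" for j
    unfolding down_set_def S_def
    using cube_down down_setD[OF insert.prems] upd by blast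
  have S': "down_set U S'"
    unfolding down_set_def S'_def
    using cube_down down_setD[OF insert.prems] upd by blast
  have S_anti: "S j \<subseteq> S i" if "i \<le> j" for i j
    unfolding S_def using down_setD[OF insert.prems] upd[OF order_refl that] by blast
  obtain c' where c': "boxed U c' S'"
    using insert.IH[OF S'] by blast
  have "\<forall>j. \<exists>c. boxed U c (S j)"
    using insert.IH[OF S] by blast
  then obtain cs where cs: "\<And>j. boxed U (cs j) (S j)"
    by metis
  \<comment> \<open>Each of the finitely many box points outside \<open>S'\<close> has left the
    slices by some stage. From the latest such stage \<open>J\<close> on, a slice agrees with
    \<open>S'\<close> inside the box and therefore, \<open>S'\<close> being boxed,
    everywhere.\<close>
  define B where "B = {h \<in> cube U. \<forall>i. h i \<le> c'} - S'"
  have "finite B"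
    unfolding B_def using finite_box[OF insert.hyps(1)] by blast
  have "\<forall>h\<in>B. \<exists>j. h \<notin> S j"
    unfolding B_def S_def S'_def by blast
  then obtain js where js: "\<And>h. h \<in> B \<Longrightarrow> h \<notin> S (js h)"
    by metis
  define J where "J = Max (insert 0 (js ` B))"
  have J: "js h \<le> J" if "h \<in> B" for h
    unfolding J_def using \<open>finite B\<close> that by (intro Max_ge) auto
  have S_J: "S j = S'" if "J \<le> j" for j
  proof
    show "S' \<subseteq> S j"
      unfolding S_def S'_def by blast
    show "S j \<subseteq> S'"
    proof
      fix h assume h: "h \<in> S j"
      define g where "g = (\<lambda>i. min (h i) c')"
      have "h \<in> cube U"
        using h unfolding S_def by blast
      have "g \<le> h"
        by (auto simp: g_def le_fun_def)
      then have "g \<in> S j"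
        using down_setD[OF S h] by blast
      have "g \<notin> B"
      proof
        assume "g \<in> B"
        then have "g \<notin> S (js g)" "js g \<le> j"
          using js J that by (auto intro: order_trans)
        then show False
          using \<open>g \<in> S j\<close> S_anti by blast
      qed
      moreover have "g \<in> {h \<in> cube U. \<forall>i. h i \<le> c'}"
        using cube_min[OF \<open>h \<in> cube U\<close>] by (simp add: g_def)
      ultimately have "g \<in> S'"
        unfolding B_def by blast
      then show "h \<in> S'"
        using c' \<open>h \<in> cube U\<close> unfolding boxed_def g_def by blast
    qed
  qed
  \<comment> \<open>The slices stop changing at \<open>J\<close>, so only the box constants of the
    finitely many slices up to \<open>J\<close> have to be accommodated.\<close>
  define c where "c = Max (insert J (cs ` {..J}))"
  have "J \<le> c"
    unfolding c_def by (intro Max_ge) auto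
  have S_min: "S (min j c) = S j" for j
    using S_J \<open>J \<le> c\<close> by (cases "j \<le> c") (auto simp: min_def)
  have boxed: "boxed U c (S j)" for j
  proof -
    have "cs (min j J) \<le> c"
      unfolding c_def by (intro Max_ge) auto
    moreover have "S (min j J) = S j"
      using S_J by (cases "j \<le> J") (auto simp: min_def)
    ultimately show ?thesis
      using boxed_mono[OF cs[of "min j J"]] by simp
  qed
  have M_iff: "h \<in> M \<longleftrightarrow> h(x := 0) \<in> S (h x)" if "h \<in> cube (insert x U)" for h
    using that unfolding S_def by (auto simp: cube_def)
  have "boxed (insert x U) c M"
    unfolding boxed_def
  proof
    fix h assume h: "h \<in> cube (insert x U)"
    define g where "g = (\<lambda>i. min (h i) c)"
    have "h(x := 0) \<in> cube U"
      using h by (auto simp: cube_def)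
    then have "h(x := 0) \<in> S (h x) \<longleftrightarrow> (\<lambda>i. min ((h(x := 0)) i) c) \<in> S (h x)"
      using boxed unfolding boxed_def by blast
    also have "(\<lambda>i. min ((h(x := 0)) i) c) = g(x := 0)"
      by (auto simp: g_def)
    finally have "h(x := 0) \<in> S (h x) \<longleftrightarrow> g(x := 0) \<in> S (h x)" .
    moreover have "S (h x) = S (g x)"
      unfolding g_def by (simp add: S_min)
    moreover have "g \<in> M \<longleftrightarrow> g(x := 0) \<in> S (g x)"
      unfolding g_def by (rule M_iff[OF cube_min[OF h]])
    ultimately show "h \<in> M \<longleftrightarrow> g \<in> M"
      using M_iff[OF h] by blast
  qed
  then show ?case by blast
qed

text \<open>Monomials free of \<open>x\<close> form the slice, and the others are \<open>x\<close>
  times the colon by \<open>x\<close>.\<close>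

lemma hilbert_split:
  assumes U: "finite U" "x \<in> U" and M: "M \<subseteq> cube U"
  shows "hilbert U M = hilbert (U - {x}) (M \<inter> cube (U - {x})) +
    fps_X * hilbert U {h \<in> cube U. h(x := Suc (h x)) \<in> M}"
    (is "_ = hilbert _ ?M0 + _ * hilbert _ ?M1")
proof (rule fps_ext)
  fix z
  have sumU: "sum h U = h x + sum h (U - {x})" for h :: "'a \<Rightarrow> nat"
    using U by (simp add: sum.remove)
  have "{h \<in> M. sum h U = z} = {h \<in> M. sum h U = z \<and> h x = 0} \<union> {h \<in> M. sum h U = z \<and> h x \<noteq> 0}"
    by blast
  moreover have "card ({h \<in> M. sum h U = z \<and> h x = 0} \<union> {h \<in> M. sum h U = z \<and> h x \<noteq> 0}) =
      card {h \<in> M. sum h U = z \<and> h x = 0} + card {h \<in> M. sum h U = z \<and> h x \<noteq> 0}"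
    by (rule card_Un_disjoint) (auto intro: finite_subset[OF _ finite_degree[OF U(1) M, of z]])
  moreover have "{h \<in> M. sum h U = z \<and> h x = 0} = {h \<in> ?M0. sum h (U - {x}) = z}"
    using M by (auto simp: sumU cube_def)
  moreover have "int (card {h \<in> M. sum h U = z \<and> h x \<noteq> 0}) = (fps_X * hilbert U ?M1) $ z"
  proof (cases z)
    case 0
    then have none: "{h \<in> M. sum h U = z \<and> h x \<noteq> 0} = {}"
      by (auto simp: sumU)
    show ?thesis
      unfolding none by (simp add: 0)
  next
    case (Suc y)
    have "card {h \<in> M. sum h U = z \<and> h x \<noteq> 0} = card {h \<in> ?M1. sum h U = y}"
    proof (rule bij_betw_same_card[OF bij_betw_byWitness[where f = "\<lambda>h. h(x := h x - 1)"
            and f' = "\<lambda>h. h(x := Suc (h x))"]])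
      have [simp]: "sum (h(x := j)) (U - {x}) = sum h (U - {x})" for h :: "'a \<Rightarrow> nat" and j
        by (intro sum.cong) auto
      show "\<forall>h\<in>{h \<in> M. sum h U = z \<and> h x \<noteq> 0}. (h(x := h x - 1))(x := Suc ((h(x := h x - 1)) x)) = h"
        by auto
      show "\<forall>h\<in>{h \<in> ?M1. sum h U = y}. (h(x := Suc (h x)))(x := (h(x := Suc (h x))) x - 1) = h"
        by auto
      show "(\<lambda>h. h(x := h x - 1)) ` {h \<in> M. sum h U = z \<and> h x \<noteq> 0} \<subseteq> {h \<in> ?M1. sum h U = y}"
        using M Suc U(2) by (auto simp: sumU cube_def)
      show "(\<lambda>h. h(x := Suc (h x))) ` {h \<in> ?M1. sum h U = y} \<subseteq> {h \<in> M. sum h U = z \<and> h x \<noteq> 0}"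
        using Suc by (auto simp: sumU)
    qed
    then show ?thesis
      using Suc by (simp add: hilbert_def)
  qed
  ultimately show "hilbert U M $ z = (hilbert (U - {x}) ?M0 + fps_X * hilbert U ?M1) $ z"
    by (simp add: hilbert_def)
qed

lemma hilbert_cube:
  assumes "finite U"
  shows "hilbert U (cube U) = geom ^ card U"
  using assms
proof (induction U)
  case empty
  show ?case
    by (intro fps_ext) (simp add: hilbert_def cube_empty)
next
  case (insert x U)
  let ?U = "insert x U" and ?H = "hilbert (insert x U) (cube (insert x U))"
  have "?U - {x} = U" "cube ?U \<inter> cube U = cube U"
    using insert.hyps cube_mono[of U ?U] by auto
  moreover have "{h \<in> cube ?U. h(x := Suc (h x)) \<in> cube ?U} = cube ?U"
    by (auto simp: cube_def)
  ultimately have "?H = geom ^ card U + fps_X * ?H"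
    using hilbert_split[of ?U x "cube ?U"] insert by simp
  then have "(1 - fps_X) * ?H = geom ^ card U"
    by (simp add: left_diff_distrib diff_eq_eq)
  then have "geom * ((1 - fps_X) * ?H) = geom ^ card ?U"
    using insert.hyps by simp
  moreover have "geom * ((1 - fps_X) * ?H) = ?H"
    using geom_mult by (simp add: mult.assoc[symmetric] mult.commute[of geom])
  ultimately show ?case
    by simp
qed

text \<open>Corners are the minimal generators of the monomial ideal complementary to
  \<open>M\<close>; for a set of standard monomials these are the minimal leading exponents, whose
  degrees are wanted.\<close>

definition corner :: "'a set \<Rightarrow> ('a \<Rightarrow> nat) set \<Rightarrow> ('a \<Rightarrow> nat) \<Rightarrow> bool" where
  "corner U M h \<longleftrightarrow> h \<in> cube U \<and> h \<notin> M \<and> (\<forall>i\<in>U. 0 < h i \<longrightarrow> h(i := h i - 1) \<in> M)"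

text \<open>The measure falls on both sides of a split along a variable: the slice loses the
  variable, the colon loses a point of the box. The claims on cubes strengthen the induction:
  dimensions come from cubes inside \<open>M\<close>, and a largest such cube is matched by a cone
  in degree 0, which fills the only gap that opens when the cones of the colon are shifted up by
  one.\<close>

lemma boxed_cone_decomposition:
  assumes "finite U" "down_set U M" "boxed U c M"
  shows "\<exists>P. cone_series P = hilbert U M \<and> standard 0 P \<and>
    (\<forall>p\<in>#P. \<exists>s\<subseteq>U. card s = snd p \<and> cube s \<subseteq> M) \<and>
    (\<forall>s\<subseteq>U. cube s \<subseteq> M \<longrightarrow> (\<exists>k\<ge>card s. (0, k) \<in># P)) \<and>
    (\<forall>h. corner U M h \<longrightarrow> sum h U = 0 \<or> (\<exists>p\<in>#P. sum h U \<le> Suc (fst p)))"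
  using assms
proof (induction "card U + card (M \<inter> {h \<in> cube U. \<forall>i. h i \<le> c})" arbitrary: U M rule: less_induct)
  case less
  note fin = less.prems(1) and down = less.prems(2)
  consider "M = {}" | "M = cube U" | "M \<noteq> {}" "M \<noteq> cube U"
    by blast
  then show ?case
  proof cases
    case 1
    have "hilbert U M = 0"
      by (rule fps_ext) (simp add: hilbert_def 1)
    moreover have "sum h U = 0" if "corner U M h" for h
      using that unfolding corner_def 1 by (intro sum.neutral) auto
    moreover have "\<not> cube s \<subseteq> M" for s
      unfolding 1 by (auto simp: cube_def)
    ultimately show ?thesis
      by (intro exI[of _ "{#}"]) (simp add: standard_def)
  next
    case 2
    have "\<not> corner U M h" for h
      unfolding corner_def 2 by simp
    moreover have "card s \<le> card U" if "s \<subseteq> U" for s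
      using fin that by (rule card_mono)
    ultimately show ?thesis
      using hilbert_cube[OF fin]
      by (intro exI[of _ "{#(0, card U)#}"]) (auto simp: standard_def 2)
  next
    case 3
    txt \<open>
      Splitting along a variable \<open>x\<close> outside a coordinate cube \<open>t\<close> of maximal dimension in \<open>M\<close> keeps
      the decomposition standard, since \<open>t\<close> survives in the slice \<open>x = 0\<close>.
    \<close>
    define T where "T = {s. s \<subseteq> U \<and> cube s \<subseteq> M}"
    have "finite T"
      unfolding T_def using fin by simp
    obtain h0 where "h0 \<in> M"
      using 3 by blast
    have "(\<lambda>_. 0) \<in> M"
      by (rule down_setD[OF down \<open>h0 \<in> M\<close>]) (simp add: le_fun_def)
    then have "{} \<in> T"
      unfolding T_def by (simp add: cube_empty)
    have "Max (card ` T) \<in> card ` T"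
      using \<open>finite T\<close> \<open>{} \<in> T\<close> by (intro Max_in) auto
    then obtain t where "t \<in> T" "card t = Max (card ` T)"
      by auto
    then have "t \<in> T" "\<forall>s\<in>T. card s \<le> card t"
      using \<open>finite T\<close> by simp_all
    then obtain t where t: "t \<subseteq> U" "cube t \<subseteq> M"
      and t_max: "\<And>s. s \<subseteq> U \<Longrightarrow> cube s \<subseteq> M \<Longrightarrow> card s \<le> card t"
      unfolding T_def by blast
    have "t \<noteq> U"
      using 3 t down_set_subset[OF down] by blast
    then obtain x where x: "x \<in> U" "x \<notin> t"
      using t by blast
    define M0 where "M0 = M \<inter> cube (U - {x})"
    define M1 where "M1 = {h \<in> cube U. h(x := Suc (h x)) \<in> M}"
    have M0: "down_set (U - {x}) M0"
      unfolding down_set_def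
    proof (intro conjI ballI allI impI)
      fix h g assume "h \<in> M0" "g \<le> h"
      then show "g \<in> M0"
        unfolding M0_def using down_setD[OF down] cube_down[of g h] by blast
    qed (simp add: M0_def)
    have le_upd: "g(x := Suc (g x)) \<le> h(x := Suc (h x))" "g \<le> g(x := Suc (g x))"
      if "g \<le> h" for g h :: "'a \<Rightarrow> nat"
      using that by (auto simp: le_fun_def)
    have M1: "down_set U M1"
      unfolding down_set_def
    proof (intro conjI ballI allI impI)
      fix h g assume "h \<in> M1" "g \<le> h"
      then show "g \<in> M1"
        unfolding M1_def using down_setD[OF down] cube_down[of g h] le_upd(1) by blast
    qed (simp add: M1_def)
    have M1_sub: "M1 \<subseteq> M"
      unfolding M1_def using down_setD[OF down] le_upd(2)[OF order_refl] by blast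
    have M0_boxed: "boxed (U - {x}) c M0"
      unfolding boxed_def
    proof
      fix h :: "'a \<Rightarrow> nat" assume h: "h \<in> cube (U - {x})"
      then have "h \<in> cube U"
        using cube_mono[of "U - {x}" U] by blast
      then have "h \<in> M \<longleftrightarrow> (\<lambda>i. min (h i) c) \<in> M"
        using less.prems(3) unfolding boxed_def by blast
      then show "h \<in> M0 \<longleftrightarrow> (\<lambda>i. min (h i) c) \<in> M0"
        unfolding M0_def using h cube_min[OF h, of c] by blast
    qed
    have M1_boxed: "boxed U c M1"
      unfolding boxed_def
    proof
      fix h assume h: "h \<in> cube U"
      define g where "g = (\<lambda>i. min (h i) c)"
      have g: "g \<in> cube U"
        unfolding g_def by (rule cube_min[OF h])
      have "h \<in> M1 \<longleftrightarrow> (\<lambda>i. min ((h(x := Suc (h x))) i) c) \<in> M"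
        using less.prems(3) h cube_upd[OF x(1) h] unfolding boxed_def M1_def by blast
      also have "(\<lambda>i. min ((h(x := Suc (h x))) i) c) = (\<lambda>i. min ((g(x := Suc (g x))) i) c)"
        by (rule ext) (simp add: g_def min_def)
      also have "\<dots> \<in> M \<longleftrightarrow> g \<in> M1"
        using less.prems(3) g cube_upd[OF x(1) g] unfolding boxed_def M1_def by blast
      finally show "h \<in> M1 \<longleftrightarrow> g \<in> M1" .
    qed
    have "card (U - {x}) + card (M0 \<inter> {h \<in> cube (U - {x}). \<forall>i. h i \<le> c})
        < card U + card (M \<inter> {h \<in> cube U. \<forall>i. h i \<le> c})"
    proof (rule add_less_le_mono)
      show "card (U - {x}) < card U"
        using fin x by (intro psubset_card_mono) auto
      show "card (M0 \<inter> {h \<in> cube (U - {x}). \<forall>i. h i \<le> c}) \<le> card (M \<inter> {h \<in> cube U. \<forall>i. h i \<le> c})"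
        using finite_box[OF fin] cube_mono[of "U - {x}" U]
        by (intro card_mono) (auto simp: M0_def)
    qed
    from less.hyps[OF this finite_Diff[OF fin] M0 M0_boxed]
    obtain P0 where P0: "cone_series P0 = hilbert (U - {x}) M0" "standard 0 P0"
      "\<forall>p\<in>#P0. \<exists>s\<subseteq>U - {x}. card s = snd p \<and> cube s \<subseteq> M0"
      "\<forall>s\<subseteq>U - {x}. cube s \<subseteq> M0 \<longrightarrow> (\<exists>k\<ge>card s. (0, k) \<in># P0)"
      "\<forall>h. corner (U - {x}) M0 h \<longrightarrow> sum h (U - {x}) = 0 \<or> (\<exists>p\<in>#P0. sum h (U - {x}) \<le> Suc (fst p))"
      by (elim exE conjE) (rule that)
    \<comment> \<open>By maximality of \<open>t\<close> some exponent in
      \<open>cube (insert x t)\<close> lies outside \<open>M\<close>, and truncation keeps it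
      outside. Its \<open>x\<close>-coordinate is raised from 0, where it lies in
      \<open>cube t\<close>; the last point before leaving \<open>M\<close> is a box point missing
      from the colon.\<close>
    have "\<exists>g\<in>M \<inter> {h \<in> cube U. \<forall>i. h i \<le> c}. g \<notin> M1"
    proof -
      have "\<not> cube (insert x t) \<subseteq> M"
        using t_max[of "insert x t"] t x finite_subset[OF t(1) fin] by auto
      then obtain f where f: "f \<in> cube (insert x t)" "f \<notin> M"
        by blast
      define g where "g = (\<lambda>i. min (f i) c)"
      have "f \<in> cube U"
        using f(1) cube_mono[of "insert x t" U] t x by blast
      then have g: "g \<in> cube U" "g \<notin> M"
        using less.prems(3) f(2) cube_min unfolding boxed_def g_def by blast+
      have "g(x := 0) \<in> cube t"
        using f(1) by (auto simp: cube_def g_def)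
      then have "g(x := 0) \<in> M" "g(x := g x) \<notin> M"
        using t g by auto
      then obtain j where j: "j < g x" "g(x := j) \<in> M" "g(x := Suc j) \<notin> M"
        using ex_least_nat_less[of "\<lambda>j. g(x := j) \<notin> M" "g x"] by auto
      have "\<forall>i. (g(x := j)) i \<le> c"
        using j(1) by (auto simp: g_def)
      then show ?thesis
        using j cube_upd[OF x(1) g(1)] by (intro bexI[of _ "g(x := j)"]) (auto simp: M1_def)
    qed
    then have "card (M1 \<inter> {h \<in> cube U. \<forall>i. h i \<le> c}) < card (M \<inter> {h \<in> cube U. \<forall>i. h i \<le> c})"
      using M1_sub finite_box[OF fin, of c] by (intro psubset_card_mono) auto
    then have "card U + card (M1 \<inter> {h \<in> cube U. \<forall>i. h i \<le> c}) <
        card U + card (M \<inter> {h \<in> cube U. \<forall>i. h i \<le> c})"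
      by simp
    from less.hyps[OF this fin M1 M1_boxed]
    obtain P1 where P1: "cone_series P1 = hilbert U M1" "standard 0 P1"
      "\<forall>p\<in>#P1. \<exists>s\<subseteq>U. card s = snd p \<and> cube s \<subseteq> M1"
      "\<forall>h. corner U M1 h \<longrightarrow> sum h U = 0 \<or> (\<exists>p\<in>#P1. sum h U \<le> Suc (fst p))"
      by (elim exE conjE) (rule that)
    define P1' where "P1' = image_mset (\<lambda>(e, k). (e + 1, k)) P1"
    have "cube t \<subseteq> M0"
      unfolding M0_def using t x cube_mono[of t "U - {x}"] by blast
    then obtain k0 where k0: "card t \<le> k0" "(0, k0) \<in># P0"
      using P0(4) t x by blast
    have series: "cone_series (P0 + P1') = hilbert U M"
      unfolding P1'_def cone_series_union cone_series_shift P0(1) P1(1)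
      using hilbert_split[OF fin x(1) down_set_subset[OF down]] by (simp add: M0_def M1_def)
    have dims: "\<exists>s\<subseteq>U. card s = snd p \<and> cube s \<subseteq> M" if "p \<in># P0 + P1'" for p
    proof (cases "p \<in># P0")
      case True
      then obtain s where "s \<subseteq> U - {x}" "card s = snd p" "cube s \<subseteq> M0"
        using P0(3) by blast
      then show ?thesis
        unfolding M0_def by blast
    next
      case False
      with that obtain e k where "(e, k) \<in># P1" "p = (e + 1, k)"
        by (auto simp: P1'_def)
      with P1(3) M1_sub show ?thesis
        by (metis order_trans snd_conv)
    qed
    have std: "standard 0 (P0 + P1')"
      unfolding standard_def
    proof (intro allI impI conjI ballI)
      fix e k d assume ek: "(e, k) \<in># P0 + P1'" "0 < k" and d: "d \<in> {0..e}"
      show "\<exists>l\<ge>k. (d, l) \<in># P0 + P1'"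
      proof (cases "(e, k) \<in># P0")
        case True
        then show ?thesis
          using standardD(2)[OF P0(2) _ ek(2) d] by auto
      next
        case False
        then have P: "(e, k) \<in># P1'"
          using ek(1) by simp
        have "standard (0 + 1) P1'"
          unfolding P1'_def by (rule standard_shift[OF P1(2)])
        note * = standardD(2)[OF this P ek(2), of d]
        show ?thesis
        proof (cases "d = 0")
          case True
          have "k \<le> card t"
            using dims[OF ek(1)] t_max by auto
          with k0 True show ?thesis
            by (intro exI[of _ k0]) auto
        next
          case False
          with * d show ?thesis by auto
        qed
      qed
    qed simp
    have corners: "sum h U = 0 \<or> (\<exists>p\<in>#P0 + P1'. sum h U \<le> Suc (fst p))" if h: "corner U M h" for h
    proof (cases "h x = 0")
      case True
      have h0: "h \<in> cube (U - {x})"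
        using h True by (auto simp: corner_def cube_def)
      have "corner (U - {x}) M0 h"
        unfolding corner_def
      proof (intro conjI ballI impI)
        fix i assume i: "i \<in> U - {x}" "0 < h i"
        then have "h(i := h i - 1) \<in> M"
          using h unfolding corner_def by blast
        then show "h(i := h i - 1) \<in> M0"
          unfolding M0_def using cube_upd[OF i(1) h0] by blast
      qed (use h h0 in \<open>auto simp: corner_def M0_def\<close>)
      moreover have "sum h U = sum h (U - {x})"
        using fin x True by (simp add: sum.remove)
      ultimately show ?thesis
        using P0(5) by auto
    next
      case False
      \<comment> \<open>Dividing a corner by \<open>x\<close> gives a corner of the colon; its
        degree falls by one, which the shift of the cones of the colon makes up for.\<close>
      define g where "g = h(x := h x - 1)"
      have h': "g(x := Suc (g x)) = h"
        using False by (auto simp: g_def)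
      have g: "g \<in> cube U"
        unfolding g_def using h x by (intro cube_upd) (auto simp: corner_def)
      have "sum (h(x := h x - 1)) (U - {x}) = sum h (U - {x})"
        by (intro sum.cong) auto
      then have sum: "sum h U = Suc (sum g U)"
        using fin x False by (simp add: sum.remove[of U x] g_def)
      have "corner U M1 g"
        unfolding corner_def
      proof (intro conjI ballI impI)
        show "g \<notin> M1"
          using h by (simp add: M1_def h' corner_def)
        fix i assume i: "i \<in> U" "0 < g i"
        then have "0 < h i"
          by (auto simp: g_def split: if_splits)
        then have "h(i := h i - 1) \<in> M"
          using h i unfolding corner_def by blast
        moreover have "(g(i := g i - 1))(x := Suc ((g(i := g i - 1)) x)) = h(i := h i - 1)"
          using False i by (auto simp: g_def fun_eq_iff)
        ultimately show "g(i := g i - 1) \<in> M1"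
          unfolding M1_def using cube_upd[OF i(1) g] by simp
      qed (fact g)
      from P1(4)[rule_format, OF this] show ?thesis
      proof (elim disjE bexE)
        \<comment> \<open>Here \<open>h\<close> has degree 1, and the cone in degree 0
          serves.\<close>
        assume "sum g U = 0"
        then show ?thesis
          using sum k0(2) by (intro disjI2 bexI[of _ "(0, k0)"]) auto
      next
        fix p assume p: "p \<in># P1" "sum g U \<le> Suc (fst p)"
        then have "(fst p + 1, snd p) \<in># P1'"
          unfolding P1'_def by (force simp: case_prod_unfold)
        with p sum show ?thesis
          by (intro disjI2 bexI[of _ "(fst p + 1, snd p)"]) auto
      qed
    qed
    have "\<exists>k\<ge>card s. (0, k) \<in># P0 + P1'" if "s \<subseteq> U" "cube s \<subseteq> M" for s
      using t_max[OF that] k0 by (intro exI[of _ k0]) auto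
    with series std dims corners show ?thesis
      by blast
  qed
qed

lemma cone_decomposition:
  assumes "finite U" "down_set U M"
  shows "\<exists>P. cone_series P = hilbert U M \<and> standard 0 P \<and> (\<forall>p\<in>#P. snd p \<le> card U) \<and>
    (\<forall>h. corner U M h \<longrightarrow> sum h U = 0 \<or> (\<exists>p\<in>#P. sum h U \<le> Suc (fst p)))"
proof -
  obtain c where "boxed U c M"
    using down_set_boxed[OF assms] by blast
  from boxed_cone_decomposition[OF assms this] show ?thesis
    using card_mono[OF assms(1)] by metis
qed

lemma exists_corner_below:
  assumes "finite U" "down_set U M" "h \<in> cube U" "h \<notin> M"
  shows "\<exists>g\<le>h. corner U M g"
  using assms(3,4)
proof (induction "sum h U" arbitrary: h rule: less_induct)
  case less
  show ?case
  proof (cases "corner U M h")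
    case False
    then obtain i where i: "i \<in> U" "0 < h i" "h(i := h i - 1) \<notin> M"
      using less.prems unfolding corner_def by blast
    have "sum (h(i := h i - 1)) U < sum h U"
      using i assms(1) by (intro sum_strict_mono_ex1) auto
    from less.hyps[OF this cube_upd[OF i(1) less.prems(1)] i(3)]
    obtain g where "g \<le> h(i := h i - 1)" "corner U M g"
      by blast
    moreover have "h(i := h i - 1) \<le> h"
      by (auto simp: le_fun_def)
    ultimately show ?thesis
      by (meson order_trans)
  qed auto
qed

section \<open>Leading monomials in quadric algebras of solvable type\<close>

lemma exponents_iff: "\<alpha> \<in> exponents N \<longleftrightarrow> (\<forall>i. i \<notin> {1..N} \<longrightarrow> Poly_Mapping.lookup \<alpha> i = 0)"
  by (auto simp: exponents_def in_keys_iff)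

lemma exponents_0 [simp]: "0 \<in> exponents N"
  by (simp add: exponents_iff)

lemma exponents_add: "\<alpha> \<in> exponents N \<Longrightarrow> \<beta> \<in> exponents N \<Longrightarrow> \<alpha> + \<beta> \<in> exponents N"
  by (simp add: exponents_iff lookup_add)

lemma exponents_single: "i \<in> {1..N} \<Longrightarrow> Poly_Mapping.single i 1 \<in> exponents N"
  by (simp add: exponents_iff lookup_single when_def)

lemma total_degree_0 [simp]: "total_degree N 0 = 0"
  by (simp add: total_degree_def)

lemma total_degree_add: "total_degree N (\<alpha> + \<beta>) = total_degree N \<alpha> + total_degree N \<beta>"
  by (simp add: total_degree_def lookup_add sum.distrib)

lemma exponents_diff:
  assumes "\<alpha> \<in> exponents N" "\<beta> \<in> exponents N" "exp_divides N \<alpha> \<beta>"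
  shows "\<beta> - \<alpha> \<in> exponents N" "(\<beta> - \<alpha>) + \<alpha> = \<beta>"
proof -
  show "\<beta> - \<alpha> \<in> exponents N"
    using assms(1,2) by (simp add: exponents_iff lookup_minus)
  show "(\<beta> - \<alpha>) + \<alpha> = \<beta>"
  proof (rule poly_mapping_eqI)
    fix i
    show "Poly_Mapping.lookup ((\<beta> - \<alpha>) + \<alpha>) i = Poly_Mapping.lookup \<beta> i"
      using assms unfolding exponents_iff exp_divides_def
      by (cases "i \<in> {1..N}") (simp_all add: lookup_add lookup_minus)
  qed
qed

section \<open>Words in the generators and their exponents\<close>

definition word_content :: "nat list \<Rightarrow> (nat \<Rightarrow>\<^sub>0 nat)" where
  "word_content w = (\<Sum>i\<leftarrow>w. Poly_Mapping.single i 1)"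

definition sorted_word :: "nat \<Rightarrow> (nat \<Rightarrow>\<^sub>0 nat) \<Rightarrow> nat list" where
  "sorted_word N \<alpha> = concat (map (\<lambda>i. replicate (Poly_Mapping.lookup \<alpha> i) i) [1..<Suc N])"

lemma content_simps [simp]:
  "word_content [] = 0" "word_content (i # w) = Poly_Mapping.single i 1 + word_content w"
  "word_content (u @ v) = word_content u + word_content v"
  by (simp_all add: word_content_def)

lemma content_insort: "word_content (insort i w) = Poly_Mapping.single i 1 + word_content w"
  by (induction w) (simp_all add: add.left_commute)

lemma content_sort: "word_content (sort w) = word_content w"
  by (induction w) (simp_all add: content_insort)

lemma content_exponents: "set w \<subseteq> {1..N} \<Longrightarrow> word_content w \<in> exponents N"
  by (induction w) (simp_all add: exponents_add exponents_single del: One_nat_def)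

lemma total_degree_content: "set w \<subseteq> {1..N} \<Longrightarrow> total_degree N (word_content w) = length w"
proof (induction w)
  case (Cons i w)
  have "total_degree N (Poly_Mapping.single i 1) = (\<Sum>j=1..N. if j = i then 1 else 0)"
    unfolding total_degree_def by (intro sum.cong) (auto simp: lookup_single when_def)
  also have "\<dots> = 1"
    using Cons.prems by (subst sum.delta) auto
  finally show ?case
    using Cons by (simp add: total_degree_add)
qed simp

lemma lookup_content: "Poly_Mapping.lookup (word_content w) i = count (mset w) i"
  by (induction w) (auto simp: lookup_add lookup_single when_def)

lemma sorted_word_set: "set (sorted_word N \<alpha>) \<subseteq> {1..N}"
  by (auto simp: sorted_word_def)

lemma count_sorted_word:
  "count (mset (sorted_word N \<alpha>)) i = (if i \<in> {1..N} then Poly_Mapping.lookup \<alpha> i else 0)"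
  by (induction N) (auto simp: sorted_word_def)

lemma content_sorted_word:
  assumes "\<alpha> \<in> exponents N"
  shows "word_content (sorted_word N \<alpha>) = \<alpha>"
  by (rule poly_mapping_eqI)
    (use assms in \<open>auto simp: lookup_content count_sorted_word exponents_iff\<close>)

lemma length_sorted_word: "\<alpha> \<in> exponents N \<Longrightarrow> length (sorted_word N \<alpha>) = total_degree N \<alpha>"
  using total_degree_content[OF sorted_word_set] content_sorted_word by metis

lemma sorted_sorted_word: "sorted (sorted_word N \<alpha>)"
  by (induction N) (auto simp: sorted_word_def sorted_append sorted_replicate)

lemma sort_eq_sorted_word:
  assumes "set w \<subseteq> {1..N}"
  shows "sort w = sorted_word N (word_content w)"
proof (rule properties_for_sort)
  show "mset (sorted_word N (word_content w)) = mset w"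
  proof (rule multiset_eqI)
    fix i
    show "count (mset (sorted_word N (word_content w))) i = count (mset w) i"
      using assms by (auto simp: count_sorted_word lookup_content count_eq_zero_iff)
  qed
qed (rule sorted_sorted_word)

lemma monomial_eq_word: "monomial N x \<alpha> = prod_list (map x (sorted_word N \<alpha>))"
proof -
  have "prod_list (map x (concat (map (\<lambda>i. replicate (f i) i) l))) = prod_list (map (\<lambda>i. x i ^ f i) l)"
    for l and f :: "nat \<Rightarrow> nat"
    by (induction l) (simp_all add: map_replicate)
  then show ?thesis
    unfolding monomial_def sorted_word_def by simp
qed

lemma monomial_0 [simp]: "monomial N x 0 = 1"
proof -
  have "sorted_word N 0 = []"
    by (simp add: sorted_word_def)
  then show ?thesis
    by (simp add: monomial_eq_word)
qed

locale quadric_solvable = k_algebra scale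
  for scale :: "'k::field \<Rightarrow> 'r::ring_1 \<Rightarrow> 'r" (infixr \<open>*s\<close> 75) +
  fixes N :: nat and x :: "nat \<Rightarrow> 'r" and r :: "(nat \<Rightarrow>\<^sub>0 nat) rel"
  assumes ordering: "monomial_ordering N r"
    and solvable: "solvable_type N x r"
    and quadric: "quadric N x r"
begin

abbreviation mon :: "(nat \<Rightarrow>\<^sub>0 nat) \<Rightarrow> 'r" where
  "mon \<equiv> monomial N x"

abbreviation word :: "nat list \<Rightarrow> 'r" where
  "word w \<equiv> prod_list (map x w)"

abbreviation less_r :: "(nat \<Rightarrow>\<^sub>0 nat) \<Rightarrow> (nat \<Rightarrow>\<^sub>0 nat) \<Rightarrow> bool" (infix \<open>\<prec>\<close> 50) where
  "\<alpha> \<prec> \<beta> \<equiv> (\<alpha>, \<beta>) \<in> r \<and> \<alpha> \<noteq> \<beta>"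

definition expo :: "nat \<Rightarrow> (nat \<Rightarrow>\<^sub>0 nat) set" where
  "expo s = {\<alpha> \<in> exponents N. total_degree N \<alpha> \<le> s}"

definition coef :: "'r \<Rightarrow> (nat \<Rightarrow>\<^sub>0 nat) \<Rightarrow> 'k" where
  "coef f \<alpha> = representation (mon ` exponents N) f (mon \<alpha>)"

definition filt :: "nat \<Rightarrow> 'r set" where
  "filt s = span (mon ` expo s)"

text \<open>Both bounds are imposed at once because the ordering may ignore total degree: errors of
  rewriting have to be smaller in the ordering and also stay in the filtration. For the commutation
  relations the former comes from solvability, the latter from quadricity.\<close>

definition below :: "nat \<Rightarrow> (nat \<Rightarrow>\<^sub>0 nat) \<Rightarrow> 'r set" where
  "below s \<gamma> = span (mon ` {\<alpha> \<in> expo s. \<alpha> \<prec> \<gamma>})"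

abbreviation lead :: "'r \<Rightarrow> (nat \<Rightarrow>\<^sub>0 nat)" where
  "lead \<equiv> lm N x r"

lemma linear_r: "linear_order_on (exponents N) r"
  using ordering by (simp add: monomial_ordering_def)

lemma r_trans: "(\<alpha>, \<beta>) \<in> r \<Longrightarrow> (\<beta>, \<gamma>) \<in> r \<Longrightarrow> (\<alpha>, \<gamma>) \<in> r"
  using linear_r unfolding order_on_defs by (meson transD)

lemma r_antisym: "(\<alpha>, \<beta>) \<in> r \<Longrightarrow> (\<beta>, \<alpha>) \<in> r \<Longrightarrow> \<alpha> = \<beta>"
  using linear_r unfolding order_on_defs by (meson antisymD)

lemma r_refl: "\<alpha> \<in> exponents N \<Longrightarrow> (\<alpha>, \<alpha>) \<in> r"
  using linear_r unfolding order_on_defs by (meson refl_onD)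

lemma r_total: "\<alpha> \<in> exponents N \<Longrightarrow> \<beta> \<in> exponents N \<Longrightarrow> \<alpha> \<noteq> \<beta> \<Longrightarrow> (\<alpha>, \<beta>) \<in> r \<or> (\<beta>, \<alpha>) \<in> r"
  using linear_r unfolding order_on_defs total_on_def by blast

lemma r_add:
  "\<lbrakk>\<alpha> \<in> exponents N; \<beta> \<in> exponents N; \<gamma> \<in> exponents N; (\<alpha>, \<beta>) \<in> r\<rbrakk> \<Longrightarrow> (\<alpha> + \<gamma>, \<beta> + \<gamma>) \<in> r"
  using ordering unfolding monomial_ordering_def by blast

lemma less_add:
  "\<lbrakk>\<alpha> \<in> exponents N; \<beta> \<in> exponents N; \<gamma> \<in> exponents N; \<alpha> \<prec> \<beta>\<rbrakk> \<Longrightarrow> \<alpha> + \<gamma> \<prec> \<beta> + \<gamma>"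
  using r_add by auto

lemma less_trans1: "(\<alpha>, \<beta>) \<in> r \<Longrightarrow> \<beta> \<prec> \<gamma> \<Longrightarrow> \<alpha> \<prec> \<gamma>"
  using r_trans r_antisym by blast

lemma less_trans2: "\<alpha> \<prec> \<beta> \<Longrightarrow> (\<beta>, \<gamma>) \<in> r \<Longrightarrow> \<alpha> \<prec> \<gamma>"
  using r_trans r_antisym by blast

lemma expo_exponents: "expo s \<subseteq> exponents N"
  by (auto simp: expo_def)

lemma expo_mono: "s \<le> t \<Longrightarrow> expo s \<subseteq> expo t"
  by (auto simp: expo_def)

lemma expo_add: "\<alpha> \<in> expo s \<Longrightarrow> \<beta> \<in> expo t \<Longrightarrow> \<alpha> + \<beta> \<in> expo (s + t)"
  by (auto simp: expo_def exponents_add total_degree_add)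

lemma finite_expo: "finite (expo s)"
proof (rule finite_imageD)
  show "finite (Poly_Mapping.lookup ` expo s)"
  proof (rule finite_subset)
    show "Poly_Mapping.lookup ` expo s \<subseteq>
      {h. \<forall>i. (i \<in> {1..N} \<longrightarrow> h i \<in> {..s}) \<and> (i \<notin> {1..N} \<longrightarrow> h i = 0)}"
    proof clarify
      fix \<alpha> i assume \<alpha>: "\<alpha> \<in> expo s"
      have "Poly_Mapping.lookup \<alpha> i \<le> total_degree N \<alpha>" if "i \<in> {1..N}"
        unfolding total_degree_def using that by (intro member_le_sum) auto
      with \<alpha> show "(i \<in> {1..N} \<longrightarrow> Poly_Mapping.lookup \<alpha> i \<in> {..s}) \<and>
          (i \<notin> {1..N} \<longrightarrow> Poly_Mapping.lookup \<alpha> i = 0)"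
        by (auto simp: expo_def exponents_iff)
    qed
    show "finite {h :: nat \<Rightarrow> nat. \<forall>i. (i \<in> {1..N} \<longrightarrow> h i \<in> {..s}) \<and> (i \<notin> {1..N} \<longrightarrow> h i = 0)}"
      by (rule finite_set_of_finite_funs) auto
  qed
  show "inj_on Poly_Mapping.lookup (expo s)"
    by (rule inj_onI) simp
qed

lemma basis:
  "inj_on mon (exponents N)" "independent (mon ` exponents N)" "span (mon ` exponents N) = UNIV"
  using solvable by (auto simp: solvable_type_def monomial_basis_def)

lemma occurring_eq: "occurring N x f = {\<alpha> \<in> exponents N. coef f \<alpha> \<noteq> 0}"
  by (simp add: occurring_def coef_def)

lemma coef_add: "coef (f + g) \<alpha> = coef f \<alpha> + coef g \<alpha>"
  unfolding coef_def by (subst representation_add) (simp_all add: basis)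

lemma coef_scale: "coef (c *s f) \<alpha> = c * coef f \<alpha>"
  unfolding coef_def by (subst representation_scale) (simp_all add: basis)

lemma coef_diff: "coef (f - g) \<alpha> = coef f \<alpha> - coef g \<alpha>"
  unfolding coef_def by (subst representation_diff) (simp_all add: basis)

lemma coef_0 [simp]: "coef 0 \<alpha> = 0"
  unfolding coef_def by (simp add: representation_zero)

lemma coef_mon:
  "\<alpha> \<in> exponents N \<Longrightarrow> \<beta> \<in> exponents N \<Longrightarrow> coef (mon \<beta>) \<alpha> = (if \<alpha> = \<beta> then 1 else 0)"
  unfolding coef_def using basis(1) by (subst representation_basis) (auto simp: basis inj_on_def)

lemma finite_occurring: "finite (occurring N x f)"
proof (rule finite_imageD)
  show "finite (mon ` occurring N x f)"
    by (rule finite_subset[OF _ finite_representation[of "mon ` exponents N" f]])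
      (auto simp: occurring_def)
  show "inj_on mon (occurring N x f)"
    using basis(1) by (rule inj_on_subset) (auto simp: occurring_def)
qed

lemma coef_expansion: "f = (\<Sum>\<alpha>\<in>occurring N x f. coef f \<alpha> *s mon \<alpha>)"
proof -
  let ?R = "representation (mon ` exponents N) f"
  have "f = (\<Sum>b | ?R b \<noteq> 0. ?R b *s b)"
    by (rule sum_nonzero_representation_eq[symmetric]) (simp_all add: basis)
  also have "{b. ?R b \<noteq> 0} = mon ` occurring N x f"
    using representation_ne_zero[of "mon ` exponents N" f] by (auto simp: occurring_def)
  also have "(\<Sum>b\<in>mon ` occurring N x f. ?R b *s b) = (\<Sum>\<alpha>\<in>occurring N x f. coef f \<alpha> *s mon \<alpha>)"
    using inj_on_subset[OF basis(1), of "occurring N x f"]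
    by (subst sum.reindex) (auto simp: coef_def occurring_def)
  finally show ?thesis .
qed

lemma span_mon_iff:
  assumes "A \<subseteq> exponents N"
  shows "f \<in> span (mon ` A) \<longleftrightarrow> occurring N x f \<subseteq> A"
proof
  assume "f \<in> span (mon ` A)"
  then show "occurring N x f \<subseteq> A"
  proof (induction rule: span_induct_alt)
    case base
    show ?case by (simp add: occurring_eq)
  next
    case (step c y f)
    then obtain \<beta> where \<beta>: "\<beta> \<in> A" "y = mon \<beta>" by blast
    then have "\<beta> \<in> exponents N"
      using assms by blast
    with step.IH \<beta> show ?case
      by (auto simp: occurring_eq coef_add coef_scale coef_mon split: if_splits)
  qed
next
  assume "occurring N x f \<subseteq> A"
  then have "(\<Sum>\<alpha>\<in>occurring N x f. coef f \<alpha> *s mon \<alpha>) \<in> span (mon ` A)"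
    by (intro span_sum span_scale span_base) auto
  then show "f \<in> span (mon ` A)"
    by (subst coef_expansion)
qed

lemma filt_iff: "f \<in> filt s \<longleftrightarrow> occurring N x f \<subseteq> expo s"
  unfolding filt_def by (rule span_mon_iff[OF expo_exponents])

lemma below_iff: "f \<in> below s \<gamma> \<longleftrightarrow> occurring N x f \<subseteq> {\<alpha> \<in> expo s. \<alpha> \<prec> \<gamma>}"
  unfolding below_def by (rule span_mon_iff) (auto simp: expo_def)

lemma occurring_eq_empty: "occurring N x f = {} \<longleftrightarrow> f = 0"
  using span_mon_iff[of "{}" f] by simp

lemma finite_has_greatest:
  assumes "finite A" "A \<noteq> {}" "A \<subseteq> exponents N"
  shows "\<exists>\<alpha>\<in>A. \<forall>\<beta>\<in>A. (\<beta>, \<alpha>) \<in> r"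
  using assms
proof (induction A rule: finite_ne_induct)
  case (singleton \<alpha>)
  then show ?case by (simp add: r_refl)
next
  case (insert \<alpha> A)
  have ex: "\<alpha> \<in> exponents N" "A \<subseteq> exponents N"
    using insert.prems by blast+
  obtain \<gamma> where \<gamma>: "\<gamma> \<in> A" "\<forall>\<beta>\<in>A. (\<beta>, \<gamma>) \<in> r"
    using insert.IH[OF ex(2)] by blast
  show ?case
  proof (cases "(\<alpha>, \<gamma>) \<in> r")
    case True
    with \<gamma> show ?thesis by blast
  next
    case False
    then have "(\<gamma>, \<alpha>) \<in> r"
      using r_total[of \<alpha> \<gamma>] r_refl[of \<alpha>] \<gamma>(1) ex by blast
    then have "\<forall>\<beta>\<in>insert \<alpha> A. (\<beta>, \<alpha>) \<in> r"
      using \<gamma>(2) r_trans r_refl[OF ex(1)] by blast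
    then show ?thesis by blast
  qed
qed

lemma lead_eqI:
  assumes "\<alpha> \<in> occurring N x f" "\<forall>\<beta>\<in>occurring N x f. (\<beta>, \<alpha>) \<in> r"
  shows "lead f = \<alpha>"
  unfolding lm_def using assms r_antisym by (intro the_equality) blast+

lemma lead:
  assumes "f \<noteq> 0"
  shows "lead f \<in> occurring N x f" "\<beta> \<in> occurring N x f \<Longrightarrow> (\<beta>, lead f) \<in> r"
proof -
  have "occurring N x f \<noteq> {}" "occurring N x f \<subseteq> exponents N"
    using assms occurring_eq_empty by (auto simp: occurring_eq)
  then obtain \<alpha> where "\<alpha> \<in> occurring N x f" "\<forall>\<beta>\<in>occurring N x f. (\<beta>, \<alpha>) \<in> r"
    using finite_has_greatest[OF finite_occurring] by blast
  with lead_eqI show "lead f \<in> occurring N x f" "\<beta> \<in> occurring N x f \<Longrightarrow> (\<beta>, lead f) \<in> r"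
    by auto
qed

lemma lead_exponents: "f \<noteq> 0 \<Longrightarrow> lead f \<in> exponents N"
  using lead(1) by (auto simp: occurring_eq)

lemma coef_lead: "f \<noteq> 0 \<Longrightarrow> coef f (lead f) \<noteq> 0"
  using lead(1) by (auto simp: occurring_eq)

lemma lead_expo: "f \<noteq> 0 \<Longrightarrow> f \<in> filt s \<Longrightarrow> lead f \<in> expo s"
  using lead(1) filt_iff by blast

lemma lead_decomposition:
  assumes "f \<noteq> 0" "f \<in> filt s"
  shows "f - coef f (lead f) *s mon (lead f) \<in> below s (lead f)"
  unfolding below_iff
proof
  fix \<beta> assume \<beta>: "\<beta> \<in> occurring N x (f - coef f (lead f) *s mon (lead f))"
  then have "\<beta> \<noteq> lead f" "\<beta> \<in> occurring N x f"
    using lead_exponents[OF assms(1)]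
    by (auto simp: occurring_eq coef_diff coef_scale coef_mon split: if_splits)
  then show "\<beta> \<in> {\<alpha> \<in> expo s. \<alpha> \<prec> lead f}"
    using assms filt_iff lead(2)[OF assms(1)] by blast
qed

text \<open>Converse to \<open>lead_decomposition\<close>: it reads off leading exponents from
  congruences modulo \<open>below\<close>, the form in which products are computed.\<close>

lemma lead_eq_of_decomposition:
  assumes "f - c *s mon \<gamma> \<in> below s \<gamma>" "c \<noteq> 0" "\<gamma> \<in> exponents N"
  shows "f \<noteq> 0" "lead f = \<gamma>"
proof -
  have coef: "coef f \<beta> = coef (f - c *s mon \<gamma>) \<beta> + (if \<beta> = \<gamma> then c else 0)"
    if "\<beta> \<in> exponents N" for \<beta>
    using that assms(3) by (simp add: coef_diff coef_scale coef_mon)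
  have "coef (f - c *s mon \<gamma>) \<gamma> = 0"
    using assms(1,3) unfolding below_iff by (auto simp: occurring_eq)
  then have \<gamma>: "\<gamma> \<in> occurring N x f"
    using coef[OF assms(3)] assms(2,3) by (simp add: occurring_eq)
  then show "f \<noteq> 0"
    using occurring_eq_empty[of f] by auto
  show "lead f = \<gamma>"
  proof (rule lead_eqI[OF \<gamma>], rule ballI)
    fix \<beta> assume "\<beta> \<in> occurring N x f"
    then have "\<beta> = \<gamma> \<or> \<beta> \<in> occurring N x (f - c *s mon \<gamma>)"
      using coef[of \<beta>] by (auto simp: occurring_eq)
    then show "(\<beta>, \<gamma>) \<in> r"
      using assms(1,3) r_refl unfolding below_iff by blast
  qed
qed

lemma subspace_filt: "subspace (filt s)"
  by (simp add: filt_def)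

lemma subspace_below: "subspace (below s \<gamma>)"
  by (simp add: below_def)

lemma filt_mono: "s \<le> t \<Longrightarrow> filt s \<subseteq> filt t"
  unfolding filt_def by (intro span_mono image_mono expo_mono)

lemma mon_filt: "\<alpha> \<in> expo s \<Longrightarrow> mon \<alpha> \<in> filt s"
  unfolding filt_def by (intro span_base imageI)

lemma below_filt: "below s \<gamma> \<subseteq> filt s"
  unfolding filt_def below_def by (intro span_mono) auto

lemma below_mono: "(\<gamma>, \<delta>) \<in> r \<Longrightarrow> below s \<gamma> \<subseteq> below s \<delta>"
  unfolding below_def using less_trans2 by (intro span_mono image_mono) blast

lemma mon_below: "\<alpha> \<in> expo s \<Longrightarrow> \<alpha> \<prec> \<gamma> \<Longrightarrow> mon \<alpha> \<in> below s \<gamma>"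
  unfolding below_def by (intro span_base imageI) auto

section \<open>Rewriting words by the commutation relations\<close>

lemma commutation:
  assumes "1 \<le> i" "i < j" "j \<le> N"
  obtains c p where "c \<noteq> 0" "x j * x i = c *s (x i * x j) + p"
    "p \<in> below 2 (Poly_Mapping.single i 1 + Poly_Mapping.single j 1)"
proof -
  obtain c p where cp: "commutation_relation N x r i j c p"
    using solvable assms unfolding solvable_type_def by blast
  then have "p \<in> span (mon ` expo 2)"
    using quadric assms unfolding quadric_def expo_def by blast
  then have p: "p \<in> filt 2"
    by (simp add: filt_def)
  have "p \<in> below 2 (Poly_Mapping.single i 1 + Poly_Mapping.single j 1)"
  proof (cases "p = 0")
    case False
    then have "lead p \<prec> Poly_Mapping.single i 1 + Poly_Mapping.single j 1"
      using cp unfolding commutation_relation_def lm_less_def by blast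
    then show ?thesis
      using p lead(2)[OF False] less_trans1 unfolding filt_iff below_iff by blast
  qed (simp add: below_def span_zero)
  with cp that show ?thesis
    unfolding commutation_relation_def by blast
qed

text \<open>The error of a swap is \<open>word u * p * word v\<close> with the tail \<open>p\<close>
  of the commutation relation. Each monomial of \<open>p\<close>, as a sorted word of at most two
  letters, takes the place of \<open>[j, i]\<close>: the length does not grow and the exponent falls
  below \<gamma>, so \<open>IH\<close> applies.\<close>

lemma reorder_swap:
  assumes IH: "\<And>w. set w \<subseteq> {1..N} \<Longrightarrow> length w \<le> s \<Longrightarrow> word_content w \<prec> \<gamma> \<Longrightarrow> word w \<in> below s \<gamma>"
    and w: "set (u @ [j, i] @ v) \<subseteq> {1..N}" "length (u @ [j, i] @ v) \<le> s"
      "word_content (u @ [j, i] @ v) = \<gamma>" and "i < j"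
  shows "\<exists>c. c \<noteq> 0 \<and> word (u @ [j, i] @ v) - c *s word (u @ [i, j] @ v) \<in> below s \<gamma>"
proof -
  have ij: "i \<in> {1..N}" "j \<in> {1..N}"
    using w(1) by auto
  obtain c p where cp: "c \<noteq> 0" "x j * x i = c *s (x i * x j) + p"
    "p \<in> below 2 (Poly_Mapping.single i 1 + Poly_Mapping.single j 1)"
    using commutation[of i j] ij \<open>i < j\<close> by auto
  have "word (u @ [j, i] @ v) = word u * (x j * x i) * word v"
    by (simp add: mult.assoc)
  also have "\<dots> = c *s word (u @ [i, j] @ v) + word u * p * word v"
    unfolding cp(2) by (simp add: distrib_left distrib_right scale_mult_left mult_scale_right mult.assoc)
  finally have diff: "word (u @ [j, i] @ v) - c *s word (u @ [i, j] @ v) = word u * p * word v"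
    by simp
  have "word u * p * word v \<in> below s \<gamma>"
    using cp(3) unfolding below_def[of 2]
  proof (induction rule: span_induct_alt)
    case base
    show ?case by (simp add: subspace_0[OF subspace_below])
  next
    case (step a y p)
    then obtain \<delta> where \<delta>: "\<delta> \<in> expo 2"
      "\<delta> \<prec> Poly_Mapping.single i 1 + Poly_Mapping.single j 1" "y = mon \<delta>" by blast
    have \<delta>': "\<delta> \<in> exponents N"
      using \<delta>(1) expo_exponents by blast
    define w' where "w' = u @ sorted_word N \<delta> @ v"
    have uv: "word_content u + word_content v \<in> exponents N"
      using w(1) by (intro exponents_add content_exponents) auto
    have "word_content w' = \<delta> + (word_content u + word_content v)"
      using content_sorted_word[OF \<delta>'] by (simp add: w'_def add_ac)
    moreover have "\<gamma> = (Poly_Mapping.single i 1 + Poly_Mapping.single j 1) + (word_content u + word_content v)"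
      unfolding w(3)[symmetric] by (simp add: add_ac)
    ultimately have less: "word_content w' \<prec> \<gamma>"
      using less_add[OF \<delta>' exponents_add[OF exponents_single[OF ij(1)] exponents_single[OF ij(2)]]
          uv \<delta>(2)] by metis
    have "length w' \<le> s" "set w' \<subseteq> {1..N}"
      using w(1,2) \<delta>(1) sorted_word_set[of N \<delta>] length_sorted_word[OF \<delta>']
      by (auto simp: w'_def expo_def)
    then have "word w' \<in> below s \<gamma>"
      using IH less by blast
    moreover have "word w' = word u * y * word v"
      by (simp add: w'_def \<delta>(3) monomial_eq_word mult.assoc)
    ultimately have "a *s (word u * y * word v) + word u * p * word v \<in> below s \<gamma>"
      using step.IH subspace_add[OF subspace_below] subspace_scale[OF subspace_below] by simp
    then show ?case
      by (simp add: distrib_left distrib_right scale_mult_left mult_scale_right)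
  qed
  with diff cp(1) show ?thesis
    by auto
qed

lemma proportional_trans:
  assumes "subspace V" "\<exists>c. c \<noteq> 0 \<and> f - c *s g \<in> V" "\<exists>c. c \<noteq> 0 \<and> g - c *s h \<in> V"
  shows "\<exists>c. c \<noteq> 0 \<and> f - c *s h \<in> V"
proof -
  obtain a b where ab: "a \<noteq> 0" "b \<noteq> 0" "f - a *s g \<in> V" "g - b *s h \<in> V"
    using assms by blast
  have "(f - a *s g) + a *s (g - b *s h) \<in> V"
    using ab assms(1) by (intro subspace_add subspace_scale)
  then have "f - (a * b) *s h \<in> V"
    by (simp add: scale_right_diff_distrib)
  with ab show ?thesis
    by (intro exI[of _ "a * b"]) simp
qed

lemma proportional_refl: "subspace V \<Longrightarrow> \<exists>c. c \<noteq> 0 \<and> f - c *s f \<in> V"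
  by (intro exI[of _ 1]) (simp add: subspace_0)

lemma reorder_insort:
  assumes IH: "\<And>w. set w \<subseteq> {1..N} \<Longrightarrow> length w \<le> s \<Longrightarrow> word_content w \<prec> \<gamma> \<Longrightarrow> word w \<in> below s \<gamma>"
    and "set (u @ a # w) \<subseteq> {1..N}" "length (u @ a # w) \<le> s" "word_content (u @ a # w) = \<gamma>"
  shows "\<exists>c. c \<noteq> 0 \<and> word (u @ a # w) - c *s word (u @ insort a w) \<in> below s \<gamma>"
  using assms(2-)
proof (induction w arbitrary: u)
  case Nil
  show ?case by (simp add: proportional_refl[OF subspace_below] del: map_append)
next
  case (Cons b w)
  show ?case
  proof (cases "a \<le> b")
    case True
    then show ?thesis by (simp add: proportional_refl[OF subspace_below] del: map_append)
  next
    case False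
    have 1: "\<exists>c. c \<noteq> 0 \<and> word (u @ [a, b] @ w) - c *s word (u @ [b, a] @ w) \<in> below s \<gamma>"
      using False Cons.prems by (intro reorder_swap[OF IH]) auto
    have "\<exists>c. c \<noteq> 0 \<and> word ((u @ [b]) @ a # w) - c *s word ((u @ [b]) @ insort a w) \<in> below s \<gamma>"
      using Cons.prems by (intro Cons.IH) (auto simp: add_ac)
    with 1 show ?thesis
      using False proportional_trans[OF subspace_below, of "word (u @ [a, b] @ w)" "word (u @ [b, a] @ w)"]
      by simp
  qed
qed

text \<open>Follows \<open>sort\<close> as insertion sort; the prefix \<open>u\<close> holds the
  letters whose insertion is still pending.\<close>

lemma reorder_sort:
  assumes IH: "\<And>w. set w \<subseteq> {1..N} \<Longrightarrow> length w \<le> s \<Longrightarrow> word_content w \<prec> \<gamma> \<Longrightarrow> word w \<in> below s \<gamma>"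
    and "set (u @ w) \<subseteq> {1..N}" "length (u @ w) \<le> s" "word_content (u @ w) = \<gamma>"
  shows "\<exists>c. c \<noteq> 0 \<and> word (u @ w) - c *s word (u @ sort w) \<in> below s \<gamma>"
  using assms(2-)
proof (induction w arbitrary: u)
  case Nil
  show ?case by (simp add: proportional_refl[OF subspace_below] del: map_append)
next
  case (Cons a w)
  have 1: "\<exists>c. c \<noteq> 0 \<and> word ((u @ [a]) @ w) - c *s word ((u @ [a]) @ sort w) \<in> below s \<gamma>"
    using Cons.prems by (intro Cons.IH) (auto simp: add_ac)
  have 2: "\<exists>c. c \<noteq> 0 \<and> word (u @ a # sort w) - c *s word (u @ insort a (sort w)) \<in> below s \<gamma>"
    using Cons.prems by (intro reorder_insort[OF IH]) (auto simp: content_sort)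
  from 1 2 show ?case
    using proportional_trans[OF subspace_below, of "word (u @ a # w)" "word (u @ a # sort w)"]
    by simp
qed

text \<open>Induction on the number of smaller exponents in \<open>expo s\<close>. This set is
  finite and rewriting never leaves it, so the count is a legitimate measure.\<close>

lemma reorder_word:
  assumes "set w \<subseteq> {1..N}" "length w \<le> s"
  shows "\<exists>c. c \<noteq> 0 \<and> word w - c *s mon (word_content w) \<in> below s (word_content w)"
  using assms
proof (induction "card {\<beta> \<in> expo s. \<beta> \<prec> word_content w}" arbitrary: w rule: less_induct)
  case less
  have cont: "word_content v \<in> expo s" if "set v \<subseteq> {1..N}" "length v \<le> s" for v
    using that by (simp add: expo_def content_exponents total_degree_content)
  have IH: "word v \<in> below s (word_content w)"
    if v: "set v \<subseteq> {1..N}" "length v \<le> s" "word_content v \<prec> word_content w" for v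
  proof -
    have "card {\<beta> \<in> expo s. \<beta> \<prec> word_content v} < card {\<beta> \<in> expo s. \<beta> \<prec> word_content w}"
    proof (rule psubset_card_mono)
      show "{\<beta> \<in> expo s. \<beta> \<prec> word_content v} \<subset> {\<beta> \<in> expo s. \<beta> \<prec> word_content w}"
        using cont[OF v(1,2)] v(3) less_trans1 by blast
    qed (use finite_expo in auto)
    from less.hyps[OF this v(1,2)] obtain c where
      "word v - c *s mon (word_content v) \<in> below s (word_content v)" by blast
    then have "word v - c *s mon (word_content v) \<in> below s (word_content w)"
      using below_mono v(3) by blast
    moreover have "mon (word_content v) \<in> below s (word_content w)"
      using cont[OF v(1,2)] v(3) by (rule mon_below)
    ultimately have "(word v - c *s mon (word_content v)) + c *s mon (word_content v) \<in> below s (word_content w)"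
      by (intro subspace_add[OF subspace_below] subspace_scale[OF subspace_below])
    then show ?thesis by simp
  qed
  show ?case
    using reorder_sort[of s "word_content w" "[]" w, OF IH] less.prems
    by (simp add: sort_eq_sorted_word monomial_eq_word)
qed

lemma mon_mult:
  assumes "\<alpha> \<in> expo s" "\<beta> \<in> expo t"
  shows "\<exists>c. c \<noteq> 0 \<and> mon \<alpha> * mon \<beta> - c *s mon (\<alpha> + \<beta>) \<in> below (s + t) (\<alpha> + \<beta>)"
proof -
  have ex: "\<alpha> \<in> exponents N" "\<beta> \<in> exponents N"
    using assms expo_exponents by blast+
  have "word_content (sorted_word N \<alpha> @ sorted_word N \<beta>) = \<alpha> + \<beta>"
    using ex by (simp add: content_sorted_word)
  moreover have "word (sorted_word N \<alpha> @ sorted_word N \<beta>) = mon \<alpha> * mon \<beta>"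
    by (simp add: monomial_eq_word)
  moreover have "set (sorted_word N \<alpha> @ sorted_word N \<beta>) \<subseteq> {1..N}"
    using sorted_word_set by auto
  moreover have "length (sorted_word N \<alpha> @ sorted_word N \<beta>) \<le> s + t"
    using assms ex by (simp add: length_sorted_word expo_def)
  ultimately show ?thesis
    using reorder_word[of "sorted_word N \<alpha> @ sorted_word N \<beta>" "s + t"] by metis
qed

lemma span_mult:
  assumes "f \<in> span A" "g \<in> span B" "\<And>a b. a \<in> A \<Longrightarrow> b \<in> B \<Longrightarrow> a * b \<in> V" "subspace V"
  shows "f * g \<in> V"
proof -
  have "a * g \<in> V" if "a \<in> A" for a
    using assms(2)
  proof (induction rule: span_induct_alt)
    case (step c y h)
    then have "c *s (a * y) + a * h \<in> V"
      using assms(3)[OF that] assms(4) by (intro subspace_add subspace_scale) auto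
    then show ?case by (simp add: distrib_left mult_scale_right)
  qed (simp add: subspace_0[OF assms(4)])
  note * = this
  from assms(1) show ?thesis
  proof (induction rule: span_induct_alt)
    case (step c y h)
    then have "c *s (y * g) + h * g \<in> V"
      using * assms(4) by (intro subspace_add subspace_scale) auto
    then show ?case by (simp add: distrib_right scale_mult_left)
  qed (simp add: subspace_0[OF assms(4)])
qed

lemma mon_mult_filt:
  assumes "\<alpha> \<in> expo s" "\<beta> \<in> expo t"
  shows "mon \<alpha> * mon \<beta> \<in> filt (s + t)"
proof -
  obtain c where "mon \<alpha> * mon \<beta> - c *s mon (\<alpha> + \<beta>) \<in> below (s + t) (\<alpha> + \<beta>)"
    using mon_mult[OF assms] by blast
  then have "mon \<alpha> * mon \<beta> - c *s mon (\<alpha> + \<beta>) + c *s mon (\<alpha> + \<beta>) \<in> filt (s + t)"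
    using below_filt expo_add[OF assms]
    by (intro subspace_add[OF subspace_filt] subspace_scale[OF subspace_filt] mon_filt) blast+
  then show ?thesis by simp
qed

lemma filt_mult:
  assumes "f \<in> filt s" "g \<in> filt t"
  shows "f * g \<in> filt (s + t)"
  using assms(1,2)[unfolded filt_def]
  by (rule span_mult) (auto intro: mon_mult_filt subspace_filt)

lemma mon_mult_below:
  assumes "\<alpha> \<in> expo s" "\<beta> \<in> expo t" "\<alpha> + \<beta> \<prec> \<gamma>"
  shows "mon \<alpha> * mon \<beta> \<in> below (s + t) \<gamma>"
proof -
  obtain c where "mon \<alpha> * mon \<beta> - c *s mon (\<alpha> + \<beta>) \<in> below (s + t) (\<alpha> + \<beta>)"
    using mon_mult[OF assms(1,2)] by blast
  then have "mon \<alpha> * mon \<beta> - c *s mon (\<alpha> + \<beta>) + c *s mon (\<alpha> + \<beta>) \<in> below (s + t) \<gamma>"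
    using below_mono assms expo_add[OF assms(1,2)]
    by (intro subspace_add[OF subspace_below] subspace_scale[OF subspace_below] mon_below) blast+
  then show ?thesis by simp
qed

lemma below_mult:
  assumes "f \<in> below s \<gamma>" "g \<in> below t \<delta>" "\<gamma> \<in> exponents N" "\<delta> \<in> exponents N"
  shows "f * g \<in> below (s + t) (\<gamma> + \<delta>)"
  using assms(1,2)[unfolded below_def]
proof (rule span_mult)
  fix a b assume "a \<in> mon ` {\<alpha> \<in> expo s. \<alpha> \<prec> \<gamma>}" "b \<in> mon ` {\<alpha> \<in> expo t. \<alpha> \<prec> \<delta>}"
  then obtain \<alpha> \<beta> where *: "\<alpha> \<in> expo s" "\<alpha> \<prec> \<gamma>" "a = mon \<alpha>" "\<beta> \<in> expo t" "\<beta> \<prec> \<delta>" "b = mon \<beta>"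
    by blast
  then have ex: "\<alpha> \<in> exponents N" "\<beta> \<in> exponents N"
    using expo_exponents by blast+
  have "\<alpha> + \<beta> \<prec> \<gamma> + \<beta>"
    using less_add[OF ex(1) assms(3) ex(2) *(2)] .
  moreover have "\<beta> + \<gamma> \<prec> \<delta> + \<gamma>"
    using less_add[OF ex(2) assms(4) assms(3) *(5)] .
  ultimately have "\<alpha> + \<beta> \<prec> \<gamma> + \<delta>"
    by (metis add.commute less_trans2)
  then show "a * b \<in> below (s + t) (\<gamma> + \<delta>)"
    unfolding *(3,6) using * by (intro mon_mult_below)
qed (rule subspace_below)

lemma mon_mult_below_right:
  assumes "\<alpha> \<in> expo s" "g \<in> below t \<delta>" "\<delta> \<in> exponents N"
  shows "mon \<alpha> * g \<in> below (s + t) (\<alpha> + \<delta>)"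
proof (rule span_mult[of _ "{mon \<alpha>}"])
  show "g \<in> span (mon ` {\<beta> \<in> expo t. \<beta> \<prec> \<delta>})"
    using assms(2) by (simp add: below_def)
  fix a b assume "a \<in> {mon \<alpha>}" "b \<in> mon ` {\<beta> \<in> expo t. \<beta> \<prec> \<delta>}"
  then obtain \<beta> where *: "a = mon \<alpha>" "\<beta> \<in> expo t" "\<beta> \<prec> \<delta>" "b = mon \<beta>"
    by blast
  then have "\<alpha> + \<beta> \<prec> \<alpha> + \<delta>"
    using less_add[of \<beta> \<delta> \<alpha>] assms expo_exponents by (metis add.commute subsetD)
  then show "a * b \<in> below (s + t) (\<alpha> + \<delta>)"
    unfolding *(1,4) using assms * by (intro mon_mult_below)
qed (auto intro: span_base subspace_below)

lemma mon_mult_below_left: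
  assumes "f \<in> below s \<gamma>" "\<beta> \<in> expo t" "\<gamma> \<in> exponents N"
  shows "f * mon \<beta> \<in> below (s + t) (\<gamma> + \<beta>)"
proof (rule span_mult[of _ _ _ "{mon \<beta>}"])
  show "f \<in> span (mon ` {\<alpha> \<in> expo s. \<alpha> \<prec> \<gamma>})"
    using assms(1) by (simp add: below_def)
  fix a b assume "a \<in> mon ` {\<alpha> \<in> expo s. \<alpha> \<prec> \<gamma>}" "b \<in> {mon \<beta>}"
  then obtain \<alpha> where *: "b = mon \<beta>" "\<alpha> \<in> expo s" "\<alpha> \<prec> \<gamma>" "a = mon \<alpha>"
    by blast
  then have "\<alpha> + \<beta> \<prec> \<gamma> + \<beta>"
    using less_add[of \<alpha> \<gamma> \<beta>] assms expo_exponents by blast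
  then show "a * b \<in> below (s + t) (\<gamma> + \<beta>)"
    unfolding *(1,4) using assms * by (intro mon_mult_below)
qed (auto intro: span_base subspace_below)

text \<open>Both factors are split into leading term and tail. The three products that involve a
  tail lie in \<open>below\<close>, and the product of the two leading monomials is a nonzero
  multiple of \<open>mon (\<alpha> + \<beta>)\<close> modulo \<open>below\<close>.\<close>

lemma lead_mult:
  assumes "f \<noteq> 0" "g \<noteq> 0" "f \<in> filt s" "g \<in> filt t"
  shows "f * g \<noteq> 0" "lead (f * g) = lead f + lead g"
proof -
  define \<alpha> \<beta> where "\<alpha> = lead f" and "\<beta> = lead g"
  define a b where "a = coef f \<alpha>" and "b = coef g \<beta>"
  define f' g' where "f' = f - a *s mon \<alpha>" and "g' = g - b *s mon \<beta>"
  have \<alpha>: "\<alpha> \<in> expo s" "\<alpha> \<in> exponents N" and \<beta>: "\<beta> \<in> expo t" "\<beta> \<in> exponents N"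
    using assms lead_expo lead_exponents by (auto simp: \<alpha>_def \<beta>_def)
  have f': "f' \<in> below s \<alpha>" and g': "g' \<in> below t \<beta>"
    unfolding f'_def g'_def a_def b_def \<alpha>_def \<beta>_def using assms by (auto intro: lead_decomposition)
  have nz: "a \<noteq> 0" "b \<noteq> 0"
    unfolding a_def b_def \<alpha>_def \<beta>_def using assms by (auto simp: coef_lead)
  obtain c where c: "c \<noteq> 0" "mon \<alpha> * mon \<beta> - c *s mon (\<alpha> + \<beta>) \<in> below (s + t) (\<alpha> + \<beta>)"
    using mon_mult[OF \<alpha>(1) \<beta>(1)] by blast
  have "(a * b) *s (mon \<alpha> * mon \<beta> - c *s mon (\<alpha> + \<beta>)) + a *s (mon \<alpha> * g') +
      b *s (f' * mon \<beta>) + f' * g' \<in> below (s + t) (\<alpha> + \<beta>)"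
    using c(2) \<alpha> \<beta> f' g'
    by (intro subspace_add[OF subspace_below] subspace_scale[OF subspace_below]
        mon_mult_below_left mon_mult_below_right below_mult)
  also have "(a * b) *s (mon \<alpha> * mon \<beta> - c *s mon (\<alpha> + \<beta>)) + a *s (mon \<alpha> * g') +
      b *s (f' * mon \<beta>) + f' * g' = (a *s mon \<alpha> + f') * (b *s mon \<beta> + g') - (a * b * c) *s mon (\<alpha> + \<beta>)"
    by (simp add: distrib_left distrib_right scale_mult_left mult_scale_right
        scale_right_diff_distrib scale_right_distrib mult_ac)
  also have "(a *s mon \<alpha> + f') * (b *s mon \<beta> + g') = f * g"
    by (simp add: f'_def g'_def)
  finally have "f * g - (a * b * c) *s mon (\<alpha> + \<beta>) \<in> below (s + t) (\<alpha> + \<beta>)" .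
  from lead_eq_of_decomposition[OF this] nz c(1) exponents_add[OF \<alpha>(2) \<beta>(2)]
  show "f * g \<noteq> 0" "lead (f * g) = lead f + lead g"
    by (auto simp: \<alpha>_def \<beta>_def)
qed

lemma filt_exhaustive: "\<exists>s. f \<in> filt s"
proof -
  define s where "s = Max (insert 0 (total_degree N ` occurring N x f))"
  have "occurring N x f \<subseteq> expo s"
    using finite_occurring[of f] by (auto simp: expo_def s_def occurring_eq)
  then show ?thesis
    using filt_iff by blast
qed

text \<open>A monomial is a sorted word; conversely, rewriting expresses a word of length at most
  \<open>s\<close> by monomials of total degree at most \<open>s\<close>. This ties the degree,
  which is defined through words, to the filtration.\<close>

lemma filt_eq_span_words:
  "filt s = span {prod_list (map x w) |w. set w \<subseteq> {1..N} \<and> length w \<le> s}"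
proof
  show "filt s \<subseteq> span {prod_list (map x w) |w. set w \<subseteq> {1..N} \<and> length w \<le> s}"
    unfolding filt_def
  proof (intro span_mono image_subsetI)
    fix \<alpha> assume "\<alpha> \<in> expo s"
    then show "mon \<alpha> \<in> {prod_list (map x w) |w. set w \<subseteq> {1..N} \<and> length w \<le> s}"
      using sorted_word_set[of N \<alpha>] length_sorted_word[of \<alpha> N]
      by (intro CollectI exI[of _ "sorted_word N \<alpha>"]) (auto simp: monomial_eq_word expo_def)
  qed
  show "span {prod_list (map x w) |w. set w \<subseteq> {1..N} \<and> length w \<le> s} \<subseteq> filt s"
  proof (intro span_minimal subspace_filt subsetI, clarify)
    fix w assume w: "set w \<subseteq> {1..N}" "length w \<le> s"
    then obtain c where "word w - c *s mon (word_content w) \<in> below s (word_content w)"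
      using reorder_word by blast
    moreover have "word_content w \<in> expo s"
      using w by (simp add: expo_def content_exponents total_degree_content)
    ultimately have "word w - c *s mon (word_content w) + c *s mon (word_content w) \<in> filt s"
      using below_filt
      by (intro subspace_add[OF subspace_filt] subspace_scale[OF subspace_filt] mon_filt) blast+
    then show "word w \<in> filt s" by simp
  qed
qed

lemma degree_le_iff: "degree N x f \<le> d \<longleftrightarrow> f \<in> filt d"
proof
  have "degree N x f = (LEAST e. f \<in> filt e)"
    unfolding degree_def filt_eq_span_words ..
  moreover obtain s where "f \<in> filt s"
    using filt_exhaustive by blast
  ultimately have *: "f \<in> filt (degree N x f)" "\<And>e. f \<in> filt e \<Longrightarrow> degree N x f \<le> e"
    by (metis LeastI Least_le)+
  show "degree N x f \<le> d \<Longrightarrow> f \<in> filt d"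
    using *(1) filt_mono by blast
  show "f \<in> filt d \<Longrightarrow> degree N x f \<le> d"
    by (rule *(2))
qed

section \<open>Leading exponents and dimension counts\<close>

definition leads :: "'r set \<Rightarrow> (nat \<Rightarrow>\<^sub>0 nat) set" where
  "leads V = lead ` (V - {0})"

lemma leads_expo: "V \<subseteq> filt s \<Longrightarrow> leads V \<subseteq> expo s"
  unfolding leads_def using lead_expo by blast

text \<open>Division with remainder by a vector space: the leading term is either cancelled by an
  element of \<open>V\<close> or moved to the remainder.\<close>

lemma reduce_modulo:
  assumes V: "subspace V" "V \<subseteq> filt s" and "g \<in> filt s"
  shows "\<exists>v\<in>V. g - v \<in> span (mon ` (expo s - leads V))"
  using \<open>g \<in> filt s\<close>
\<comment> \<open>\<open>lead 0\<close> is meaningless, so zero gets measure 0 and every other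
  element a successor.\<close>
proof (induction "if g = 0 then 0 else Suc (card {\<beta> \<in> expo s. \<beta> \<prec> lead g})"
    arbitrary: g rule: less_induct)
  case less
  show ?case
  proof (cases "g = 0")
    case True
    then show ?thesis
      using subspace_0[OF V(1)] span_zero by (intro bexI[of _ 0]) auto
  next
    case False
    define \<alpha> where "\<alpha> = lead g"
    have \<alpha>: "\<alpha> \<in> expo s" "\<alpha> \<in> exponents N"
      using lead_expo[OF False less.prems] lead_exponents[OF False] by (auto simp: \<alpha>_def)
    \<comment> \<open>Either move subtracts some \<open>h\<close> that agrees with \<open>g\<close>
      at the leading exponent and has nothing above it.\<close>
    have step: "\<exists>v\<in>V. g - h - v \<in> span (mon ` (expo s - leads V))"
      if h: "h \<in> filt s" "coef h \<alpha> = coef g \<alpha>" "\<And>\<beta>. \<beta> \<in> occurring N x h \<Longrightarrow> (\<beta>, \<alpha>) \<in> r" for h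
    proof (rule less.hyps)
      show "g - h \<in> filt s"
        using h(1) less.prems by (rule subspace_diff[OF subspace_filt, rotated])
      show "(if g - h = 0 then 0 else Suc (card {\<beta> \<in> expo s. \<beta> \<prec> lead (g - h)})) <
        (if g = 0 then 0 else Suc (card {\<beta> \<in> expo s. \<beta> \<prec> lead g}))"
      proof (cases "g - h = 0")
        case gh: False
        have "lead (g - h) \<in> occurring N x (g - h)"
          using lead(1)[OF gh] .
        then have "lead (g - h) \<noteq> \<alpha>" "lead (g - h) \<in> occurring N x g \<or> lead (g - h) \<in> occurring N x h"
          using h(2) by (auto simp: occurring_eq coef_diff)
        then have less: "lead (g - h) \<prec> \<alpha>"
          using h(3) lead(2)[OF False] by (auto simp: \<alpha>_def)
        have "card {\<beta> \<in> expo s. \<beta> \<prec> lead (g - h)} < card {\<beta> \<in> expo s. \<beta> \<prec> \<alpha>}"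
        proof (rule psubset_card_mono)
          show "{\<beta> \<in> expo s. \<beta> \<prec> lead (g - h)} \<subset> {\<beta> \<in> expo s. \<beta> \<prec> \<alpha>}"
            using less less_trans1 lead_expo[OF gh \<open>g - h \<in> filt s\<close>] by blast
        qed (use finite_expo in auto)
        with gh False show ?thesis
          by (simp add: \<alpha>_def)
      qed (use False in auto)
    qed
    show ?thesis
    proof (cases "\<alpha> \<in> leads V")
      case True
      then obtain f where f: "f \<in> V" "f \<noteq> 0" "lead f = \<alpha>"
        unfolding leads_def by blast
      define c where "c = coef g \<alpha> / coef f \<alpha>"
      have cf: "c *s f \<in> V"
        using f(1) by (rule subspace_scale[OF V(1)])
      have "coef f \<alpha> \<noteq> 0"
        using coef_lead[OF f(2)] f(3) by simp
      then have "coef (c *s f) \<alpha> = coef g \<alpha>"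
        by (simp add: coef_scale c_def)
      moreover have "(\<beta>, \<alpha>) \<in> r" if "\<beta> \<in> occurring N x (c *s f)" for \<beta>
        using that lead(2)[OF f(2), of \<beta>] f(3) by (auto simp: occurring_eq coef_scale)
      ultimately obtain v where "v \<in> V" "g - c *s f - v \<in> span (mon ` (expo s - leads V))"
        using step[of "c *s f"] cf V(2) by blast
      then show ?thesis
        using subspace_add[OF V(1) cf] by (intro bexI[of _ "c *s f + v"]) (auto simp: diff_diff_eq)
    next
      case \<alpha>_new: False
      define h where "h = coef g \<alpha> *s mon \<alpha>"
      have "h \<in> filt s"
        unfolding h_def using \<alpha>(1) by (intro subspace_scale[OF subspace_filt] mon_filt)
      moreover have "coef h \<alpha> = coef g \<alpha>"
        using \<alpha>(2) by (simp add: h_def coef_scale coef_mon)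
      moreover have "(\<beta>, \<alpha>) \<in> r" if "\<beta> \<in> occurring N x h" for \<beta>
        using that \<alpha>(2) r_refl by (auto simp: h_def occurring_eq coef_scale coef_mon split: if_splits)
      ultimately obtain v where v: "v \<in> V" "g - h - v \<in> span (mon ` (expo s - leads V))"
        using step[of h] by blast
      have "h \<in> span (mon ` (expo s - leads V))"
        unfolding h_def using \<alpha>(1) \<alpha>_new by (intro span_scale span_base imageI) simp
      then have "h + (g - h - v) \<in> span (mon ` (expo s - leads V))"
        using v(2) by (rule span_add)
      with v(1) show ?thesis
        by (intro bexI[of _ v]) auto
    qed
  qed
qed

text \<open>A basis of \<open>V\<close> and the multiples \<open>mon \<beta> * f\<close>, for
  \<beta> a standard exponent of the colon space \<open>J\<close>, form a basis of the sum: they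
  span by reduction modulo \<open>J\<close>, and a linear relation would give a nonzero element of
  \<open>J\<close> supported on standard exponents.\<close>

lemma dim_add_multiples:
  fixes f :: 'r and t :: nat
  assumes V: "subspace V" "V \<subseteq> filt s"
  defines "J \<equiv> {g \<in> filt t. g * f \<in> V}"
  shows "subspace J"
    and "dim (span (V \<union> (\<lambda>g. g * f) ` filt t)) = dim V + card (expo t - leads J)"
proof -
  show J: "subspace J"
    unfolding J_def
  proof (rule subspaceI)
    show "0 \<in> {g \<in> filt t. g * f \<in> V}"
      using subspace_0[OF V(1)] subspace_0[OF subspace_filt] by simp
  next
    fix g h assume "g \<in> {g \<in> filt t. g * f \<in> V}" "h \<in> {g \<in> filt t. g * f \<in> V}"
    then show "g + h \<in> {g \<in> filt t. g * f \<in> V}"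
      using subspace_add[OF V(1)] subspace_add[OF subspace_filt] by (simp add: distrib_right)
  next
    fix c g assume "g \<in> {g \<in> filt t. g * f \<in> V}"
    then show "c *s g \<in> {g \<in> filt t. g * f \<in> V}"
      using subspace_scale[OF V(1)] subspace_scale[OF subspace_filt] by (simp add: scale_mult_left)
  qed
  have J_sub: "J \<subseteq> filt t"
    by (auto simp: J_def)
  obtain B where B: "B \<subseteq> V" "independent B" "V \<subseteq> span B" "card B = dim V"
    by (rule basis_exists)
  have "finite B"
  proof -
    have "B \<subseteq> span (mon ` expo s)"
      using B(1) V(2) unfolding filt_def by (rule order_trans)
    then show ?thesis
      using independent_span_bound[OF finite_imageI[OF finite_expo] B(2)] by blast
  qed
  have spanB: "span B = V"
    using B(1,3) span_minimal[OF B(1) V(1)] by blast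
  define Q where "Q = expo t - leads J"
  have "finite Q"
    unfolding Q_def using finite_expo by simp
  define y where "y \<beta> = mon \<beta> * f" for \<beta>
  have span_y: "\<exists>h\<in>span (mon ` A). w = h * f" if "w \<in> span (y ` A)" for w A
    using that
  proof (induction rule: span_induct_alt)
    case base
    show ?case using span_zero by (intro bexI[of _ 0]) auto
  next
    case (step c z w)
    then obtain h \<beta> where h: "h \<in> span (mon ` A)" "w = h * f" "\<beta> \<in> A" "z = y \<beta>"
      by blast
    then have "c *s mon \<beta> + h \<in> span (mon ` A)"
      by (intro span_add[OF span_scale[OF span_base]]) auto
    moreover have "c *s z + w = (c *s mon \<beta> + h) * f"
      using h by (simp add: y_def distrib_right scale_mult_left)
    ultimately show ?case
      by blast
  qed
  have "independent (B \<union> y ` A) \<and> card (B \<union> y ` A) = card B + card A" if "A \<subseteq> Q" for A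
    using finite_subset[OF that \<open>finite Q\<close>] that
  proof (induction A)
    case empty
    with B(2) show ?case by simp
  next
    case (insert q A)
    have notin: "y q \<notin> span (B \<union> y ` A)"
    proof
      assume "y q \<in> span (B \<union> y ` A)"
      then obtain v w where vw: "v \<in> V" "w \<in> span (y ` A)" "y q = v + w"
        unfolding span_Un spanB by blast
      obtain h where h: "h \<in> span (mon ` A)" "w = h * f"
        using span_y[OF vw(2)] by blast
      define g where "g = mon q - h"
      have QE: "insert q A \<subseteq> exponents N" "insert q A \<subseteq> expo t"
        using insert.prems expo_exponents by (auto simp: Q_def)
      have "h \<in> span (mon ` insert q A)" "mon q \<in> span (mon ` insert q A)"
        using h(1) span_mono[of "mon ` A" "mon ` insert q A"] span_base[of "mon q" "mon ` insert q A"]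
        by blast+
      then have "g \<in> span (mon ` insert q A)"
        unfolding g_def by (intro span_diff)
      then have occ: "occurring N x g \<subseteq> insert q A"
        using span_mon_iff[OF QE(1)] by blast
      have "q \<notin> occurring N x h"
        using h(1) span_mon_iff[of A h] QE(1) insert.hyps(2) by blast
      then have "coef g q = 1"
        using QE(1) by (simp add: g_def coef_diff coef_mon occurring_eq)
      then have "g \<noteq> 0"
        by auto
      have "g * f = v"
        using vw(3) h(2) by (simp add: g_def y_def left_diff_distrib)
      then have "g \<in> J"
        using vw(1) occ QE(2) filt_iff[of g t] unfolding J_def by blast
      then have "lead g \<in> leads J"
        using \<open>g \<noteq> 0\<close> unfolding leads_def by blast
      moreover have "lead g \<in> Q"
        using subsetD[OF insert.prems subsetD[OF occ lead(1)[OF \<open>g \<noteq> 0\<close>]]] .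
      ultimately show False
        by (simp add: Q_def)
    qed
    have "y q \<notin> B \<union> y ` A"
      using notin by (rule contrapos_nn) (rule span_base)
    moreover have "independent (B \<union> y ` A)" "card (B \<union> y ` A) = card B + card A"
      using insert.IH insert.prems by blast+
    moreover have "B \<union> y ` insert q A = insert (y q) (B \<union> y ` A)"
      by blast
    ultimately show ?case
      using notin insert.hyps \<open>finite B\<close> by (simp add: independent_insert)
  qed
  from this[OF order_refl] B(4)
  have indep: "independent (B \<union> y ` Q)" and card: "card (B \<union> y ` Q) = dim V + card Q"
    by simp_all
  have "span (B \<union> y ` Q) = span (V \<union> (\<lambda>g. g * f) ` filt t)"
  proof
    have "B \<union> y ` Q \<subseteq> V \<union> (\<lambda>g. g * f) ` filt t"
      using B(1) mon_filt by (auto simp: y_def Q_def)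
    then show "span (B \<union> y ` Q) \<subseteq> span (V \<union> (\<lambda>g. g * f) ` filt t)"
      by (rule span_mono)
    have "V \<subseteq> span (B \<union> y ` Q)"
      using B(3) span_mono[of B "B \<union> y ` Q"] by blast
    moreover have "g * f \<in> span (B \<union> y ` Q)" if g: "g \<in> filt t" for g
    proof -
      obtain v where v: "v \<in> J" "g - v \<in> span (mon ` Q)"
        using reduce_modulo[OF J J_sub g] unfolding Q_def by blast
      have "(g - v) * f \<in> span (y ` Q)"
        by (rule span_mult[OF v(2), of f "{f}"]) (auto simp: y_def intro: span_base)
      then have "(g - v) * f \<in> span (B \<union> y ` Q)"
        using span_mono[of "y ` Q" "B \<union> y ` Q"] by blast
      moreover have "v * f \<in> span (B \<union> y ` Q)"
        using v(1) \<open>V \<subseteq> span (B \<union> y ` Q)\<close> by (auto simp: J_def)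
      ultimately have "(g - v) * f + v * f \<in> span (B \<union> y ` Q)"
        by (rule span_add)
      then show ?thesis
        by (simp add: left_diff_distrib)
    qed
    ultimately show "span (V \<union> (\<lambda>g. g * f) ` filt t) \<subseteq> span (B \<union> y ` Q)"
      by (intro span_minimal) auto
  qed
  from dim_eq_card[OF this indep] card
  show "dim (span (V \<union> (\<lambda>g. g * f) ` filt t)) = dim V + card (expo t - leads J)"
    by (simp add: Q_def)
qed

lemma dim_complement:
  assumes "subspace V" "V \<subseteq> filt s"
  shows "dim V + card (expo s - leads V) = card (expo s)"
proof -
  \<comment> \<open>The case \<open>f = 1\<close>: the colon space is \<open>V\<close> itself and
    the sum is \<open>filt s\<close>. Applying it also to \<open>{0}\<close> evaluates the dimension
    of \<open>filt s\<close>.\<close>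
  have dim_filt: "dim V + card (expo s - leads V) = dim (filt s)" if "subspace V" "V \<subseteq> filt s" for V
  proof -
    have "{g \<in> filt s. g * 1 \<in> V} = V" "V \<union> (\<lambda>g. g * 1) ` filt s = filt s"
      using that(2) by auto
    moreover have "span (filt s) = filt s"
      using subspace_filt span_eq_iff by blast
    ultimately show ?thesis
      using dim_add_multiples(2)[OF that, where t = s and f = 1] by simp
  qed
  have "dim {0} = 0"
    using dim_eq_card[of "{}" "{0}"] independent_empty by (simp add: span_insert_0)
  then have "card (expo s) = dim (filt s)"
    using dim_filt[of "{0}"] subspace_0[OF subspace_filt] by (simp add: leads_def)
  with dim_filt[OF assms] show ?thesis
    by simp
qed

end

section \<open>Hilbert series of left ideals\<close>

definition affine_part :: "nat \<Rightarrow> (nat \<Rightarrow> nat) \<Rightarrow> (nat \<Rightarrow>\<^sub>0 nat)" where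
  "affine_part N h = Abs_poly_mapping (\<lambda>i. if i \<in> {1..N} then h i else 0)"

text \<open>Coordinate 0 is the exponent of the homogenizing variable.\<close>

definition homogenization :: "nat \<Rightarrow> nat \<Rightarrow> (nat \<Rightarrow>\<^sub>0 nat) \<Rightarrow> nat \<Rightarrow> nat" where
  "homogenization N t \<alpha> i = (if i = 0 then t - total_degree N \<alpha> else Poly_Mapping.lookup \<alpha> i)"

lemma lookup_affine_part:
  "Poly_Mapping.lookup (affine_part N h) i = (if i \<in> {1..N} then h i else 0)"
proof -
  have "finite {i. (if i \<in> {1..N} then h i else 0) \<noteq> 0}"
    by (rule finite_subset[of _ "{1..N}"]) auto
  then show ?thesis
    unfolding affine_part_def by (subst lookup_Abs_poly_mapping) auto
qed

lemma affine_part_exponents: "affine_part N h \<in> exponents N"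
  by (simp add: exponents_iff lookup_affine_part)

lemma sum_affine_part: "sum h {0..N} = h 0 + total_degree N (affine_part N h)"
proof -
  have "{0..N} = insert 0 {1..N}"
    by auto
  then show ?thesis
    by (simp add: total_degree_def lookup_affine_part)
qed

lemma affine_part_homogenization:
  assumes "\<alpha> \<in> exponents N"
  shows "affine_part N (homogenization N t \<alpha>) = \<alpha>"
  using assms by (intro poly_mapping_eqI) (auto simp: lookup_affine_part homogenization_def exponents_iff)

lemma homogenization_cube: "\<alpha> \<in> exponents N \<Longrightarrow> homogenization N t \<alpha> \<in> cube {0..N}"
  by (auto simp: cube_def homogenization_def exponents_iff)

lemma sum_homogenization:
  assumes "\<alpha> \<in> exponents N" "total_degree N \<alpha> \<le> t"
  shows "sum (homogenization N t \<alpha>) {0..N} = t"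
  using assms(2) unfolding sum_affine_part affine_part_homogenization[OF assms(1)]
  by (simp add: homogenization_def)

lemma homogenization_affine_part:
  assumes "h \<in> cube {0..N}" "sum h {0..N} = t"
  shows "homogenization N t (affine_part N h) = h"
proof
  fix i
  show "homogenization N t (affine_part N h) i = h i"
    using assms sum_affine_part[of h N]
    by (cases "i = 0"; cases "i \<in> {1..N}") (auto simp: homogenization_def lookup_affine_part cube_def)
qed

lemma left_ideal_hull: "left_ideal (left_ideal hull S)"
  unfolding hull_def left_ideal_def by blast

context k_algebra
begin

lemma subspace_left_ideal:
  assumes "left_ideal I"
  shows "subspace I"
proof (rule subspaceI)
  show "0 \<in> I" "\<And>f g. f \<in> I \<Longrightarrow> g \<in> I \<Longrightarrow> f + g \<in> I"
    using assms by (auto simp: left_ideal_def)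
  fix c f assume "f \<in> I"
  then have "(c *s 1) * f \<in> I"
    using assms unfolding left_ideal_def by blast
  then show "c *s f \<in> I"
    by (simp add: scale_mult_left)
qed

end

context quadric_solvable
begin

text \<open>These filtrations are the homogeneous left ideals of the Rees algebra of \<open>filt\<close>.\<close>

definition module_filtration :: "(nat \<Rightarrow> 'r set) \<Rightarrow> bool" where
  "module_filtration V \<longleftrightarrow> (\<forall>t. subspace (V t) \<and> V t \<subseteq> filt t) \<and>
     (\<forall>s t. \<forall>g\<in>filt s. \<forall>f\<in>V t. g * f \<in> V (s + t))"

text \<open>A monomial in \<open>N + 1\<close> variables stands for an exponent placed in a level at
  least its total degree. Membership depends on that level, as the same exponent may become a
  leading one only higher up.\<close>

definition standard_set :: "(nat \<Rightarrow> 'r set) \<Rightarrow> (nat \<Rightarrow> nat) set" where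
  "standard_set V = {h \<in> cube {0..N}. affine_part N h \<notin> leads (V (sum h {0..N}))}"

lemma down_set_standard_set:
  assumes V: "module_filtration V"
  shows "down_set {0..N} (standard_set V)"
  unfolding down_set_def
proof (intro conjI ballI allI impI)
  fix h g assume h: "h \<in> standard_set V" and gh: "g \<le> h"
  have cube: "g \<in> cube {0..N}"
    using gh h cube_down unfolding standard_set_def by blast
  show "g \<in> standard_set V"
  proof (rule ccontr)
    assume "g \<notin> standard_set V"
    then obtain f where f: "f \<in> V (sum g {0..N})" "f \<noteq> 0" "lead f = affine_part N g"
      using cube unfolding standard_set_def leads_def by force
    define \<gamma> where "\<gamma> = affine_part N h - affine_part N g"
    define s where "s = sum h {0..N} - sum g {0..N}"
    have "exp_divides N (affine_part N g) (affine_part N h)"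
      using gh by (auto simp: exp_divides_def lookup_affine_part le_fun_def)
    note \<gamma> = exponents_diff[OF affine_part_exponents affine_part_exponents this, folded \<gamma>_def]
    have "sum g {0..N} \<le> sum h {0..N}"
      using gh by (intro sum_mono) (simp add: le_fun_def)
    then have s: "s + sum g {0..N} = sum h {0..N}"
      by (simp add: s_def)
    \<comment> \<open>The level difference \<open>s\<close> is the degree of \<gamma> plus
      \<open>h 0 - g 0\<close>; the homogenizing variable absorbs the excess.\<close>
    have "total_degree N (affine_part N h) = total_degree N \<gamma> + total_degree N (affine_part N g)"
      using \<gamma>(2) total_degree_add by metis
    moreover have "g 0 \<le> h 0"
      using gh by (simp add: le_fun_def)
    ultimately have "total_degree N \<gamma> \<le> s"
      using s sum_affine_part[of g N] sum_affine_part[of h N] by linarith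
    then have "\<gamma> \<in> expo s"
      using \<gamma>(1) by (simp add: expo_def)
    then have m: "mon \<gamma> \<in> filt s"
      by (rule mon_filt)
    have mon: "mon \<gamma> \<noteq> 0" "lead (mon \<gamma>) = \<gamma>"
      using lead_eq_of_decomposition[of "mon \<gamma>" 1 \<gamma> s] \<gamma>(1) subspace_0[OF subspace_below] by auto
    have "f \<in> filt (sum g {0..N})"
      using f(1) V unfolding module_filtration_def by blast
    note fm = lead_mult[OF mon(1) f(2) m this]
    have "mon \<gamma> * f \<in> V (sum h {0..N})"
      using V m f(1) s unfolding module_filtration_def by metis
    moreover have "lead (mon \<gamma> * f) = affine_part N h"
      using fm(2) f(3) mon(2) \<gamma>(2) by simp
    ultimately have "affine_part N h \<in> leads (V (sum h {0..N}))"
      using fm(1) unfolding leads_def by (metis Diff_iff image_eqI singletonD)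
    then show False
      using h unfolding standard_set_def by blast
  qed
qed (auto simp: standard_set_def)

lemma hilbert_standard_set:
  "hilbert {0..N} (standard_set V) = Abs_fps (\<lambda>t. int (card (expo t - leads (V t))))"
proof (rule fps_ext)
  fix t
  have "card {h \<in> standard_set V. sum h {0..N} = t} = card (expo t - leads (V t))"
  proof (rule bij_betw_same_card[OF bij_betw_byWitness[where f = "affine_part N"
          and f' = "homogenization N t"]])
    show "\<forall>h\<in>{h \<in> standard_set V. sum h {0..N} = t}. homogenization N t (affine_part N h) = h"
      using homogenization_affine_part unfolding standard_set_def by blast
    show "\<forall>\<alpha>\<in>expo t - leads (V t). affine_part N (homogenization N t \<alpha>) = \<alpha>"
      using affine_part_homogenization unfolding expo_def by blast
    show "affine_part N ` {h \<in> standard_set V. sum h {0..N} = t} \<subseteq> expo t - leads (V t)"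
      using affine_part_exponents sum_affine_part[of _ N] by (auto simp: standard_set_def expo_def)
    show "homogenization N t ` (expo t - leads (V t)) \<subseteq> {h \<in> standard_set V. sum h {0..N} = t}"
      using homogenization_cube sum_homogenization affine_part_homogenization
      by (auto simp: standard_set_def expo_def)
  qed
  then show "hilbert {0..N} (standard_set V) $ t = Abs_fps (\<lambda>t. int (card (expo t - leads (V t)))) $ t"
    by (simp add: hilbert_def)
qed

text \<open>The zero filtration has no leading exponents, so its standard set is the whole
  cube.\<close>

lemma card_expo_series: "Abs_fps (\<lambda>t. int (card (expo t))) = geom ^ Suc N"
proof -
  have "standard_set (\<lambda>_. {0}) = cube {0..N}"
    by (simp add: standard_set_def leads_def)
  then show ?thesis
    using hilbert_standard_set[of "\<lambda>_. {0}"] hilbert_cube[of "{0..N}"] by (simp add: leads_def)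
qed

text \<open>Below the homogenization of a leading exponent lies a corner of the standard set. The
  bound concerns its level \<open>s\<close> and not merely the degree of \<beta>: an element of
  \<open>V s\<close> with leading exponent \<beta> then has degree at most \<open>s\<close>.\<close>

lemma filtration_cone_decomposition:
  assumes "module_filtration V"
  obtains P where "cone_series P = Abs_fps (\<lambda>t. int (card (expo t - leads (V t))))"
    "standard 0 P" "\<forall>p\<in>#P. snd p \<le> Suc N"
    "\<And>t \<alpha>. \<alpha> \<in> leads (V t) \<Longrightarrow> \<exists>s \<beta>. \<beta> \<in> leads (V s) \<and> exp_divides N \<beta> \<alpha> \<and>
      (s = 0 \<or> (\<exists>p\<in>#P. s \<le> Suc (fst p)))"
proof -
  have down: "down_set {0..N} (standard_set V)"
    by (rule down_set_standard_set[OF assms])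
  from cone_decomposition[OF _ this]
  obtain P where P: "cone_series P = hilbert {0..N} (standard_set V)" "standard 0 P"
    "\<forall>p\<in>#P. snd p \<le> card {0..N}"
    "\<forall>h. corner {0..N} (standard_set V) h \<longrightarrow> sum h {0..N} = 0 \<or> (\<exists>p\<in>#P. sum h {0..N} \<le> Suc (fst p))"
    by auto
  show ?thesis
  proof (rule that[of P])
    fix t \<alpha> assume \<alpha>: "\<alpha> \<in> leads (V t)"
    have "V t \<subseteq> filt t"
      using assms unfolding module_filtration_def by blast
    then have "\<alpha> \<in> expo t"
      using \<alpha> leads_expo by blast
    then have ex: "\<alpha> \<in> exponents N" "total_degree N \<alpha> \<le> t"
      by (auto simp: expo_def)
    define h where "h = homogenization N t \<alpha>"
    have "h \<notin> standard_set V"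
      using \<alpha> ex by (simp add: h_def standard_set_def affine_part_homogenization sum_homogenization)
    then obtain g where g: "g \<le> h" "corner {0..N} (standard_set V) g"
      using exists_corner_below[OF _ down homogenization_cube[OF ex(1)], of t] unfolding h_def by auto
    have "affine_part N g \<in> leads (V (sum g {0..N}))"
      using g(2) unfolding corner_def standard_set_def by blast
    moreover have "exp_divides N (affine_part N g) \<alpha>"
      using g(1) by (auto simp: exp_divides_def lookup_affine_part h_def homogenization_def le_fun_def
          split: if_splits)
    ultimately show "\<exists>s \<beta>. \<beta> \<in> leads (V s) \<and> exp_divides N \<beta> \<alpha> \<and> (s = 0 \<or> (\<exists>p\<in>#P. s \<le> Suc (fst p)))"
      using P(4) g(2) by blast
  qed (use P hilbert_standard_set in auto)
qed

section \<open>Left ideals with all generators in degree d\<close>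

definition products :: "nat \<Rightarrow> 'r set \<Rightarrow> nat \<Rightarrow> 'r set" where
  "products d F t = {g * f |g f s. f \<in> F \<and> g \<in> filt s \<and> s + d = t}"

text \<open>Every generator enters in level \<open>d\<close>, whatever its own degree, so all colon
  contributions are shifted by the same amount.\<close>

definition ideal_filtration :: "nat \<Rightarrow> 'r set \<Rightarrow> nat \<Rightarrow> 'r set" where
  "ideal_filtration d F t = span (products d F t)"

lemma module_filtration_ideal:
  assumes "F \<subseteq> filt d"
  shows "module_filtration (ideal_filtration d F)"
  unfolding module_filtration_def
proof (intro conjI allI ballI)
  fix t
  show "subspace (ideal_filtration d F t)"
    by (simp add: ideal_filtration_def)
  show "ideal_filtration d F t \<subseteq> filt t"
    unfolding ideal_filtration_def
  proof (intro span_minimal subspace_filt subsetI)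
    fix y assume "y \<in> products d F t"
    then show "y \<in> filt t"
      using assms filt_mult unfolding products_def by blast
  qed
next
  fix s t g f assume g: "g \<in> filt s" and f: "f \<in> ideal_filtration d F t"
  show "g * f \<in> ideal_filtration d F (s + t)"
  proof (rule span_mult[of g "{g}" f "products d F t"])
    show "f \<in> span (products d F t)"
      using f by (simp add: ideal_filtration_def)
    fix a b assume "a \<in> {g}" "b \<in> products d F t"
    then obtain g' f' s' where *: "a = g" "b = g' * f'" "f' \<in> F" "g' \<in> filt s'" "s' + d = t"
      unfolding products_def by blast
    then have "a * b = (g * g') * f'" "g * g' \<in> filt (s + s')" "(s + s') + d = s + t"
      using filt_mult[OF g] by (auto simp: mult.assoc)
    then have "a * b \<in> products d F (s + t)"
      unfolding products_def using *(3) by blast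
    then show "a * b \<in> ideal_filtration d F (s + t)"
      unfolding ideal_filtration_def by (rule span_base)
  qed (auto simp: ideal_filtration_def intro: span_base)
qed

text \<open>Multiplication by \<open>f\<close> takes place on the right, which leaves the left side
  free for the action of the algebra.\<close>

lemma module_filtration_colon:
  assumes V: "module_filtration V" and f: "f \<in> filt d"
  shows "module_filtration (\<lambda>t. {g \<in> filt t. g * f \<in> V (t + d)})"
  unfolding module_filtration_def
proof (intro conjI allI ballI)
  fix t
  have "subspace (V (t + d))" "V (t + d) \<subseteq> filt (t + d)"
    using V unfolding module_filtration_def by blast+
  then show "subspace {g \<in> filt t. g * f \<in> V (t + d)}"
    by (rule dim_add_multiples(1))
  show "{g \<in> filt t. g * f \<in> V (t + d)} \<subseteq> filt t"
    by blast
next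
  fix s t h g assume h: "h \<in> filt s" and g: "g \<in> {g \<in> filt t. g * f \<in> V (t + d)}"
  then have "h * (g * f) \<in> V (s + (t + d))"
    using V unfolding module_filtration_def by blast
  then show "h * g \<in> {g \<in> filt (s + t). g * f \<in> V (s + t + d)}"
    using filt_mult[OF h] g by (simp add: mult.assoc add.assoc)
qed

lemma ideal_filtration_insert:
  "ideal_filtration d (insert f F) (t + d) =
    span (ideal_filtration d F (t + d) \<union> (\<lambda>g. g * f) ` filt t)"
proof -
  have "products d (insert f F) (t + d) = products d F (t + d) \<union> (\<lambda>g. g * f) ` filt t"
    unfolding products_def by auto
  then show ?thesis
    unfolding ideal_filtration_def by (simp add: span_Un span_span)
qed

lemma ideal_filtration_dim_insert:
  assumes F: "F \<subseteq> filt d" and f: "f \<in> filt d"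
  defines "J \<equiv> \<lambda>t. {g \<in> filt t. g * f \<in> ideal_filtration d F (t + d)}"
  shows "Abs_fps (\<lambda>t. int (dim (ideal_filtration d (insert f F) t))) =
    Abs_fps (\<lambda>t. int (dim (ideal_filtration d F t))) +
    fps_X ^ d * Abs_fps (\<lambda>t. int (card (expo t - leads (J t))))"
proof (rule fps_ext)
  fix t
  show "Abs_fps (\<lambda>t. int (dim (ideal_filtration d (insert f F) t))) $ t =
    (Abs_fps (\<lambda>t. int (dim (ideal_filtration d F t))) +
    fps_X ^ d * Abs_fps (\<lambda>t. int (card (expo t - leads (J t))))) $ t"
  proof (cases "t < d")
    \<comment> \<open>Below level \<open>d\<close> both ideals are zero, and so is the coefficient
      of the shifted series.\<close>
    case True
    then have "products d A t = {}" for A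
      unfolding products_def by auto
    then show ?thesis
      using True by (simp add: ideal_filtration_def fps_X_power_mult_nth)
  next
    case False
    then obtain s where s: "t = s + d"
      by (metis add.commute le_add_diff_inverse not_less)
    have "subspace (ideal_filtration d F (s + d))" "ideal_filtration d F (s + d) \<subseteq> filt (s + d)"
      using module_filtration_ideal[OF F] unfolding module_filtration_def by blast+
    from dim_add_multiples(2)[OF this, where t = s and f = f] show ?thesis
      unfolding s by (simp add: fps_X_power_mult_nth J_def ideal_filtration_insert)
  qed
qed

text \<open>The colon of the zero ideal by \<open>f\<close> is zero since there are no zero
  divisors, so \<open>f\<close> alone contributes a full cone. Each further generator adds a
  0-standard decomposition shifted by \<open>d\<close>, and \<open>d\<close>-standard decompositions
  may be united.\<close>

lemma ideal_filtration_series: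
  assumes "finite F" "F \<subseteq> filt d" "f \<in> filt d" "f \<noteq> 0"
  shows "\<exists>P. standard d P \<and> (\<forall>p\<in>#P. snd p \<le> Suc N) \<and>
    Abs_fps (\<lambda>t. int (dim (ideal_filtration d (insert f F) t))) = fps_X ^ d * geom ^ Suc N + cone_series P"
  using assms(1,2)
proof (induction F)
  case empty
  have zero: "ideal_filtration d {} t = {0}" for t
    by (simp add: ideal_filtration_def products_def)
  have "g * f \<noteq> 0" if "g \<noteq> 0" for g
  proof -
    obtain s where "g \<in> filt s"
      using filt_exhaustive by blast
    then show ?thesis
      using lead_mult(1)[OF that assms(4) _ assms(3)] by blast
  qed
  then have "leads {g \<in> filt t. g * f \<in> {0}} = {}" for t
    unfolding leads_def by blast
  moreover have "dim {0} = 0"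
    using dim_eq_card[of "{}" "{0}"] independent_empty by (simp add: span_insert_0)
  moreover have "Abs_fps (\<lambda>t. 0 :: int) = 0"
    by (rule fps_ext) simp
  ultimately have "Abs_fps (\<lambda>t. int (dim (ideal_filtration d {f} t))) =
      fps_X ^ d * geom ^ Suc N + cone_series {#}"
    using ideal_filtration_dim_insert[of "{}" d f] assms(3) by (simp add: zero card_expo_series)
  moreover have "standard d {#}"
    by (simp add: standard_def)
  ultimately show ?case
    by (intro exI[of _ "{#}"]) simp
next
  case (insert f' F)
  obtain P where P: "standard d P" "\<forall>p\<in>#P. snd p \<le> Suc N"
    "Abs_fps (\<lambda>t. int (dim (ideal_filtration d (insert f F) t))) = fps_X ^ d * geom ^ Suc N + cone_series P"
    using insert.IH insert.prems by blast
  have F: "insert f F \<subseteq> filt d" "f' \<in> filt d"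
    using insert.prems assms(3) by auto
  obtain Q where Q: "cone_series Q = Abs_fps (\<lambda>t. int (card (expo t -
        leads {g \<in> filt t. g * f' \<in> ideal_filtration d (insert f F) (t + d)})))"
    "standard 0 Q" "\<forall>p\<in>#Q. snd p \<le> Suc N"
    by (rule filtration_cone_decomposition[OF
          module_filtration_colon[OF module_filtration_ideal[OF F(1)] F(2)]]) (rule that)
  define Q' where "Q' = image_mset (\<lambda>(e, k). (e + d, k)) Q"
  have "Abs_fps (\<lambda>t. int (dim (ideal_filtration d (insert f' (insert f F)) t))) =
      fps_X ^ d * geom ^ Suc N + cone_series (P + Q')"
    unfolding ideal_filtration_dim_insert[OF F] P(3) Q(1)[symmetric] Q'_def cone_series_union
      cone_series_shift by (simp add: add.assoc)
  moreover have "standard d (P + Q')"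
    using standard_union[OF P(1)] standard_shift[OF Q(2), of d] by (simp add: Q'_def)
  moreover have "\<forall>p\<in>#P + Q'. snd p \<le> Suc N"
    using P(2) Q(3) by (auto simp: Q'_def)
  ultimately show ?case
    unfolding insert_commute[of f f'] by blast
qed

text \<open>In each level the dimension of the ideal and the number of its standard exponents add up
  to the number of all exponents. Both parts have exact decompositions, so the bounds of
  \<open>complementary_exact\<close> apply with \<open>Suc N\<close> variables.\<close>

lemma ideal_filtration_lead_bound:
  assumes F: "finite F" "F \<subseteq> filt d" and f: "f \<in> F" "f \<noteq> 0" and d: "1 \<le> d" and N: "1 \<le> N"
    and \<alpha>: "\<alpha> \<in> leads (ideal_filtration d F t)"
  shows "\<exists>s \<beta>. \<beta> \<in> leads (ideal_filtration d F s) \<and> exp_divides N \<beta> \<alpha> \<and> real s \<le> D_bound N d"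
proof -
  define V where "V = ideal_filtration d F"
  have V: "module_filtration V"
    unfolding V_def by (rule module_filtration_ideal[OF F(2)])
  obtain P where P: "standard d P" "\<forall>p\<in>#P. snd p \<le> Suc N"
    "Abs_fps (\<lambda>t. int (dim (V t))) = fps_X ^ d * geom ^ Suc N + cone_series P"
    using ideal_filtration_series[OF F subsetD[OF F(2) f(1)] f(2)]
    unfolding V_def insert_absorb[OF f(1)] by blast
  obtain Q where Q: "cone_series Q = Abs_fps (\<lambda>t. int (card (expo t - leads (V t))))"
    "standard 0 Q" "\<forall>p\<in>#Q. snd p \<le> Suc N"
    "\<And>t \<alpha>. \<alpha> \<in> leads (V t) \<Longrightarrow> \<exists>s \<beta>. \<beta> \<in> leads (V s) \<and> exp_divides N \<beta> \<alpha> \<and>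
      (s = 0 \<or> (\<exists>p\<in>#Q. s \<le> Suc (fst p)))"
    by (rule filtration_cone_decomposition[OF V]) (rule that)
  obtain a Z where a: "a (Suc (Suc N)) = d" "\<forall>k\<in>{1..Suc N}. a (Suc k) \<le> a k"
    "cone_series P = exact_series (Suc N) a Z"
    using standard_imp_exact[OF P(1,2)] by blast
  obtain b W where b: "b (Suc (Suc N)) = 0" "\<forall>k\<in>{1..Suc N}. b (Suc k) \<le> b k"
    "cone_series Q = exact_series (Suc N) b W" "\<forall>p\<in>#Q. fst p < b 1 \<or> fst p \<in># W"
    using standard_imp_exact[OF Q(2,3)] by blast
  have "geom ^ Suc N = Abs_fps (\<lambda>t. int (dim (V t))) + cone_series Q"
  proof -
    have "int (card (expo t)) = int (dim (V t)) + int (card (expo t - leads (V t)))" for t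
      using dim_complement[of "V t" t] V unfolding module_filtration_def by (metis of_nat_add)
    then show ?thesis
      unfolding card_expo_series[symmetric] Q(1) by (intro fps_ext) simp
  qed
  then have series: "geom ^ Suc N = fps_X ^ d * geom ^ Suc N + exact_series (Suc N) a Z +
      exact_series (Suc N) b W"
    unfolding P(3) a(3) b(3) .
  interpret complementary_exact "Suc N" d a b Z W
    using series a b N by unfold_locales auto
  have A: "0 \<le> (real d)\<^sup>2 / 2 + real d"
    by simp
  have bound: "real (Suc (fst p)) \<le> D_bound N d" if "p \<in># Q" for p
  proof -
    have "real (Suc (fst p)) \<le> 4 / 3 * ((real d)\<^sup>2 / 2 + real d) ^ 2 ^ (Suc N - 2)"
      using b(4) that by (intro degree_bound[OF d]) auto
    \<comment> \<open>\<open>Suc N - 2\<close> is \<open>N - 1\<close>, and the factor 4/3 is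
      relaxed to 2.\<close>
    also have "\<dots> \<le> D_bound N d"
      unfolding D_bound_def using A by (simp add: mult_right_mono)
    finally show ?thesis .
  qed
  obtain s \<beta> where s: "\<beta> \<in> leads (V s)" "exp_divides N \<beta> \<alpha>" "s = 0 \<or> (\<exists>p\<in>#Q. s \<le> Suc (fst p))"
    using Q(4) \<alpha> unfolding V_def by blast
  have "real s \<le> D_bound N d"
    using s(3)
  proof
    assume "s = 0"
    then show ?thesis
      unfolding D_bound_def using A by simp
  next
    assume "\<exists>p\<in>#Q. s \<le> Suc (fst p)"
    then obtain p where "p \<in># Q" "s \<le> Suc (fst p)" by blast
    then show ?thesis
      using bound[of p] by (meson of_nat_mono order_trans)
  qed
  with s show ?thesis
    unfolding V_def by blast
qed

section \<open>Dehomogenization and Groebner bases of bounded degree\<close>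

lemma ideal_filtration_exhausts:
  assumes F: "F \<subseteq> filt d"
  shows "left_ideal hull F = (\<Union>t. ideal_filtration d F t)"
proof
  have V: "subspace (ideal_filtration d F t)" for t
    by (simp add: ideal_filtration_def)
  \<comment> \<open>Raising the level of an element corresponds to multiplying by the homogenizing
    variable; it lets two elements be added in a common level.\<close>
  have mono: "ideal_filtration d F s \<subseteq> ideal_filtration d F t" if "s \<le> t" for s t
    unfolding ideal_filtration_def
  proof (rule span_mono, rule subsetI)
    fix y assume "y \<in> products d F s"
    then obtain g f u where "y = g * f" "f \<in> F" "g \<in> filt u" "u + d = s"
      unfolding products_def by blast
    moreover from this have "u \<le> t - d" "t - d + d = t"
      using that by auto
    ultimately have "g \<in> filt (t - d)" "t - d + d = t"
      using filt_mono by blast+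
    then show "y \<in> products d F t"
      unfolding products_def using \<open>y = g * f\<close> \<open>f \<in> F\<close> by blast
  qed
  show "left_ideal hull F \<subseteq> (\<Union>t. ideal_filtration d F t)"
  proof (rule hull_minimal)
    have "f \<in> ideal_filtration d F d" if "f \<in> F" for f
    proof -
      have "1 \<in> filt 0"
        using mon_filt[of 0 0] by (simp add: expo_def)
      then have "1 * f \<in> products d F d"
        unfolding products_def using that by (intro CollectI exI[of _ 1] exI[of _ f] exI[of _ 0]) auto
      then show ?thesis
        unfolding ideal_filtration_def by (simp add: span_base)
    qed
    then show "F \<subseteq> (\<Union>t. ideal_filtration d F t)"
      by blast
    show "left_ideal (\<Union>t. ideal_filtration d F t)"
      unfolding left_ideal_def
    proof (intro conjI ballI allI)
      show "0 \<in> (\<Union>t. ideal_filtration d F t)"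
        using subspace_0[OF V] by blast
    next
      fix f g assume "f \<in> (\<Union>t. ideal_filtration d F t)" "g \<in> (\<Union>t. ideal_filtration d F t)"
      then obtain s t where "f \<in> ideal_filtration d F s" "g \<in> ideal_filtration d F t" by blast
      then have "f \<in> ideal_filtration d F (max s t)" "g \<in> ideal_filtration d F (max s t)"
        using mono[of s "max s t"] mono[of t "max s t"] by auto
      then show "f + g \<in> (\<Union>t. ideal_filtration d F t)"
        using subspace_add[OF V] by blast
    next
      fix a f assume "f \<in> (\<Union>t. ideal_filtration d F t)"
      then obtain t where "f \<in> ideal_filtration d F t" by blast
      moreover obtain s where "a \<in> filt s"
        using filt_exhaustive by blast
      ultimately have "a * f \<in> ideal_filtration d F (s + t)"
        using module_filtration_ideal[OF F] unfolding module_filtration_def by blast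
      then show "a * f \<in> (\<Union>t. ideal_filtration d F t)"
        by blast
    qed
  qed
  have "products d F t \<subseteq> left_ideal hull F" for t
    using hull_subset[of F left_ideal] left_ideal_hull[of F] unfolding products_def left_ideal_def by blast
  then show "(\<Union>t. ideal_filtration d F t) \<subseteq> left_ideal hull F"
    unfolding ideal_filtration_def using span_minimal[OF _ subspace_left_ideal[OF left_ideal_hull]] by blast
qed

text \<open>One element is chosen for each leading exponent in each level up to the bound, and
  elements of level \<open>s\<close> have degree at most \<open>s\<close>. Including
  \<open>F\<close>, whose degrees are at most \<open>d\<close> and hence within the bound, makes
  generation immediate.\<close>

lemma groebner_basis_nonzero:
  assumes F: "finite F" "F \<subseteq> filt d" and f: "f \<in> F" "f \<noteq> 0" and d: "1 \<le> d" and N: "1 \<le> N"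
  shows "\<exists>G. groebner_basis N x r (left_ideal hull F) G \<and> (\<forall>g\<in>G. real (degree N x g) \<le> D_bound N d)"
proof -
  define V where "V = ideal_filtration d F"
  define I where "I = left_ideal hull F"
  have I: "I = (\<Union>t. V t)"
    unfolding I_def V_def by (rule ideal_filtration_exhausts[OF F(2)])
  have V_filt: "V t \<subseteq> filt t" for t
    using module_filtration_ideal[OF F(2)] unfolding V_def module_filtration_def by blast
  \<comment> \<open>Levels are natural numbers, so the integer part of the real bound is the last
    level to consider.\<close>
  define T where "T = nat \<lfloor>D_bound N d\<rfloor>"
  define pick where "pick = (\<lambda>(t, \<beta>). SOME g. g \<in> V t \<and> g \<noteq> 0 \<and> lead g = \<beta>)"
  define G where "G = F \<union> pick ` (SIGMA t:{..T}. leads (V t))"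
  have pick: "pick (t, \<beta>) \<in> V t \<and> pick (t, \<beta>) \<noteq> 0 \<and> lead (pick (t, \<beta>)) = \<beta>"
    if "\<beta> \<in> leads (V t)" for t \<beta>
  proof -
    have "\<exists>g. g \<in> V t \<and> g \<noteq> 0 \<and> lead g = \<beta>"
      using that unfolding leads_def by blast
    then show ?thesis
      unfolding pick_def prod.case by (rule someI_ex)
  qed
  have dD: "real d \<le> D_bound N d" and D0: "0 \<le> D_bound N d"
  proof -
    define A where "A = (real d)\<^sup>2 / 2 + real d"
    have "real d \<le> A" "1 \<le> A"
      using d by (auto simp: A_def add_increasing)
    moreover from this have "A ^ 1 \<le> A ^ 2 ^ (N - 1)"
      by (intro power_increasing) auto
    ultimately show "real d \<le> D_bound N d" "0 \<le> D_bound N d"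
      unfolding D_bound_def A_def[symmetric] by auto
  qed
  have "finite G"
    unfolding G_def using F(1) finite_subset[OF leads_expo[OF V_filt] finite_expo] by auto
  moreover have "G \<subseteq> I"
    unfolding G_def using hull_subset[of F left_ideal] pick by (auto simp: I I_def[symmetric])
  moreover have "left_ideal hull G = I"
  proof
    show "left_ideal hull G \<subseteq> I"
      using \<open>G \<subseteq> I\<close> left_ideal_hull unfolding I_def by (rule hull_minimal)
    show "I \<subseteq> left_ideal hull G"
      unfolding I_def G_def by (rule hull_mono) simp
  qed
  moreover have "\<exists>g\<in>G. g \<noteq> 0 \<and> exp_divides N (lead g) (lead h)" if h: "h \<in> I" "h \<noteq> 0" for h
  proof -
    obtain t where "h \<in> V t"
      using h(1) I by blast
    then have "lead h \<in> leads (ideal_filtration d F t)"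
      using h(2) unfolding leads_def V_def by blast
    from ideal_filtration_lead_bound[OF F f d N this]
    obtain s \<beta> where s: "\<beta> \<in> leads (V s)" "exp_divides N \<beta> (lead h)" "real s \<le> D_bound N d"
      unfolding V_def by blast
    then have "s \<le> T"
      unfolding T_def by (simp add: le_nat_floor)
    then have "pick (s, \<beta>) \<in> G"
      using s(1) by (auto simp: G_def)
    then show ?thesis
      using pick[OF s(1)] s(2) by auto
  qed
  ultimately have "groebner_basis N x r I G"
    unfolding groebner_basis_def by blast
  moreover have "real (degree N x g) \<le> D_bound N d" if g: "g \<in> G" for g
  proof -
    consider "g \<in> F" | s \<beta> where "s \<le> T" "\<beta> \<in> leads (V s)" "g = pick (s, \<beta>)"
      using g unfolding G_def by auto
    then show ?thesis
    proof cases
      case 1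
      then have "degree N x g \<le> d"
        using F(2) degree_le_iff by blast
      with dD show ?thesis
        by (meson of_nat_mono order_trans)
    next
      case 2
      then have "degree N x g \<le> s"
        using pick V_filt degree_le_iff by blast
      then have "real (degree N x g) \<le> real T"
        using 2(1) by simp
      also have "\<dots> \<le> D_bound N d"
        unfolding T_def using D0 by simp
      finally show ?thesis .
    qed
  qed
  ultimately show ?thesis
    unfolding I_def by blast
qed

text \<open>The case \<open>d = 0\<close>, where the bound itself is 0: a nonzero constant is
  invertible and generates everything.\<close>

lemma groebner_basis_constant:
  assumes "F \<subseteq> filt 0" "f \<in> F" "f \<noteq> 0"
  shows "groebner_basis N x r (left_ideal hull F) {1}" "degree N x 1 = 0"
proof -
  have expo0: "expo 0 = {0}"
  proof -
    have "\<alpha> = 0" if "\<alpha> \<in> exponents N" "total_degree N \<alpha> = 0" for \<alpha>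
      using that by (intro poly_mapping_eqI) (auto simp: total_degree_def exponents_iff)
    then show ?thesis
      by (auto simp: expo_def)
  qed
  then have one: "1 \<in> filt 0"
    using mon_filt[of 0 0] by simp
  then show "degree N x 1 = 0"
    using degree_le_iff[of 1 0] by simp
  have "lead f = 0"
    using lead_expo[of f 0] assms expo0 by auto
  obtain c where "f = c *s 1"
    using assms(1,2) expo0 unfolding filt_def by (auto simp: span_singleton)
  then have inv: "(inverse c *s 1) * f = 1"
    using assms(3) by (auto simp: scale_mult_left)
  have ideal: "left_ideal (left_ideal hull F)"
    by (rule left_ideal_hull)
  have "f \<in> left_ideal hull F"
    by (rule subsetD[OF hull_subset assms(2)])
  with ideal have "(inverse c *s 1) * f \<in> left_ideal hull F"
    unfolding left_ideal_def by blast
  then have one_mem: "1 \<in> left_ideal hull F"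
    unfolding inv .
  have UNIV_I: "J = UNIV" if "left_ideal J" "1 \<in> J" for J :: "'r set"
  proof -
    have "a * 1 \<in> J" for a
      using that unfolding left_ideal_def by blast
    then show ?thesis by auto
  qed
  have "left_ideal hull F = UNIV"
    using UNIV_I[OF ideal one_mem] .
  moreover have "left_ideal hull {1} = (UNIV :: 'r set)"
    using hull_subset[of "{1}" left_ideal] by (intro UNIV_I left_ideal_hull) auto
  moreover have "(1 :: 'r) \<noteq> 0" "lead 1 = 0"
    using lead_expo[OF _ one] expo0 by auto
  ultimately show "groebner_basis N x r (left_ideal hull F) {1}"
    unfolding groebner_basis_def exp_divides_def by simp
qed

text \<open>\<open>S\<close> may be infinite. A maximal independent subset generates the same left
  ideal, since left ideals are subspaces, and it is finite because \<open>filt d\<close> has finite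
  dimension. If it is empty, the ideal is zero and so the empty set is a Groebner basis.\<close>

lemma groebner_basis_exists:
  assumes N: "1 \<le> N" and S: "S \<subseteq> filt d"
  shows "\<exists>G. groebner_basis N x r (left_ideal hull S) G \<and> (\<forall>g\<in>G. real (degree N x g) \<le> D_bound N d)"
proof -
  obtain F where F: "F \<subseteq> S" "independent F" "S \<subseteq> span F"
    by (rule maximal_independent_subset)
  have "F \<subseteq> span (mon ` expo d)"
    using F(1) S unfolding filt_def by (rule order_trans)
  then have "finite F"
    using independent_span_bound[OF finite_imageI[OF finite_expo] F(2)] by blast
  have "left_ideal hull F = left_ideal hull S"
  proof
    show "left_ideal hull F \<subseteq> left_ideal hull S"
      using F(1) by (rule hull_mono)
    have "span F \<subseteq> left_ideal hull F"
      by (rule span_minimal[OF hull_subset subspace_left_ideal[OF left_ideal_hull]])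
    then show "left_ideal hull S \<subseteq> left_ideal hull F"
      using F(3) by (intro hull_minimal left_ideal_hull) blast
  qed
  moreover have "\<exists>G. groebner_basis N x r (left_ideal hull F) G \<and> (\<forall>g\<in>G. real (degree N x g) \<le> D_bound N d)"
  proof (cases "F \<subseteq> {0}")
    case True
    have "left_ideal hull F \<subseteq> {0}"
      using True by (intro hull_minimal) (auto simp: left_ideal_def)
    moreover have "F = {}"
      using dependent_zero[of F] True F(2) by blast
    ultimately show ?thesis
      by (intro exI[of _ "{}"]) (auto simp: groebner_basis_def)
  next
    case False
    then obtain f where f: "f \<in> F" "f \<noteq> 0"
      by blast
    have F_filt: "F \<subseteq> filt d"
      using F(1) S by (rule order_trans)
    show ?thesis
    proof (cases "d = 0")
      case True
      have "0 \<le> D_bound N d"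
        by (simp add: D_bound_def)
      with groebner_basis_constant[of F f] F_filt f True show ?thesis
        by (intro exI[of _ "{1}"]) auto
    next
      case False
      then show ?thesis
        using groebner_basis_nonzero[OF \<open>finite F\<close> F_filt f _ N] by simp
    qed
  qed
  ultimately show ?thesis
    by simp
qed

end

theorem theorem0p1:
  fixes scale :: "'k::field \<Rightarrow> 'r::ring_1 \<Rightarrow> 'r"
    and N d :: nat
    and x :: "nat \<Rightarrow> 'r"
    and r :: "(nat \<Rightarrow>\<^sub>0 nat) rel"
    and S :: "'r set"
  assumes "k_algebra scale"
    and "N \<ge> 1"
    and "monomial_ordering N r"
    and "k_algebra.solvable_type scale N x r"
    and "k_algebra.quadric scale N x r"
    and "\<forall>f\<in>S. k_algebra.degree scale N x f \<le> d"
  shows "\<exists>G. k_algebra.groebner_basis scale N x r (left_ideal hull S) G \<and>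
             (\<forall>g\<in>G. real (k_algebra.degree scale N x g) \<le> D_bound N d)"
proof -
  interpret quadric_solvable scale N x r
    using assms by (simp add: quadric_solvable_def quadric_solvable_axioms_def)
  have "S \<subseteq> filt d"
    using assms(6) degree_le_iff by blast
  with assms(2) show ?thesis
    by (rule groebner_basis_exists)
qed

end
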